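(* Let $R:\hat{\mathbb{C}}\to\hat{\mathbb{C}}$ be a rational function of degree $d$ ($d\ge 1$), let $\zeta_1,\dots,\zeta_d$ be the zeros and $p_1,\dots,p_d$ the poles of $R$ in $\hat{\mathbb{C}}$ (each repeated according to multiplicity), and let $\Omega:=R^{-1}(\mathbb{D})=\{z\in\hat{\mathbb{C}}:|R(z)|<1\}$. Then \[ \sum_{i=1}^{d}\omega_{p_i}^{\hat{\mathbb{C}}\setminus\overline{\Omega}}(E)=\sum_{j=1}^{d}\omega_{\zeta_j}^{\Omega}(E) \] for every Borel set $E\subset\partial\Omega$.
   Context: $\mathbb{D}=\{z\in\mathbb{C}:|z|<1\}$ is the unit disc and $\hat{\mathbb{C}}$ is the extended complex plane; closures and boundaries are taken in $\hat{\mathbb{C}}$. For an open set $D\subset\hat{\mathbb{C}}$ whose complement has positive logarithmic capacity and a point $a\in D$, $\omega_a^D$ denotes the harmonic measure of $D$ with respect to $a$; when $D$ is not connected, this is the harmonic measure at $a$ of the connected component $D_a$ of $D$ containing $a$, i.e. $\omega_a^D(E)=\omega_a^{D_a}(E\cap\partial D_a)$ for Borel $E\subset\partial D$. *)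

theory Defs
  imports "HOL-Complex_Analysis.Complex_Analysis" "HOL-Probability.Probability"
begin

section \<open>The extended complex plane\<close>

datatype riemann_sphere = Fin (the_Fin: complex) | Infty

text \<open>Inverse stereographic projection onto the unit sphere of \<open>complex \<times> real\<close>. The Euclidean
  distance there induces the chordal metric, and hence the usual topology, on the extended plane.\<close>

fun stereographic :: "riemann_sphere \<Rightarrow> complex \<times> real" where
  "stereographic (Fin z) =
     ((2 / (1 + (cmod z)\<^sup>2)) *\<^sub>R z, ((cmod z)\<^sup>2 - 1) / (1 + (cmod z)\<^sup>2))"
| "stereographic Infty = (0, 1)"

lemma stereographic_snd_Fin: "1 - snd (stereographic (Fin z)) = 2 / (1 + (cmod z)\<^sup>2)"
proof -
  have "1 + (cmod z)\<^sup>2 \<noteq> 0"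
    by (metis add_pos_nonneg less_irrefl zero_le_power2 zero_less_one)
  then show ?thesis
    by (simp add: field_simps)
qed

lemma inj_stereographic: "inj stereographic"
proof (rule injI)
  fix x y :: riemann_sphere
  assume eq: "stereographic x = stereographic y"
  have pos: "2 / (1 + (cmod z)\<^sup>2) > 0" for z
    by (intro divide_pos_pos add_pos_nonneg) auto
  have ne: "stereographic (Fin z) \<noteq> stereographic Infty" for z
    using stereographic_snd_Fin[of z] pos[of z] by (metis diff_self less_irrefl snd_conv stereographic.simps(2))
  show "x = y"
  proof (cases x)
    case (Fin a)
    then obtain b where b: "y = Fin b"
      using eq ne by (cases y) auto
    have "2 / (1 + (cmod a)\<^sup>2) = 2 / (1 + (cmod b)\<^sup>2)"
      using eq Fin b stereographic_snd_Fin by metis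
    moreover have "(2 / (1 + (cmod a)\<^sup>2)) *\<^sub>R a = (2 / (1 + (cmod b)\<^sup>2)) *\<^sub>R b"
      using eq Fin b by simp
    ultimately have "a = b"
      using pos[of b] by (metis less_irrefl scaleR_cancel_left)
    then show ?thesis
      using Fin b by simp
  next
    case Infty
    then show ?thesis
      using eq ne by (cases y) metis+
  qed
qed

instantiation riemann_sphere :: metric_space
begin

definition dist_riemann_sphere :: "riemann_sphere \<Rightarrow> riemann_sphere \<Rightarrow> real" where
  "dist_riemann_sphere x y = dist (stereographic x) (stereographic y)"

definition uniformity_riemann_sphere :: "(riemann_sphere \<times> riemann_sphere) filter" where
  "uniformity_riemann_sphere = (INF e\<in>{0<..}. principal {(x, y). dist x y < e})"

definition open_riemann_sphere :: "riemann_sphere set \<Rightarrow> bool" where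
  "open_riemann_sphere U \<longleftrightarrow>
     (\<forall>x\<in>U. eventually (\<lambda>(x', y). x' = x \<longrightarrow> y \<in> U) uniformity)"

instance
proof
  fix x y z :: riemann_sphere
  show "dist x y = 0 \<longleftrightarrow> x = y"
    by (simp add: dist_riemann_sphere_def inj_eq[OF inj_stereographic])
  show "dist x y \<le> dist x z + dist y z"
    by (simp add: dist_riemann_sphere_def dist_triangle2)
qed (rule uniformity_riemann_sphere_def open_riemann_sphere_def)+

end

fun sphere_inverse :: "riemann_sphere \<Rightarrow> riemann_sphere" where
  "sphere_inverse (Fin z) = (if z = 0 then Infty else Fin (inverse z))"
| "sphere_inverse Infty = Fin 0"


section \<open>Rational functions\<close>

text \<open>The quotient of two coprime polynomials; its value at \<open>Infty\<close> is the limit of \<open>p / q\<close>.\<close>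

fun poly_quotient :: "complex poly \<Rightarrow> complex poly \<Rightarrow> riemann_sphere \<Rightarrow> riemann_sphere" where
  "poly_quotient p q (Fin z) = (if poly q z = 0 then Infty else Fin (poly p z / poly q z))"
| "poly_quotient p q Infty =
     (if degree p > degree q then Infty else Fin (coeff p (degree q) / lead_coeff q))"

definition rational_function :: "(riemann_sphere \<Rightarrow> riemann_sphere) \<Rightarrow> nat \<Rightarrow> bool" where
  "rational_function R d \<longleftrightarrow>
     (\<exists>p q. q \<noteq> 0 \<and> coprime p q \<and> R = poly_quotient p q \<and> d = max (degree p) (degree q))"

text \<open>A local holomorphic parametrization of a neighbourhood of \<open>x\<close>, taking 0 to \<open>x\<close>.\<close>

fun local_chart :: "riemann_sphere \<Rightarrow> complex \<Rightarrow> riemann_sphere" where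
  "local_chart (Fin a) z = Fin (a + z)"
| "local_chart Infty z = sphere_inverse (Fin z)"

definition zero_multiplicity :: "(riemann_sphere \<Rightarrow> riemann_sphere) \<Rightarrow> riemann_sphere \<Rightarrow> nat" where
  "zero_multiplicity R x =
     (if R x = Fin 0 then nat (zorder (\<lambda>z. the_Fin (R (local_chart x z))) 0) else 0)"

definition pole_multiplicity :: "(riemann_sphere \<Rightarrow> riemann_sphere) \<Rightarrow> riemann_sphere \<Rightarrow> nat" where
  "pole_multiplicity R x = zero_multiplicity (sphere_inverse \<circ> R) x"


section \<open>Harmonic measure\<close>

definition subharmonic_on :: "(complex \<Rightarrow> real) \<Rightarrow> complex set \<Rightarrow> bool" where
  "subharmonic_on u U \<longleftrightarrow> continuous_on U u \<and>
     (\<forall>z r. r > 0 \<and> cball z r \<subseteq> U \<longrightarrow>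
        u z \<le> 1 / (2 * pi) * integral {0..2 * pi} (\<lambda>t. u (z + of_real r * exp (\<i> * of_real t))))"

text \<open>Subharmonicity is invariant under holomorphic changes of coordinate, so on the sphere it is
  tested in the two charts \<open>z\<close> and \<open>1/z\<close>.\<close>

definition sphere_subharmonic_on :: "(riemann_sphere \<Rightarrow> real) \<Rightarrow> riemann_sphere set \<Rightarrow> bool" where
  "sphere_subharmonic_on u D \<longleftrightarrow>
     subharmonic_on (\<lambda>z. u (Fin z)) {z. Fin z \<in> D} \<and>
     subharmonic_on (\<lambda>z. u (sphere_inverse (Fin z))) {z. sphere_inverse (Fin z) \<in> D}"

definition perron_family ::
  "riemann_sphere set \<Rightarrow> (riemann_sphere \<Rightarrow> real) \<Rightarrow> (riemann_sphere \<Rightarrow> real) set" where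
  "perron_family D \<phi> = {u. sphere_subharmonic_on u D \<and>
     (\<forall>\<zeta>\<in>frontier D. Limsup (at \<zeta> within D) (\<lambda>z. ereal (u z)) \<le> ereal (\<phi> \<zeta>))}"

definition perron_solution ::
  "riemann_sphere set \<Rightarrow> (riemann_sphere \<Rightarrow> real) \<Rightarrow> riemann_sphere \<Rightarrow> real" where
  "perron_solution D \<phi> a = (SUP u\<in>perron_family D \<phi>. u a)"

text \<open>For a domain \<open>D\<close> with non-polar complement, harmonic measure at \<open>a\<close> is the unique Borel
  probability measure on the boundary that represents the generalized (Perron) solutions of the
  Dirichlet problem at \<open>a\<close>.\<close>

definition is_harmonic_measure ::
  "riemann_sphere set \<Rightarrow> riemann_sphere \<Rightarrow> riemann_sphere measure \<Rightarrow> bool" where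
  "is_harmonic_measure D a \<mu> \<longleftrightarrow>
     prob_space \<mu> \<and> sets \<mu> = sets (restrict_space borel (frontier D)) \<and>
     (\<forall>\<phi>. continuous_on (frontier D) \<phi> \<longrightarrow> perron_solution D \<phi> a = (\<integral>\<zeta>. \<phi> \<zeta> \<partial>\<mu>))"

definition harmonic_measure ::
  "riemann_sphere set \<Rightarrow> riemann_sphere \<Rightarrow> riemann_sphere set \<Rightarrow> real" where
  "harmonic_measure D a E =
     (let D\<^sub>a = connected_component_set D a
      in measure (THE \<mu>. is_harmonic_measure D\<^sub>a a \<mu>) (E \<inter> frontier D\<^sub>a))"

end

theory Submission
  imports Defs
begin

text \<open>For a continuous boundary function \<open>\<phi>\<close> let \<open>H\<close> be the Perron solution on \<open>\<Omega>\<close>. It is harmonic, and a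
  truncation of \<open>Re (cnj c * R) - 1\<close> with \<open>c = R x\<close> is a barrier at each boundary point \<open>x\<close>, so \<open>H\<close> attains
  the boundary values \<open>\<phi>\<close>. Since \<open>R\<close> looks locally like \<open>s \<mapsto> c + s\<^sup>m\<close>, summing \<open>H\<close> over the fibres of \<open>R\<close>
  with multiplicity gives a harmonic function on the unit disc, continuous up to the circle. Its value at
  the centre, which is the sum of \<open>H\<close> over the zeros of \<open>R\<close>, is therefore the mean over the circle of
  the fibre sums of \<open>\<phi>\<close>. That mean does not change when \<open>R\<close> is replaced by \<open>1/R\<close>, which exchanges \<open>\<Omega>\<close>
  with the complement of its closure and zeros with poles. So the two sums of harmonic measures integrate
  every continuous function to the same value.\<close>

section \<open>Circle means and the maximum principle\<close>

text \<open>\<open>harmonic_measure\<close> is a \<open>THE\<close> over measures on the frontier of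
  one component, so it says nothing before existence and uniqueness are known. Existence comes from
  representing the functional that sends boundary data to the Perron solution at a point; its
  linearity is obtained from attained boundary values, hence the barriers. Uniqueness holds because
  continuous functions separate finite Borel measures. \<open>\<Omega>\<close> need not be
  connected. Perron's method is therefore run on all of \<open>\<Omega>\<close>, with a maximum
  principle that uses only the connectedness of the sphere, and a component enters at the end, by
  restricting the solution. Fibres may contain critical points, also over the boundary circle, so
  \<open>R\<close> is not treated as a covering: the normal form \<open>c + s ^ m\<close> serves
  every point alike, and a circle mean in \<open>w\<close> turns into \<open>m\<close> times a
  circle mean in \<open>s\<close>. Harmonicity is carried by \<open>re_limit\<close>, which passes
  through charts and through the coordinates \<open>s\<close> by mere composition.\<close>

definition circle_mean :: "(complex \<Rightarrow> real) \<Rightarrow> complex \<Rightarrow> real \<Rightarrow> real" where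
  "circle_mean u z r =
     1 / (2 * pi) * integral {0..2 * pi} (\<lambda>t. u (z + of_real r * exp (\<i> * of_real t)))"

lemma circle_point_in_sphere:
  "r \<ge> 0 \<Longrightarrow> z + of_real r * exp (\<i> * of_real t) \<in> sphere z r"
  by (simp add: dist_norm norm_mult)

lemma sphere_circle_point:
  assumes "w \<in> sphere z r"
  obtains t where "0 \<le> t" "t < 2 * pi" "w = z + of_real r * exp (\<i> * of_real t)"
proof -
  have "norm (w - z) = r" using assms by (simp add: dist_norm norm_minus_commute)
  then have "w - z = of_real r * exp (\<i> * of_real (Arg2pi (w - z)))"
    using Arg2pi_eq[of "w - z"] by simp
  then show thesis
    using that[of "Arg2pi (w - z)"] Arg2pi_ge_0 Arg2pi_lt_2pi by (simp add: algebra_simps)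
qed

lemma continuous_on_circle:
  assumes "continuous_on (sphere z r) u" "r \<ge> 0"
  shows "continuous_on T (\<lambda>t. u (z + of_real r * exp (\<i> * of_real t)))"
  by (rule continuous_on_compose2[OF assms(1)])
     (use circle_point_in_sphere[OF assms(2)] in \<open>auto intro!: continuous_intros\<close>)

lemma integrable_on_circle:
  fixes u :: "complex \<Rightarrow> real"
  assumes "continuous_on (sphere z r) u" "r \<ge> 0"
  shows "(\<lambda>t. u (z + of_real r * exp (\<i> * of_real t))) integrable_on {0..2 * pi}"
  by (rule integrable_continuous_real[OF continuous_on_circle[OF assms]])

lemma circle_mean_mono:
  assumes "continuous_on (sphere z r) u" "continuous_on (sphere z r) v" "r \<ge> 0"
    and "\<And>w. w \<in> sphere z r \<Longrightarrow> u w \<le> v w"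
  shows "circle_mean u z r \<le> circle_mean v z r"
  unfolding circle_mean_def
  by (intro mult_left_mono integral_le integrable_on_circle assms circle_point_in_sphere) auto

lemma circle_mean_cong:
  assumes "r \<ge> 0" and "\<And>w. w \<in> sphere z r \<Longrightarrow> u w = v w"
  shows "circle_mean u z r = circle_mean v z r"
  unfolding circle_mean_def
  using assms(2)[OF circle_point_in_sphere[OF assms(1)]] by simp

lemma circle_mean_const [simp]: "circle_mean (\<lambda>_. c) z r = c"
  by (simp add: circle_mean_def)

lemma circle_mean_add:
  assumes "continuous_on (sphere z r) u" "continuous_on (sphere z r) v" "r \<ge> 0"
  shows "circle_mean (\<lambda>w. u w + v w) z r = circle_mean u z r + circle_mean v z r"
  unfolding circle_mean_def
  using integral_add[OF integrable_on_circle[OF assms(1,3)] integrable_on_circle[OF assms(2,3)]]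
  by (simp add: algebra_simps)

lemma circle_mean_diff:
  assumes "continuous_on (sphere z r) u" "continuous_on (sphere z r) v" "r \<ge> 0"
  shows "circle_mean (\<lambda>w. u w - v w) z r = circle_mean u z r - circle_mean v z r"
  unfolding circle_mean_def
  using integral_diff[OF integrable_on_circle[OF assms(1,3)] integrable_on_circle[OF assms(2,3)]]
  by (simp add: diff_divide_distrib)

lemma circle_mean_cmult: "circle_mean (\<lambda>w. c * u w) z r = c * circle_mean u z r"
  unfolding circle_mean_def by simp

lemma circle_mean_uminus: "circle_mean (\<lambda>w. - u w) z r = - circle_mean u z r"
  using circle_mean_cmult[of "-1"] by simp

text \<open>A nonnegative continuous function with integral 0 vanishes everywhere, so a single point
  where \<open>M - u\<close> is positive makes its integral over the circle positive.\<close>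

lemma circle_mean_strict:
  assumes cont: "continuous_on (sphere z r) u" and r: "r \<ge> 0"
    and le: "\<And>w. w \<in> sphere z r \<Longrightarrow> u w \<le> M"
    and w: "w \<in> sphere z r" "u w < M"
  shows "circle_mean u z r < M"
proof -
  let ?g = "\<lambda>t. M - u (z + of_real r * exp (\<i> * of_real t))"
  obtain t where t: "0 \<le> t" "t < 2 * pi" "w = z + of_real r * exp (\<i> * of_real t)"
    using sphere_circle_point[OF w(1)] by blast
  have contg: "continuous_on {0..2*pi} ?g"
    by (intro continuous_intros continuous_on_circle cont r)
  have nn: "?g s \<ge> 0" for s
    using le[OF circle_point_in_sphere[OF r]] by simp
  have "integral {0..2*pi} ?g \<noteq> 0"
  proof
    assume "integral {0..2*pi} ?g = 0"
    then have "(?g has_integral 0) (cbox 0 (2*pi))"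
      using integrable_continuous_real[OF contg] by (metis cbox_interval has_integral_integral)
    then have "?g t = 0"
      using has_integral_0_cbox_imp_0[of 0 "2*pi" ?g t] contg nn t by auto
    then show False using w t by simp
  qed
  moreover have "integral {0..2*pi} ?g \<ge> 0"
    by (rule integral_nonneg[OF integrable_continuous_real[OF contg]]) (use nn in auto)
  ultimately have "integral {0..2*pi} ?g > 0" by simp
  moreover have "circle_mean (\<lambda>w. M - u w) z r = M - circle_mean u z r"
    using circle_mean_diff[of z r "\<lambda>_. M" u] cont r by simp
  ultimately show ?thesis
    unfolding circle_mean_def by (simp add: zero_less_mult_iff field_simps)
qed

text \<open>Cauchy's integral formula at the centre: in the parametrised integral the derivative of
  the circle path cancels the denominator \<open>u - z\<close> up to the factor
  \<open>2 * pi * \<i>\<close>.\<close>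

lemma circle_mean_Re:
  assumes "P holomorphic_on ball z r" "continuous_on (cball z r) P" "r > 0"
  shows "circle_mean (\<lambda>w. Re (P w)) z r = Re (P z)"
proof -
  let ?g = "\<lambda>t::real. P (z + of_real r * exp (\<i> * of_real t))"
  have "((\<lambda>u. P u / (u - z)) has_contour_integral (2 * of_real pi * \<i> * P z)) (circlepath z r)"
    by (rule Cauchy_integral_circlepath) (use assms in auto)
  then have "((\<lambda>t. P (z + of_real r * exp (2 * of_real pi * \<i> * of_real t)) / (r * exp (2 * of_real pi * \<i> * of_real t)) *
      (2 * pi * \<i> * r * exp (2 * of_real pi * \<i> * of_real t)))
     has_integral 2 * of_real pi * \<i> * P z) {0..1}"
    unfolding has_contour_integral_def
    by (rule has_integral_eq[rotated]) (subst vector_derivative_circlepath01, simp_all add: circlepath)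
  then have "((\<lambda>t. (2 * of_real pi * \<i>) * ?g (2 * pi * t)) has_integral 2 * of_real pi * \<i> * P z) {0..1}"
    by (rule has_integral_eq[rotated]) (use assms in \<open>simp add: mult_ac\<close>)
  then have "((\<lambda>t. ?g (2 * pi * t)) has_integral P z) {0..1}"
    by (subst (asm) has_integral_mult_right_iff) auto
  \<comment> \<open>Affine substitution carrying the parameter interval of
    \<open>circlepath\<close>, the unit interval, to \<open>{0..2*pi}\<close>.\<close>
  then have "((\<lambda>t. ?g (2 * pi * (inverse (2*pi) * t + 0))) has_integral (1 / \<bar>inverse (2*pi)\<bar>) *\<^sub>R P z)
               ((\<lambda>x. (1 / inverse (2*pi)) *\<^sub>R x + - ((1 / inverse (2*pi)) *\<^sub>R 0)) ` cbox 0 1)"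
    using has_integral_affinity[of "\<lambda>t. ?g (2 * pi * t)" "P z" 0 1 "inverse (2*pi)" 0] by simp
  moreover have "((\<lambda>x. (1 / inverse (2*pi)) *\<^sub>R x + - ((1 / inverse (2*pi)) *\<^sub>R 0)) ` cbox 0 1) = {0..2*pi}"
  proof -
    have eq: "(\<lambda>x. (1 / inverse (2*pi)) *\<^sub>R x + - ((1 / inverse (2*pi)) *\<^sub>R 0)) = (*) (2*pi)"
      by (simp add: fun_eq_iff field_simps)
    show ?thesis unfolding eq using image_mult_atLeastAtMost[of "2*pi" 0 1] by simp
  qed
  moreover have "2 * pi * (inverse (2*pi) * t + 0) = t" for t
    by (simp add: field_simps)
  moreover have "1 / \<bar>inverse (2*pi)\<bar> = 2 * pi"
    by (simp add: field_simps)
  ultimately have "(?g has_integral (2*pi) *\<^sub>R P z) {0..2*pi}"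
    by (simp only:)
  then have "((\<lambda>t. Re (?g t)) has_integral Re ((2*pi) *\<^sub>R P z)) {0..2*pi}"
    by (rule has_integral_Re)
  then show ?thesis
    unfolding circle_mean_def by (simp add: integral_unique)
qed

text \<open>Testing small radii only makes the property local: it survives gluing and the passage to
  a majorant that agrees at \<open>z\<close>. For continuous functions on open sets the inequality
  for all admissible radii is recovered in \<open>subharmonic_onI\<close>.\<close>

definition locally_submean :: "(complex \<Rightarrow> real) \<Rightarrow> complex \<Rightarrow> bool" where
  "locally_submean u z \<longleftrightarrow> (\<forall>\<^sub>F r in at_right 0. u z \<le> circle_mean u z r)"

lemma eventually_cball_subset:
  fixes z :: complex
  assumes "open U" "z \<in> U"
  shows "\<forall>\<^sub>F r in at_right 0. r > 0 \<and> cball z r \<subseteq> U"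
proof -
  obtain e where e: "e > 0" "cball z e \<subseteq> U"
    using assms open_contains_cball by blast
  have "r > 0 \<and> cball z r \<subseteq> U" if "0 < r" "r < e" for r
    using that e subset_cball[of r e z] by auto
  then show ?thesis
    using e eventually_at_right_real[of 0 e] by (auto elim!: eventually_mono)
qed

lemma locally_submeanI:
  assumes "open U" "z \<in> U" "\<And>r. r > 0 \<Longrightarrow> cball z r \<subseteq> U \<Longrightarrow> u z \<le> circle_mean u z r"
  shows "locally_submean u z"
  unfolding locally_submean_def
  using eventually_cball_subset[OF assms(1,2)] by (rule eventually_mono) (use assms(3) in auto)

text \<open>Raising \<open>u\<close> away from \<open>z\<close> can only raise its circle means,
  while the value at \<open>z\<close> stays. Maxima, truncated barriers and Poisson modifications
  get their sub-mean property in this way.\<close>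

lemma locally_submean_le:
  assumes "locally_submean u z" "open U" "z \<in> U" "continuous_on U u" "continuous_on U v"
    and "\<And>w. w \<in> U \<Longrightarrow> u w \<le> v w" "v z = u z"
  shows "locally_submean v z"
proof -
  have "\<forall>\<^sub>F r in at_right 0. v z \<le> circle_mean v z r"
    using assms(1)[unfolded locally_submean_def] eventually_cball_subset[OF assms(2,3)]
  proof eventually_elim
    case (elim r)
    then have "circle_mean u z r \<le> circle_mean v z r"
      by (intro circle_mean_mono continuous_on_subset[OF assms(4)] continuous_on_subset[OF assms(5)] assms(6))
         (auto simp: subset_iff)
    then show ?case using elim assms(7) by simp
  qed
  then show ?thesis by (simp add: locally_submean_def)
qed

lemma locally_submean_cong:
  assumes "open U" "z \<in> U" "\<And>w. w \<in> U \<Longrightarrow> u w = v w"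
  shows "locally_submean u z \<longleftrightarrow> locally_submean v z"
proof -
  have "\<forall>\<^sub>F r in at_right 0. circle_mean u z r = circle_mean v z r"
    using eventually_cball_subset[OF assms(1,2)]
    by (rule eventually_mono) (auto intro!: circle_mean_cong assms(3) simp: subset_iff)
  then have "(\<forall>\<^sub>F r in at_right 0. u z \<le> circle_mean u z r) \<longleftrightarrow> (\<forall>\<^sub>F r in at_right 0. v z \<le> circle_mean v z r)"
    by (intro eventually_subst) (use assms in \<open>auto elim: eventually_mono\<close>)
  then show ?thesis by (simp add: locally_submean_def)
qed

lemma locally_submean_add:
  assumes "locally_submean u z" "locally_submean v z" "open U" "z \<in> U"
    "continuous_on U u" "continuous_on U v"
  shows "locally_submean (\<lambda>w. u w + v w) z"
  unfolding locally_submean_def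
  using assms(1,2)[unfolded locally_submean_def] eventually_cball_subset[OF assms(3,4)]
proof eventually_elim
  case (elim r)
  then have "circle_mean (\<lambda>w. u w + v w) z r = circle_mean u z r + circle_mean v z r"
    by (intro circle_mean_add continuous_on_subset[OF assms(5)] continuous_on_subset[OF assms(6)])
       (auto simp: subset_iff)
  with elim show ?case by simp
qed

text \<open>Among the points where a positive maximum is attained, take one with the largest real
  part. Every small circle around it contains a point further to the right, where \<open>s\<close>
  is smaller, so the circle mean falls strictly below the maximum.\<close>

lemma max_principle_ball:
  assumes cont: "continuous_on (cball c r) s"
    and bd: "\<And>z. z \<in> sphere c r \<Longrightarrow> s z \<le> 0"
    and sub: "\<And>z. z \<in> ball c r \<Longrightarrow> locally_submean s z"
    and z: "z \<in> cball c r"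
  shows "s z \<le> 0"
proof (rule ccontr)
  assume "\<not> s z \<le> 0"
  obtain m where m: "m \<in> cball c r" "\<And>y. y \<in> cball c r \<Longrightarrow> s y \<le> s m"
  proof -
    have "cball c r \<noteq> {}" using z by blast
    from continuous_attains_sup[OF compact_cball this cont] show thesis using that by blast
  qed
  have pos: "s m > 0" using m(2)[OF z] \<open>\<not> s z \<le> 0\<close> by simp
  define K where "K = {y \<in> cball c r. s y = s m}"
  have "closed K"
  proof -
    have "closed (cball c r \<inter> s -` {s m})"
      by (rule continuous_closed_preimage[OF cont]) auto
    then show ?thesis by (simp add: K_def vimage_def Int_def)
  qed
  then have "compact K"
    by (metis (no_types, lifting) K_def bounded_cball bounded_subset compact_eq_bounded_closed mem_Collect_eq subsetI)
  moreover have "K \<noteq> {}" using m by (auto simp: K_def)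
  ultimately obtain x where x: "x \<in> K" "\<And>y. y \<in> K \<Longrightarrow> Re y \<le> Re x"
    using continuous_attains_sup[of K Re] continuous_on_Re[OF continuous_on_id] by blast
  have xb: "x \<in> ball c r"
  proof -
    have "x \<notin> sphere c r" using bd[of x] pos x(1) by (force simp: K_def)
    then show ?thesis using x(1) by (auto simp: K_def)
  qed
  have "\<forall>\<^sub>F \<rho> in at_right 0. s x \<le> circle_mean s x \<rho>"
    using sub[OF xb] by (simp add: locally_submean_def)
  \<comment> \<open>\<open>\<rho> \<noteq> \<rho>\<close> stands for falsity: the filter
    \<open>at_right 0\<close> is nontrivial, so it cannot hold eventually.\<close>
  then have "\<forall>\<^sub>F \<rho> in at_right (0::real). \<rho> \<noteq> \<rho>"
    using eventually_cball_subset[OF open_ball xb]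
  proof eventually_elim
    case (elim \<rho>)
    then have sp: "sphere x \<rho> \<subseteq> cball c r" by (auto simp: subset_iff less_imp_le)
    have inS: "x + of_real \<rho> \<in> sphere x \<rho>" using elim by (simp add: dist_norm)
    have "x + of_real \<rho> \<notin> K" using x(2)[of "x + of_real \<rho>"] elim by auto
    then have lt: "s (x + of_real \<rho>) < s m"
      using m(2)[of "x + of_real \<rho>"] sp inS by (force simp: K_def)
    have "circle_mean s x \<rho> < s m"
      by (rule circle_mean_strict[OF continuous_on_subset[OF cont sp] _ _ inS lt])
         (use elim sp m(2) in auto)
    then show ?case using elim x(1) by (simp add: K_def)
  qed
  then show False by simp
qed

text \<open>The working form of harmonicity. The mean value property and invariance under
  holomorphic substitution are inherited from the approximants, without second derivatives. Since
  \<open>U\<close> need not be open, a closed disc as \<open>U\<close> encodes continuity up to the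
  circle.\<close>

definition re_limit :: "(complex \<Rightarrow> real) \<Rightarrow> complex set \<Rightarrow> bool" where
  "re_limit h U \<longleftrightarrow> (\<exists>P. (\<forall>n::nat. P n holomorphic_on U) \<and>
     uniform_limit U (\<lambda>n z. Re (P n z)) h sequentially)"

lemma re_limit_continuous:
  assumes "re_limit h U" shows "continuous_on U h"
proof -
  obtain P where P: "\<And>n::nat. P n holomorphic_on U" "uniform_limit U (\<lambda>n z. Re (P n z)) h sequentially"
    using assms by (auto simp: re_limit_def)
  show ?thesis
    by (rule uniform_limit_theorem[OF _ P(2)])
       (auto intro!: always_eventually continuous_on_Re holomorphic_on_imp_continuous_on P)
qed

lemma re_limit_mean:
  assumes "re_limit h U" "cball z r \<subseteq> U" "r > 0"
  shows "circle_mean h z r = h z"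
proof -
  obtain P where P: "\<And>n::nat. P n holomorphic_on U" "uniform_limit U (\<lambda>n z. Re (P n z)) h sequentially"
    using assms by (auto simp: re_limit_def)
  have sp: "sphere z r \<subseteq> U" using assms by auto
  have ch: "continuous_on (sphere z r) h"
    using re_limit_continuous[OF assms(1)] sp by (rule continuous_on_subset)
  \<comment> \<open>One \<open>e\<close> pays for replacing \<open>h\<close> by
    \<open>Re (P n w)\<close> under the mean, the other for doing so at the centre.\<close>
  have "\<bar>circle_mean h z r - h z\<bar> \<le> 2 * e" if "e > 0" for e
  proof -
    have "\<forall>\<^sub>F n in sequentially. \<forall>w\<in>U. dist (Re (P n w)) (h w) < e"
      using P(2) that by (simp add: uniform_limit_iff)
    then obtain n where n: "\<And>w. w \<in> U \<Longrightarrow> \<bar>Re (P n w) - h w\<bar> < e"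
      by (metis (no_types, lifting) dist_real_def eventually_sequentially order_refl)
    have cp: "continuous_on (sphere z r) (\<lambda>w. Re (P n w))"
      using P(1) sp by (intro continuous_on_Re holomorphic_on_imp_continuous_on) (auto intro: holomorphic_on_subset)
    have zU: "z \<in> U" using assms by auto
    have eq: "circle_mean (\<lambda>w. Re (P n w)) z r = Re (P n z)"
      by (intro circle_mean_Re holomorphic_on_imp_continuous_on holomorphic_on_subset[OF P(1)])
         (use assms in auto)
    have "circle_mean h z r \<le> circle_mean (\<lambda>w. Re (P n w) + e) z r"
      using n sp by (intro circle_mean_mono ch continuous_intros cp) (use assms(3) in \<open>force+\<close>)
    moreover have "circle_mean (\<lambda>w. Re (P n w) + (- e)) z r \<le> circle_mean h z r"
      using n sp by (intro circle_mean_mono ch continuous_intros cp) (use assms(3) in \<open>force+\<close>)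
    moreover have mc: "circle_mean (\<lambda>w. Re (P n w) + c) z r = Re (P n z) + c" for c
      using circle_mean_add[OF cp continuous_on_const] assms(3) eq by simp
    ultimately show ?thesis
      using n[OF zU] mc[of e] mc[of "- e"] by linarith
  qed
  from this[of "\<bar>circle_mean h z r - h z\<bar> / 4"] show ?thesis
    by (cases "circle_mean h z r = h z") auto
qed

lemma re_limit_subset: "re_limit h U \<Longrightarrow> V \<subseteq> U \<Longrightarrow> re_limit h V"
  unfolding re_limit_def by (meson holomorphic_on_subset uniform_limit_on_subset)

text \<open>With \<open>g\<close> a transition between charts this makes harmonicity independent of
  the coordinate; with \<open>g\<close> the local coordinate of \<open>R\<close> it transports
  harmonic functions to the variable \<open>s\<close>.\<close>

lemma re_limit_compose:
  assumes "re_limit h U" "g holomorphic_on V" "g ` V \<subseteq> U"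
  shows "re_limit (\<lambda>z. h (g z)) V"
proof -
  obtain P where P: "\<And>n::nat. P n holomorphic_on U" "uniform_limit U (\<lambda>n z. Re (P n z)) h sequentially"
    using assms by (auto simp: re_limit_def)
  have "(\<lambda>z. P n (g z)) holomorphic_on V" for n
    using holomorphic_on_compose_gen[OF assms(2) P(1) assms(3)] by (simp add: o_def)
  moreover have "uniform_limit V (\<lambda>n z. Re (P n (g z))) (\<lambda>z. h (g z)) sequentially"
    using P(2) assms(3) unfolding uniform_limit_iff by (fastforce elim!: eventually_mono)
  ultimately show ?thesis unfolding re_limit_def by (intro exI[of _ "\<lambda>n z. P n (g z)"]) auto
qed

lemma re_limit_cong:
  assumes "re_limit h U" "\<And>z. z \<in> U \<Longrightarrow> h z = k z"
  shows "re_limit k U"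
proof -
  obtain P where P: "\<And>n::nat. P n holomorphic_on U" "uniform_limit U (\<lambda>n z. Re (P n z)) h sequentially"
    using assms by (auto simp: re_limit_def)
  have "uniform_limit U (\<lambda>n z. Re (P n z)) k sequentially"
    using P(2) assms(2) by (simp add: uniform_limit_iff)
  with P(1) show ?thesis unfolding re_limit_def by blast
qed

lemma re_limit_uminus: "re_limit h U \<Longrightarrow> re_limit (\<lambda>z. - h z) U"
proof -
  assume "re_limit h U"
  then obtain P where P: "\<And>n::nat. P n holomorphic_on U" "uniform_limit U (\<lambda>n z. Re (P n z)) h sequentially"
    by (auto simp: re_limit_def)
  have "uniform_limit U (\<lambda>n z. Re (- P n z)) (\<lambda>z. - h z) sequentially"
    using uniform_limit_uminus[OF P(2)] by simp
  then show ?thesis unfolding re_limit_def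
    by (intro exI[of _ "\<lambda>n z. - P n z"]) (auto intro!: holomorphic_intros P)
qed

lemma re_limit_locally_submean:
  assumes "re_limit h U" "open U" "z \<in> U"
  shows "locally_submean h z"
  by (rule locally_submeanI[OF assms(2,3)]) (simp add: re_limit_mean[OF assms(1)])

section \<open>The Dirichlet problem on a disc\<close>

text \<open>\<open>Re x * Re y\<close> is the real part of \<open>(y * x + y * cnj x) / 2\<close>.
  On the unit circle \<open>cnj z\<close> is the inverse of \<open>z\<close>, so the mixed term is
  again a monomial once the larger exponent is the unconjugated one; by symmetry this may be
  assumed.\<close>

lemma Re_mult_on_circle:
  fixes a b :: complex
  shows "\<exists>q. \<forall>z. norm z = 1 \<longrightarrow> Re (a * z ^ i) * Re (b * z ^ j) = Re (poly q z)"
proof (induction i j arbitrary: a b rule: linorder_wlog)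
  case (le j i)
  let ?q = "monom (b * a / 2) (i + j) + monom (b * cnj a / 2) (i - j)"
  have "Re (a * z ^ j) * Re (b * z ^ i) = Re (poly ?q z)" if "norm z = 1" for z
  proof -
    have "z ^ i = z ^ (i - j) * z ^ j" using le by (simp flip: power_add)
    moreover have "z ^ j * cnj z ^ j = 1"
      using that by (metis complex_norm_square mult.commute of_real_1 power_mult_distrib power_one)
    ultimately have 1: "b * z ^ i * cnj (a * z ^ j) = b * cnj a * z ^ (i - j)"
      by (simp add: mult_ac)
    have "Re x * Re y = Re (y * x / 2 + y * cnj x / 2)" for x y :: complex
      by (simp add: field_simps)
    from this[of "a * z ^ j" "b * z ^ i"] show ?thesis
      by (simp only: 1) (simp add: poly_monom power_add mult_ac)
  qed
  then show ?case by blast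
next
  case (sym i j)
  then show ?case by (metis mult.commute)
qed

lemma Re_poly_mult_on_circle:
  "\<exists>s. \<forall>z. norm z = 1 \<longrightarrow> Re (poly p z) * Re (poly q z) = Re (poly s z)"
proof -
  define t where "t i j = (SOME s. \<forall>z. norm z = 1 \<longrightarrow>
      Re (coeff p i * z ^ i) * Re (coeff q j * z ^ j) = Re (poly s z))" for i j
  have t: "Re (coeff p i * z ^ i) * Re (coeff q j * z ^ j) = Re (poly (t i j) z)"
    if "norm z = 1" for i j z
    using someI_ex[OF Re_mult_on_circle[of "coeff p i" i "coeff q j" j]] that
    unfolding t_def by blast
  have "Re (poly p z) * Re (poly q z) = Re (poly (\<Sum>i\<le>degree p. \<Sum>j\<le>degree q. t i j) z)"
    if "norm z = 1" for z
    by (simp add: poly_altdef[of p] poly_altdef[of q] sum_product poly_sum t[OF that] del: times_complex.sel)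
  then show ?thesis by blast
qed

text \<open>Stone-Weierstrass for the real parts of polynomials, which form an algebra on the unit
  circle by \<open>Re_poly_mult_on_circle\<close>.\<close>

lemma Re_poly_dense_circle:
  assumes "continuous_on (sphere 0 1) f" "e > 0"
  shows "\<exists>p. \<forall>z\<in>sphere 0 1. \<bar>f z - Re (poly p z)\<bar> < e"
proof -
  interpret function_ring_on "{f. \<exists>p. \<forall>z\<in>sphere 0 1. f z = Re (poly p z)}" "sphere (0::complex) 1"
  proof
    fix f g :: "complex \<Rightarrow> real"
    assume "f \<in> {f. \<exists>p. \<forall>z\<in>sphere 0 1. f z = Re (poly p z)}"
    then obtain p where p: "\<And>z. norm z = 1 \<Longrightarrow> f z = Re (poly p z)" by auto
    have "continuous_on (sphere 0 1) (\<lambda>z. Re (poly p z))"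
      by (intro continuous_intros)
    then show "continuous_on (sphere 0 1) f"
      by (rule continuous_on_eq) (simp add: p)
    assume "g \<in> {f. \<exists>p. \<forall>z\<in>sphere 0 1. f z = Re (poly p z)}"
    then obtain q where q: "\<And>z. norm z = 1 \<Longrightarrow> g z = Re (poly q z)" by auto
    show "(\<lambda>x. f x + g x) \<in> {f. \<exists>p. \<forall>z\<in>sphere 0 1. f z = Re (poly p z)}"
      by (intro CollectI exI[of _ "p + q"]) (simp add: p q)
    show "(\<lambda>x. f x * g x) \<in> {f. \<exists>p. \<forall>z\<in>sphere 0 1. f z = Re (poly p z)}"
      using Re_poly_mult_on_circle[of p q] by (auto simp: p q)
  next
    fix c show "(\<lambda>_. c) \<in> {f. \<exists>p. \<forall>z\<in>sphere 0 1. f z = Re (poly p z)}"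
      by (intro CollectI exI[of _ "[:of_real c:]"]) simp
  next
    fix x y :: complex
    assume "x \<noteq> y"
    \<comment> \<open>\<open>[:0, - \<i>:]\<close> is multiplication by \<open>- \<i>\<close>, whose
      real part is \<open>Im\<close>; thus \<open>Re\<close> and \<open>Im\<close> both belong to
      the algebra and separate points.\<close>
    then have "Re x \<noteq> Re y \<or> Re (poly [:0, - \<i>:] x) \<noteq> Re (poly [:0, - \<i>:] y)"
      by (auto simp: complex_eq_iff)
    moreover have "Re \<in> {f. \<exists>p. \<forall>z\<in>sphere 0 1. f z = Re (poly p z)}"
      by (intro CollectI exI[of _ "[:0, 1:]"]) simp
    moreover have "(\<lambda>z. Re (poly [:0, - \<i>:] z)) \<in> {f. \<exists>p. \<forall>z\<in>sphere 0 1. f z = Re (poly p z)}"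
      by blast
    ultimately show "\<exists>f\<in>{f. \<exists>p. \<forall>z\<in>sphere 0 1. f z = Re (poly p z)}. f x \<noteq> f y"
      by (elim disjE) (rule bexI; assumption)+
  qed (rule compact_sphere)
  obtain g where "g \<in> {f. \<exists>p. \<forall>z\<in>sphere 0 1. f z = Re (poly p z)}" "\<forall>z\<in>sphere 0 1. \<bar>f z - g z\<bar> < e"
    using Stone_Weierstrass_basic[OF assms] by blast
  then show ?thesis by force
qed

lemma Re_le_on_cball:
  assumes "F holomorphic_on UNIV" "r > 0" "\<And>z. z \<in> sphere c r \<Longrightarrow> Re (F z) \<le> B" "z \<in> cball c r"
  shows "Re (F z) \<le> B"
  by (rule maximum_real_frontier[of F "cball c r"])
     (use assms in \<open>auto intro: holomorphic_on_subset holomorphic_on_imp_continuous_on\<close>)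

lemma poisson_exists:
  assumes f: "continuous_on (sphere c r) f" and r: "r > 0"
  shows "\<exists>h. re_limit h (cball c r) \<and> (\<forall>z\<in>sphere c r. h z = f z)"
proof -
  have cont: "continuous_on (sphere 0 1) (\<lambda>w. f (c + of_real r * w))"
    by (rule continuous_on_compose2[OF f]) (use r in \<open>auto intro!: continuous_intros simp: dist_norm norm_mult\<close>)
  have "\<exists>p. \<forall>z\<in>sphere 0 1. \<bar>f (c + of_real r * z) - Re (poly p z)\<bar> < 1 / Suc n" for n
    by (rule Re_poly_dense_circle[OF cont]) auto
  then obtain p where p: "\<And>n z. z \<in> sphere 0 1 \<Longrightarrow> \<bar>f (c + of_real r * z) - Re (poly (p n) z)\<bar> < 1 / Suc n"
    by metis
  define P where "P n z = poly (p n) ((z - c) / of_real r)" for n z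
  have hol: "P n holomorphic_on UNIV" for n
    unfolding P_def by (intro holomorphic_intros) (use r in auto)
  have app: "\<bar>f z - Re (P n z)\<bar> < 1 / Suc n" if "z \<in> sphere c r" for z n
    using p[of "(z - c) / of_real r" n] that r
    by (auto simp: P_def dist_norm norm_divide norm_minus_commute split: if_splits)
  have "uniformly_Cauchy_on (cball c r) (\<lambda>n z. Re (P n z))"
    unfolding uniformly_Cauchy_on_def
  proof (intro allI impI)
    fix e :: real assume "e > 0"
    then obtain N where N: "1 / Suc N < e / 2" using nat_approx_posE[of "e/2"] by auto
    have le: "Re (P m z) - Re (P n z) \<le> 1 / Suc m + 1 / Suc n" if "z \<in> cball c r" for m n z
    proof -
      have "Re (P m w) - Re (P n w) \<le> 1 / Suc m + 1 / Suc n" if "w \<in> sphere c r" for w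
        using app[OF that, of m] app[OF that, of n] by linarith
      then show ?thesis
        using Re_le_on_cball[of "\<lambda>z. P m z - P n z" r c "1 / Suc m + 1 / Suc n" z] that r hol
        by (auto intro: holomorphic_intros)
    qed
    have small: "1 / real (Suc m) < e / 2" if "m \<ge> N" for m
      by (rule order.strict_trans1[OF _ N]) (use that in \<open>simp add: frac_le\<close>)
    show "\<exists>M. \<forall>x\<in>cball c r. \<forall>m\<ge>M. \<forall>n\<ge>M. dist (Re (P m x)) (Re (P n x)) < e"
    proof (intro exI[of _ N] ballI allI impI)
      fix x m n assume "x \<in> cball c r" "m \<ge> N" "n \<ge> N"
      with le[of x m n] le[of x n m] small[of m] small[of n]
      show "dist (Re (P m x)) (Re (P n x)) < e" by (simp add: dist_real_def abs_if)
    qed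
  qed
  then obtain h where h: "uniform_limit (cball c r) (\<lambda>n z. Re (P n z)) h sequentially"
    using Cauchy_uniformly_convergent uniformly_convergent_on_def by blast
  have "h z = f z" if z: "z \<in> sphere c r" for z
  proof (rule LIMSEQ_unique)
    show "(\<lambda>n. Re (P n z)) \<longlonglongrightarrow> h z"
      by (rule tendsto_uniform_limitI[OF h]) (use z in auto)
    have "(\<lambda>n. Re (P n z) - f z) \<longlonglongrightarrow> 0"
      by (rule Lim_null_comparison[OF _ LIMSEQ_inverse_real_of_nat])
         (use app[OF z] in \<open>auto intro!: always_eventually less_imp_le simp: abs_minus_commute inverse_eq_divide\<close>)
    then show "(\<lambda>n. Re (P n z)) \<longlonglongrightarrow> f z" by (simp add: LIM_zero_iff)
  qed
  then show ?thesis
    using h hol unfolding re_limit_def by (meson holomorphic_on_subset subset_UNIV)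
qed

text \<open>The Poisson integral of \<open>f\<close>, accessible only through its defining property;
  its values outside the closed disc are arbitrary.\<close>

definition poisson :: "(complex \<Rightarrow> real) \<Rightarrow> complex \<Rightarrow> real \<Rightarrow> complex \<Rightarrow> real" where
  "poisson f c r = (SOME h. re_limit h (cball c r) \<and> (\<forall>z\<in>sphere c r. h z = f z))"

context
  fixes c :: complex and r :: real and f :: "complex \<Rightarrow> real"
  assumes f: "continuous_on (sphere c r) f" and r: "r > 0"
begin

lemma re_limit_poisson_cball: "re_limit (poisson f c r) (cball c r)"
  and poisson_boundary: "z \<in> sphere c r \<Longrightarrow> poisson f c r z = f z"
  using someI_ex[OF poisson_exists[OF f r]] unfolding poisson_def by auto

lemma continuous_on_poisson: "continuous_on (cball c r) (poisson f c r)"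
  by (rule re_limit_continuous[OF re_limit_poisson_cball])

lemma re_limit_poisson: "re_limit (poisson f c r) (ball c r)"
  by (rule re_limit_subset[OF re_limit_poisson_cball]) auto

text \<open>The approximation is uniform on the closed disc, so the mean value property applies to
  the boundary circle itself.\<close>

lemma poisson_center: "poisson f c r c = circle_mean f c r"
proof -
  have "circle_mean (poisson f c r) c r = circle_mean f c r"
    by (rule circle_mean_cong) (use r poisson_boundary in auto)
  then show ?thesis using re_limit_mean[OF re_limit_poisson_cball order_refl r] by simp
qed

text \<open>Subtracting a harmonic function preserves the sub-mean property, so the maximum
  principle applies to the difference.\<close>

lemma le_poisson:
  assumes u: "continuous_on (cball c r) u" "\<And>z. z \<in> ball c r \<Longrightarrow> locally_submean u z"
    and le: "\<And>z. z \<in> sphere c r \<Longrightarrow> u z \<le> f z" and z: "z \<in> cball c r"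
  shows "u z \<le> poisson f c r z"
proof -
  have "u z + - poisson f c r z \<le> 0"
  proof (rule max_principle_ball[OF _ _ _ z])
    show "continuous_on (cball c r) (\<lambda>z. u z + - poisson f c r z)"
      by (intro continuous_intros u continuous_on_poisson)
    show "u w + - poisson f c r w \<le> 0" if "w \<in> sphere c r" for w
      using le[OF that] poisson_boundary[OF that] by simp
    show "locally_submean (\<lambda>z. u z + - poisson f c r z) w" if w: "w \<in> ball c r" for w
    proof (rule locally_submean_add[OF u(2)[OF w] _ open_ball w])
      show "locally_submean (\<lambda>z. - poisson f c r z) w"
        by (rule re_limit_locally_submean[OF re_limit_uminus[OF re_limit_poisson] open_ball w])
    qed (auto intro!: continuous_intros continuous_on_subset[OF u(1)] continuous_on_subset[OF continuous_on_poisson])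
  qed
  then show ?thesis by simp
qed

lemma poisson_le:
  assumes u: "continuous_on (cball c r) u" "\<And>z. z \<in> ball c r \<Longrightarrow> locally_submean (\<lambda>w. - u w) z"
    and le: "\<And>z. z \<in> sphere c r \<Longrightarrow> f z \<le> u z" and z: "z \<in> cball c r"
  shows "poisson f c r z \<le> u z"
proof -
  have "poisson f c r z + - u z \<le> 0"
  proof (rule max_principle_ball[OF _ _ _ z])
    show "continuous_on (cball c r) (\<lambda>z. poisson f c r z + - u z)"
      by (intro continuous_intros u continuous_on_poisson)
    show "poisson f c r w + - u w \<le> 0" if "w \<in> sphere c r" for w
      using le[OF that] poisson_boundary[OF that] by simp
    show "locally_submean (\<lambda>z. poisson f c r z + - u z) w" if w: "w \<in> ball c r" for w
    proof (rule locally_submean_add[OF _ u(2)[OF w] open_ball w])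
      show "locally_submean (poisson f c r) w"
        by (rule re_limit_locally_submean[OF re_limit_poisson open_ball w])
    qed (auto intro!: continuous_intros continuous_on_subset[OF u(1)] continuous_on_subset[OF continuous_on_poisson])
  qed
  then show ?thesis by simp
qed

end

section \<open>The sub-mean inequality: from small radii to all radii\<close>

lemma subharmonic_on_locally_submean:
  assumes "subharmonic_on u U" "open U" "z \<in> U"
  shows "locally_submean u z"
  by (rule locally_submeanI[OF assms(2,3)]) (use assms(1) in \<open>simp add: subharmonic_on_def circle_mean_def\<close>)

text \<open>On a given disc, \<open>u\<close> lies below the Poisson integral of its own values on
  the circle, and at the centre that integral is the circle mean.\<close>

lemma subharmonic_onI:
  assumes U: "open U" and cont: "continuous_on U u" and sub: "\<And>z. z \<in> U \<Longrightarrow> locally_submean u z"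
  shows "subharmonic_on u U"
proof -
  have "u z \<le> circle_mean u z r" if r: "r > 0" and s: "cball z r \<subseteq> U" for z r
  proof -
    have c: "continuous_on (cball z r) u" using cont s by (rule continuous_on_subset)
    have c': "continuous_on (sphere z r) u" using c by (rule continuous_on_subset) auto
    have "u z \<le> poisson u z r z"
      by (rule le_poisson[OF c' r c]) (use sub subsetD[OF s] r in \<open>auto simp: less_imp_le\<close>)
    then show ?thesis using poisson_center[OF c' r] by simp
  qed
  then show ?thesis using cont by (auto simp: subharmonic_on_def circle_mean_def)
qed

text \<open>Above \<open>- C\<close> the slope of \<open>exp\<close> is at least
  \<open>exp (- C)\<close>. This brings an estimate for the exponential of a real part back to the
  real part.\<close>

lemma abs_diff_le_exp_diff:
  fixes a b C :: real
  assumes "a \<ge> - C" "b \<ge> - C"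
  shows "\<bar>a - b\<bar> \<le> exp C * \<bar>exp a - exp b\<bar>"
proof -
  have *: "x - y \<le> exp C * (exp x - exp y)" if "y \<ge> - C" "x \<ge> y" for x y
  proof -
    have "1 * (x - y) \<le> exp (C + y) * (exp (x - y) - 1)"
    proof (rule mult_mono)
      show "x - y \<le> exp (x - y) - 1" using exp_ge_add_one_self[of "x - y"] by linarith
    qed (use that in auto)
    also have "\<dots> = exp C * (exp x - exp y)"
      by (simp add: exp_add exp_diff field_simps)
    finally show ?thesis by simp
  qed
  show ?thesis
    using *[of a b] *[of b a] assms by (cases "a \<ge> b") (auto simp: abs_if not_le)
qed

text \<open>Only the real part of \<open>F\<close> is bounded, so Cauchy's inequality is applied to
  \<open>exp F\<close>, whose modulus is \<open>exp (Re F)\<close> and hence at most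
  \<open>exp C\<close>; the imaginary part never enters.\<close>

lemma Re_lipschitz:
  assumes F: "F holomorphic_on ball c r" and r: "r > 0" and bd: "\<And>z. z \<in> ball c r \<Longrightarrow> \<bar>Re (F z)\<bar> \<le> C"
    and z: "z \<in> ball c (r/2)" and w: "w \<in> ball c (r/2)"
  shows "\<bar>Re (F z) - Re (F w)\<bar> \<le> exp C * (exp C / (r/4)) * norm (z - w)"
proof -
  let ?G = "\<lambda>z. exp (F z)"
  have G: "?G holomorphic_on ball c r" by (intro holomorphic_intros F)
  have der: "norm (deriv ?G x) \<le> exp C / (r/4)" if x: "x \<in> ball c (r/2)" for x
  proof -
    \<comment> \<open>Radius \<open>r/4\<close> is admissible because \<open>r/2 + r/4 < r\<close>;
      it is the source of \<open>r/4\<close> in the Lipschitz constant.\<close>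
    have sub: "cball x (r/4) \<subseteq> ball c r" 
    proof
      fix y assume "y \<in> cball x (r/4)"
      then show "y \<in> ball c r" using x r dist_triangle[of c y x] by (simp add: dist_commute)
    qed
    have "norm ((deriv ^^ 1) ?G x) \<le> fact 1 * exp C / (r/4) ^ 1"
    proof (rule Cauchy_inequality)
      show "?G holomorphic_on ball x (r/4)" using G sub by (meson ball_subset_cball holomorphic_on_subset)
      show "continuous_on (cball x (r/4)) ?G"
        using G sub by (meson holomorphic_on_imp_continuous_on holomorphic_on_subset)
      fix y assume "norm (x - y) = r/4"
      then have "y \<in> ball c r" using sub by (auto simp: dist_norm subset_iff)
      then show "norm (?G y) \<le> exp C" using bd[of y] by (simp add: abs_le_iff)
    qed (use r in auto)
    then show ?thesis by simp
  qed
  have "norm (?G z - ?G w) \<le> exp C / (r/4) * norm (z - w)"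
  proof (rule field_differentiable_bound[of "ball c (r/2)" ?G "deriv ?G"])
    fix x assume x: "x \<in> ball c (r/2)"
    then have "x \<in> ball c r" using r by (simp add: dist_norm)
    then have "(?G has_field_derivative deriv ?G x) (at x)"
      using G holomorphic_derivI[OF G open_ball] by blast
    then show "(?G has_field_derivative deriv ?G x) (at x within ball c (r/2))"
      by (rule has_field_derivative_at_within)
  qed (use der z w in auto)
  moreover have "\<bar>exp (Re (F z)) - exp (Re (F w))\<bar> \<le> norm (?G z - ?G w)"
    using norm_triangle_ineq3[of "?G z" "?G w"] by simp
  ultimately have "\<bar>exp (Re (F z)) - exp (Re (F w))\<bar> \<le> exp C / (r/4) * norm (z - w)" by simp
  moreover have "\<bar>Re (F z)\<bar> \<le> C" "\<bar>Re (F w)\<bar> \<le> C"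
    using z w r by (auto intro!: bd)
  then have "\<bar>Re (F z) - Re (F w)\<bar> \<le> exp C * \<bar>exp (Re (F z)) - exp (Re (F w))\<bar>"
    by (intro abs_diff_le_exp_diff) auto
  ultimately show ?thesis
    using mult_left_mono[of _ "exp C / (r/4) * norm (z - w)" "exp C"] by (fastforce simp: mult.assoc)
qed

text \<open>The approximants eventually stay within 1 of \<open>h\<close>, hence
  \<open>C + 1\<close> in place of \<open>C\<close>. The constant depends on \<open>C\<close> and
  \<open>r\<close> only, which gives equicontinuity of bounded families of harmonic
  functions.\<close>

lemma re_limit_lipschitz:
  assumes h: "re_limit h (ball c r)" and r: "r > 0" and bd: "\<And>z. z \<in> ball c r \<Longrightarrow> \<bar>h z\<bar> \<le> C"
    and z: "z \<in> ball c (r/2)" and w: "w \<in> ball c (r/2)"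
  shows "\<bar>h z - h w\<bar> \<le> exp (C+1) * (exp (C+1) / (r/4)) * norm (z - w)"
proof -
  obtain P where P: "\<And>n::nat. P n holomorphic_on ball c r"
     "uniform_limit (ball c r) (\<lambda>n z. Re (P n z)) h sequentially"
    using h by (auto simp: re_limit_def)
  have zw: "z \<in> ball c r" "w \<in> ball c r" using z w r by auto
  have "\<forall>\<^sub>F n in sequentially. \<forall>x\<in>ball c r. dist (Re (P n x)) (h x) < 1"
    using P(2) unfolding uniform_limit_iff by (rule allE[of _ 1]) simp
  then have "\<forall>\<^sub>F n in sequentially. \<bar>Re (P n z) - Re (P n w)\<bar> \<le> exp (C+1) * (exp (C+1) / (r/4)) * norm (z - w)"
  proof eventually_elim
    case (elim n)
    show ?case
    proof (rule Re_lipschitz[OF P(1) r _ z w])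
      fix x assume "x \<in> ball c r"
      then have "dist (Re (P n x)) (h x) < 1" "\<bar>h x\<bar> \<le> C" using elim bd by auto
      then show "\<bar>Re (P n x)\<bar> \<le> C + 1" by (simp add: dist_real_def)
    qed
  qed
  moreover have "(\<lambda>n. \<bar>Re (P n z) - Re (P n w)\<bar>) \<longlonglongrightarrow> \<bar>h z - h w\<bar>"
    by (intro tendsto_intros tendsto_uniform_limitI[OF P(2)] zw)
  ultimately show ?thesis
    by (intro tendsto_upperbound) auto
qed

section \<open>Coordinates on the extended plane\<close>

lemma continuous_on_riemann_sphere_iff:
  fixes f :: "'a::metric_space \<Rightarrow> riemann_sphere"
  shows "continuous_on S f \<longleftrightarrow> continuous_on S (\<lambda>x. stereographic (f x))"
  by (simp add: continuous_on_iff dist_riemann_sphere_def)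

lemma continuous_on_stereographic: "continuous_on S stereographic"
  using continuous_on_riemann_sphere_iff[of S "\<lambda>x. x"] by simp

lemma one_plus_norm_sq_neq_0: "1 + (norm z)\<^sup>2 \<noteq> (0::real)"
  by (metis add_pos_nonneg less_irrefl zero_le_power2 zero_less_one)

lemma continuous_on_Fin: "continuous_on S Fin"
  unfolding continuous_on_riemann_sphere_iff
  by (auto intro!: continuous_intros simp: one_plus_norm_sq_neq_0)

text \<open>On the unit sphere, inversion is the half-turn about the real axis. Its continuity is
  then visible also at 0 and at \<open>Infty\<close>.\<close>

lemma stereographic_sphere_inverse:
  "stereographic (sphere_inverse x) = (cnj (fst (stereographic x)), - snd (stereographic x))"
proof (cases x)
  case (Fin z)
  show ?thesis
  proof (cases "z = 0")
    case False
    have n: "(norm z)\<^sup>2 \<noteq> 0" "1 + (norm z)\<^sup>2 \<noteq> 0" "(norm z)\<^sup>2 + 1 \<noteq> 0"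
      using False one_plus_norm_sq_neq_0[of z] by (auto simp: add.commute)
    have i: "inverse z = (1 / (norm z)\<^sup>2) *\<^sub>R cnj z"
      using False complex_norm_square[of z] by (simp add: field_simps scaleR_conv_of_real)
    have "2 / (1 + (inverse (norm z))\<^sup>2) * (1 / (norm z)\<^sup>2) = 2 / (1 + (norm z)\<^sup>2)"
      using n by (simp add: power_inverse field_simps)
    moreover have "((inverse (norm z))\<^sup>2 - 1) / (1 + (inverse (norm z))\<^sup>2) = - (((norm z)\<^sup>2 - 1) / (1 + (norm z)\<^sup>2))"
    proof -
      have "(inverse (norm z))\<^sup>2 - 1 = inverse ((norm z)\<^sup>2) * (1 - (norm z)\<^sup>2)"
        "1 + (inverse (norm z))\<^sup>2 = inverse ((norm z)\<^sup>2) * (1 + (norm z)\<^sup>2)"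
        using n by (auto simp: power_inverse field_simps)
      then show ?thesis
        using n by (simp only: mult_divide_mult_cancel_left inverse_nonzero_iff_nonzero minus_divide_left minus_diff_eq) simp
    qed
    moreover have "(2 / (1 + (inverse (norm z))\<^sup>2)) *\<^sub>R inverse z =
       (2 / (1 + (inverse (norm z))\<^sup>2) * (1 / (norm z)\<^sup>2)) *\<^sub>R cnj z"
      by (simp only: i scaleR_scaleR)
    moreover have "stereographic (sphere_inverse x) =
        ((2 / (1 + (norm (inverse z))\<^sup>2)) *\<^sub>R inverse z, ((norm (inverse z))\<^sup>2 - 1) / (1 + (norm (inverse z))\<^sup>2))"
      unfolding Fin sphere_inverse.simps if_not_P[OF False] stereographic.simps ..
    ultimately show ?thesis
      unfolding norm_inverse Fin stereographic.simps fst_conv snd_conv complex_cnj_scaleR by (simp only:)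
  qed (simp add: Fin)
qed simp

lemma sphere_inverse_involution [simp]: "sphere_inverse (sphere_inverse x) = x"
  by (cases x) auto

lemma continuous_on_sphere_inverse: "continuous_on S sphere_inverse"
  unfolding continuous_on_riemann_sphere_iff stereographic_sphere_inverse
  by (intro continuous_intros continuous_on_stereographic)

text \<open>Away from \<open>Infty\<close> the map is stereographic projection from the north pole,
  \<open>fst / (1 - snd)\<close> in Euclidean coordinates.\<close>

lemma continuous_on_the_Fin: "continuous_on (- {Infty}) the_Fin"
proof (rule continuous_on_eq)
  show "continuous_on (- {Infty}) (\<lambda>x. (1 / (1 - snd (stereographic x))) *\<^sub>R fst (stereographic x))"
  proof (intro continuous_intros continuous_on_stereographic ballI)
    fix x assume "x \<in> - {Infty}"
    then obtain z where "x = Fin z" by (cases x) auto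
    then show "1 - snd (stereographic x) \<noteq> 0"
      using stereographic_snd_Fin[of z] one_plus_norm_sq_neq_0[of z] by simp
  qed
  fix x assume "x \<in> - {Infty}"
  then obtain z where x: "x = Fin z" by (cases x) auto
  have "(1 / d) *\<^sub>R (d *\<^sub>R z) = z" if "d \<noteq> 0" for d :: real
    using that by simp
  from this[of "2 / (1 + (norm z)\<^sup>2)"]
  show "(1 / (1 - snd (stereographic x))) *\<^sub>R fst (stereographic x) = the_Fin x"
    unfolding x stereographic_snd_Fin using one_plus_norm_sq_neq_0[of z]
    by (simp only: stereographic.simps fst_conv riemann_sphere.sel divide_eq_0_iff) simp
qed

text \<open>An index for the two charts, so that a statement about both is a single statement
  quantified over \<open>b\<close>.\<close>

datatype coordinate = At_zero | At_infinity

definition chart :: "coordinate \<Rightarrow> complex \<Rightarrow> riemann_sphere" where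
  "chart b z = (if b = At_zero then Fin z else sphere_inverse (Fin z))"

definition chart_inv :: "coordinate \<Rightarrow> riemann_sphere \<Rightarrow> complex" where
  "chart_inv b x = the_Fin (if b = At_zero then x else sphere_inverse x)"

lemma chart_inv_chart [simp]: "chart_inv b (chart b z) = z"
  by (simp add: chart_inv_def chart_def)

lemma chart_eq_iff [simp]: "chart b z = chart b w \<longleftrightarrow> z = w"
  by (metis chart_inv_chart)

lemma chart_mem_image_iff [simp]: "chart b z \<in> chart b ` U \<longleftrightarrow> z \<in> U"
  by (auto simp: image_iff)

lemma continuous_on_chart: "continuous_on S (chart b)"
proof (cases b)
  case At_zero
  then have "chart b = Fin" by (simp add: fun_eq_iff chart_def)
  then show ?thesis by (simp add: continuous_on_Fin)
next
  case At_infinity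
  then have "chart b = (\<lambda>z. sphere_inverse (Fin z))"
    by (simp add: fun_eq_iff chart_def del: sphere_inverse.simps)
  then show ?thesis
    using continuous_on_compose2[OF continuous_on_sphere_inverse[of UNIV] continuous_on_Fin[of S]] by simp
qed

lemma open_chart_vimage: "open D \<Longrightarrow> open {z. chart b z \<in> D}"
  using open_vimage[OF _ continuous_on_chart[of UNIV b]] by (simp add: vimage_def)

lemma range_chart: "range (chart b) = - {if b = At_zero then Infty else Fin 0}"
proof -
  have "x \<in> range (chart b)" if "x \<noteq> (if b = At_zero then Infty else Fin 0)" for x
  proof (cases b)
    case At_zero then show ?thesis using that by (cases x) (auto simp: chart_def)
  next
    case At_infinity
    then have "chart b (the_Fin (sphere_inverse x)) = x"
      using that by (cases x) (auto simp: chart_def)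
    then show ?thesis by (metis rangeI)
  qed
  moreover have "chart b z \<noteq> (if b = At_zero then Infty else Fin 0)" for z
    by (simp add: chart_def)
  ultimately have "x \<in> range (chart b) \<longleftrightarrow> x \<in> - {if b = At_zero then Infty else Fin 0}" for x
    unfolding Compl_iff singleton_iff by (metis rangeE)
  then show ?thesis by (rule set_eqI)
qed

lemma continuous_on_chart_inv: "continuous_on (range (chart b)) (chart_inv b)"
proof (cases b)
  case At_zero then show ?thesis
    using continuous_on_the_Fin by (simp add: chart_inv_def [abs_def] range_chart)
next
  case At_infinity
  have "continuous_on (- {Fin 0}) (\<lambda>x. the_Fin (sphere_inverse x))"
  proof (rule continuous_on_compose2[OF continuous_on_the_Fin continuous_on_sphere_inverse])
    show "sphere_inverse ` (- {Fin 0}) \<subseteq> - {Infty}"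
    proof
      fix y assume "y \<in> sphere_inverse ` (- {Fin 0})"
      then obtain x where "x \<noteq> Fin 0" "y = sphere_inverse x" by auto
      then show "y \<in> - {Infty}" by (cases x) auto
    qed
  qed
  then show ?thesis using At_infinity by (simp add: chart_inv_def [abs_def] range_chart)
qed

lemma open_chart_image:
  assumes "open U" shows "open (chart b ` U)"
proof -
  have o: "open (range (chart b))" unfolding range_chart by (intro open_Compl closed_singleton)
  have "\<forall>B. open B \<longrightarrow> open (chart_inv b -` B \<inter> range (chart b))"
    by (rule iffD1[OF continuous_on_open_vimage[OF o] continuous_on_chart_inv])
  then have "open (chart_inv b -` U \<inter> range (chart b))"
    using assms by simp
  moreover have "chart_inv b -` U \<inter> range (chart b) = chart b ` U"
    by (fastforce simp: image_iff)
  ultimately show ?thesis by simp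
qed

text \<open>Inversion exchanges the inside and the outside of the unit circle, so the two closed
  unit discs already cover the sphere. Compactness and connectedness of the sphere are read off from
  this.\<close>

lemma chart_cover: obtains b z where "x = chart b z" "z \<in> cball 0 1"
proof (cases x)
  case (Fin a)
  show thesis
  proof (cases "norm a \<le> 1")
    case True then show ?thesis using that[of At_zero a] Fin by (simp add: chart_def)
  next
    case False
    then have "a \<noteq> 0" "norm (inverse a) \<le> 1" by (auto simp: norm_inverse inverse_le_1_iff)
    then show ?thesis using that[of At_infinity "inverse a"] Fin by (simp add: chart_def)
  qed
next
  case Infty then show thesis using that[of At_infinity 0] by (simp add: chart_def)
qed

lemma UNIV_riemann_sphere: "(UNIV :: riemann_sphere set) = chart At_zero ` cball 0 1 \<union> chart At_infinity ` cball 0 1"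
proof -
  have "x \<in> chart At_zero ` cball 0 1 \<union> chart At_infinity ` cball 0 1" for x
  proof -
    obtain b z where "x = chart b z" "z \<in> cball 0 1" by (rule chart_cover)
    then show ?thesis by (cases b) auto
  qed
  then show ?thesis by auto
qed

lemma compact_riemann_sphere: "compact (UNIV :: riemann_sphere set)"
  unfolding UNIV_riemann_sphere
  by (intro compact_Un compact_continuous_image continuous_on_chart compact_cball)

lemma connected_riemann_sphere: "connected (UNIV :: riemann_sphere set)"
  unfolding UNIV_riemann_sphere
proof (intro connected_Un connected_continuous_image continuous_on_chart connected_cball)
  have "chart At_zero 1 = chart At_infinity 1" by (simp add: chart_def)
  then have "chart At_zero 1 \<in> chart At_zero ` cball 0 1 \<inter> chart At_infinity ` cball 0 1"
    by (metis IntI image_eqI mem_cball_0 norm_one order_refl)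
  then show "chart At_zero ` cball 0 1 \<inter> chart At_infinity ` cball 0 1 \<noteq> {}" by blast
qed

lemma compact_riemann_sphere_closed: "closed (K :: riemann_sphere set) \<Longrightarrow> compact K"
  using closed_Int_compact[OF _ compact_riemann_sphere] by simp

lemma holomorphic_chart_transition:
  "(\<lambda>z. chart_inv b (chart b' z)) holomorphic_on {z. chart b' z \<in> range (chart b)}"
proof (cases "b = b'")
  case True then show ?thesis by simp
next
  case False
  have "(\<lambda>z. inverse z) holomorphic_on {z. chart b' z \<in> range (chart b)}"
    using False by (cases b; cases b') (auto intro!: holomorphic_intros simp: range_chart chart_def)
  moreover have "inverse z = chart_inv b (chart b' z)" if "z \<in> {z. chart b' z \<in> range (chart b)}" for z
    using that False by (cases b; cases b') (auto simp: range_chart chart_def chart_inv_def)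
  ultimately show ?thesis by (rule holomorphic_transform)
qed

section \<open>Subharmonic functions on the sphere, chart by chart\<close>

lemma sphere_subharmonic_on_chart:
  "sphere_subharmonic_on u D \<longleftrightarrow> (\<forall>b. subharmonic_on (\<lambda>z. u (chart b z)) {z. chart b z \<in> D})"
proof -
  have "(\<forall>b. P b) \<longleftrightarrow> P At_zero \<and> P At_infinity" for P
    by (metis coordinate.exhaust)
  then show ?thesis unfolding sphere_subharmonic_on_def by (simp add: chart_def)
qed

lemma continuous_on_sphere_chart:
  fixes u :: "riemann_sphere \<Rightarrow> real"
  assumes "open D"
  shows "continuous_on D u \<longleftrightarrow> (\<forall>b. continuous_on {z. chart b z \<in> D} (\<lambda>z. u (chart b z)))"
proof
  assume "continuous_on D u"
  show "\<forall>b. continuous_on {z. chart b z \<in> D} (\<lambda>z. u (chart b z))"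
  proof (intro allI)
    fix b show "continuous_on {z. chart b z \<in> D} (\<lambda>z. u (chart b z))"
      by (rule continuous_on_compose2[OF \<open>continuous_on D u\<close> continuous_on_chart]) auto
  qed
next
  assume c: "\<forall>b. continuous_on {z. chart b z \<in> D} (\<lambda>z. u (chart b z))"
  have "isCont u x" if x: "x \<in> D" for x
  proof -
    obtain b z where xz: "x = chart b z" using chart_cover by blast
    let ?V = "{z. chart b z \<in> D}"
    have "continuous_on (chart b ` ?V) (\<lambda>x. u (chart b (chart_inv b x)))"
      by (rule continuous_on_compose2[OF spec[OF c, of b]])
         (auto intro!: continuous_on_subset[OF continuous_on_chart_inv])
    then have "continuous_on (chart b ` ?V) u"
      by (rule continuous_on_eq) auto
    moreover have "open (chart b ` ?V)" by (intro open_chart_image open_chart_vimage assms)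
    moreover have "x \<in> chart b ` ?V" using x xz by auto
    ultimately show ?thesis using continuous_on_eq_continuous_at by blast
  qed
  then show "continuous_on D u" by (simp add: continuous_at_imp_continuous_on)
qed

lemma sphere_subharmonic_on_continuous:
  "sphere_subharmonic_on u D \<Longrightarrow> open D \<Longrightarrow> continuous_on D u"
  by (simp add: continuous_on_sphere_chart sphere_subharmonic_on_chart subharmonic_on_def)

lemma sphere_subharmonic_on_locally:
  "sphere_subharmonic_on u D \<Longrightarrow> open D \<Longrightarrow> chart b z \<in> D \<Longrightarrow> locally_submean (\<lambda>z. u (chart b z)) z"
  using subharmonic_on_locally_submean[OF _ open_chart_vimage, of "\<lambda>z. u (chart b z)" b D z]
  by (simp add: sphere_subharmonic_on_chart)

lemma sphere_subharmonic_onI: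
  assumes "open D" "continuous_on D u"
    "\<And>b z. chart b z \<in> D \<Longrightarrow> locally_submean (\<lambda>z. u (chart b z)) z"
  shows "sphere_subharmonic_on u D"
  unfolding sphere_subharmonic_on_chart
proof
  fix b
  show "subharmonic_on (\<lambda>z. u (chart b z)) {z. chart b z \<in> D}"
    by (rule subharmonic_onI[OF open_chart_vimage[OF assms(1)]])
       (use assms(2,3) continuous_on_sphere_chart[OF assms(1), of u] in simp_all)
qed

lemma sphere_subharmonic_on_const: "open D \<Longrightarrow> sphere_subharmonic_on (\<lambda>_. c) D"
  by (rule sphere_subharmonic_onI) (auto simp: locally_submean_def)

lemma sphere_subharmonic_on_subset:
  "sphere_subharmonic_on u D \<Longrightarrow> D' \<subseteq> D \<Longrightarrow> sphere_subharmonic_on u D'"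
  unfolding sphere_subharmonic_on_chart subharmonic_on_def
  by (smt (verit) continuous_on_subset mem_Collect_eq subset_eq)

lemma sphere_subharmonic_on_add:
  assumes "sphere_subharmonic_on u D" "sphere_subharmonic_on v D" "open D"
  shows "sphere_subharmonic_on (\<lambda>x. u x + v x) D"
proof (rule sphere_subharmonic_onI)
  show "continuous_on D (\<lambda>x. u x + v x)"
    by (intro continuous_intros sphere_subharmonic_on_continuous assms)
  show "locally_submean (\<lambda>z. u (chart b z) + v (chart b z)) z" if "chart b z \<in> D" for b z
    by (rule locally_submean_add[OF _ _ open_chart_vimage[of D b]])
       (use assms that in \<open>auto intro!: sphere_subharmonic_on_locally simp: sphere_subharmonic_on_chart subharmonic_on_def\<close>)
qed (fact assms(3))

text \<open>At \<open>z\<close> the maximum equals one of the two functions, and it is a majorant of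
  that one.\<close>

lemma locally_submean_max:
  assumes "locally_submean u z" "locally_submean v z" "open U" "z \<in> U" "continuous_on U u" "continuous_on U v"
  shows "locally_submean (\<lambda>w. max (u w) (v w)) z"
proof (cases "u z \<ge> v z")
  case True
  then show ?thesis
    by (intro locally_submean_le[OF assms(1,3,4,5)]) (auto intro!: continuous_intros assms)
next
  case False
  then show ?thesis
    by (intro locally_submean_le[OF assms(2,3,4,6)]) (auto intro!: continuous_intros assms)
qed

lemma sphere_subharmonic_on_max:
  assumes "sphere_subharmonic_on u D" "sphere_subharmonic_on v D" "open D"
  shows "sphere_subharmonic_on (\<lambda>x. max (u x) (v x)) D"
proof (rule sphere_subharmonic_onI)
  show "continuous_on D (\<lambda>x. max (u x) (v x))"
    by (intro continuous_intros sphere_subharmonic_on_continuous assms)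
  show "locally_submean (\<lambda>z. max (u (chart b z)) (v (chart b z))) z" if "chart b z \<in> D" for b z
    by (rule locally_submean_max[OF _ _ open_chart_vimage[of D b]])
       (use assms that in \<open>auto intro!: sphere_subharmonic_on_locally simp: sphere_subharmonic_on_chart subharmonic_on_def\<close>)
qed (fact assms(3))

section \<open>The maximum principle on open subsets of the sphere\<close>

lemma closure_eq_Un_frontier: "closure D = D \<union> frontier D"
  using closure_subset[of D] interior_subset[of D] by (auto simp: frontier_def)

text \<open>A positive value would give an attained maximum whose set \<open>K\<close> is closed in
  the sphere. Connectedness of the sphere, not of \<open>D\<close>, then yields a point of
  \<open>K\<close> with no neighbourhood inside \<open>K\<close>, where a suitable circle violates
  the sub-mean inequality.\<close>

lemma sphere_max_principle:
  assumes D: "open D" "D \<noteq> UNIV" and sub: "sphere_subharmonic_on u D"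
    and bd: "\<And>\<zeta> e. \<zeta> \<in> frontier D \<Longrightarrow> e > 0 \<Longrightarrow> \<forall>\<^sub>F x in at \<zeta> within D. u x < e"
    and a: "a \<in> D"
  shows "u a \<le> 0"
proof (rule ccontr)
  assume "\<not> u a \<le> 0"
  then have ua: "u a > 0" by simp
  have cont: "continuous_on D u" by (rule sphere_subharmonic_on_continuous[OF sub D(1)])
  \<comment> \<open>The frontier condition with \<open>e = u a\<close> keeps the superlevel set away
    from the frontier, which will make it closed in the sphere and therefore compact.\<close>
  have lim: "x \<in> D" if "x islimpt {y\<in>D. u y \<ge> u a}" for x
  proof (rule ccontr)
    assume "x \<notin> D"
    moreover have "x \<in> closure D"
      using that by (metis (no_types, lifting) closure_def UnCI islimpt_subset mem_Collect_eq subsetI)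
    ultimately have "x \<in> frontier D" using closure_eq_Un_frontier[of D] by blast
    from bd[OF this ua] obtain T where "open T" "x \<in> T" "\<And>y. y \<in> T \<Longrightarrow> y \<noteq> x \<Longrightarrow> y \<in> D \<Longrightarrow> u y < u a"
      by (auto simp: eventually_at_topological)
    with islimptE[OF that, of T] show False by (metis (mono_tags, lifting) mem_Collect_eq not_le)
  qed
  have "closed {y\<in>D. u y \<ge> u a}"
    unfolding closed_limpt
  proof (intro allI impI)
    fix x assume x: "x islimpt {y\<in>D. u y \<ge> u a}"
    then have "x \<in> D" by (rule lim)
    have "closedin (top_of_set D) (D \<inter> u -` {u a..})"
      by (rule continuous_closedin_preimage[OF cont]) auto
    then obtain S where S: "closed S" "D \<inter> u -` {u a..} = D \<inter> S"
      unfolding closedin_closed by blast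
    have "x islimpt S" using x S(2) by (rule_tac islimpt_subset) auto
    then have "x \<in> S" using S(1) by (simp add: closed_limpt)
    then show "x \<in> {y\<in>D. u y \<ge> u a}" using S(2) \<open>x \<in> D\<close> by blast
  qed
  then have "compact {y\<in>D. u y \<ge> u a}" by (rule compact_riemann_sphere_closed)
  moreover have "{y\<in>D. u y \<ge> u a} \<noteq> {}" using a by auto
  moreover have "continuous_on {y\<in>D. u y \<ge> u a} u" by (rule continuous_on_subset[OF cont]) auto
  ultimately obtain m where m: "m \<in> D" "u m \<ge> u a" "\<And>y. y \<in> D \<Longrightarrow> u y \<ge> u a \<Longrightarrow> u y \<le> u m"
    using continuous_attains_sup[of "{y\<in>D. u y \<ge> u a}" u] by auto
  have le: "u y \<le> u m" if "y \<in> D" for y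
    using m(2) m(3)[OF that] by linarith
  define K where "K = {y\<in>D. u y = u m}"
  have "closed K"
  proof -
    have "closedin (top_of_set {y\<in>D. u y \<ge> u a}) ({y\<in>D. u y \<ge> u a} \<inter> u -` {u m})"
      by (rule continuous_closedin_preimage) (use \<open>continuous_on {y\<in>D. u y \<ge> u a} u\<close> in auto)
    then have "closed ({y\<in>D. u y \<ge> u a} \<inter> u -` {u m})"
      using \<open>closed {y\<in>D. u y \<ge> u a}\<close> by (rule closedin_closed_trans)
    moreover have "{y\<in>D. u y \<ge> u a} \<inter> u -` {u m} = K" using m(2) by (auto simp: K_def)
    ultimately show ?thesis by simp
  qed
  have "K \<noteq> {}" "K \<noteq> UNIV" using m(1) D(2) by (auto simp: K_def)
  then have "\<not> open K"
    using \<open>closed K\<close> connected_riemann_sphere connected_clopen[of "UNIV :: riemann_sphere set"] by auto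
  then have "\<exists>x\<in>K. \<forall>T. open T \<and> x \<in> T \<longrightarrow> \<not> T \<subseteq> K"
    using Topological_Spaces.openI[of K] by blast
  then obtain x where x: "x \<in> K" "\<And>T. open T \<Longrightarrow> x \<in> T \<Longrightarrow> \<not> T \<subseteq> K"
    by blast
  obtain b z where xz: "x = chart b z" using chart_cover by blast
  let ?V = "{z. chart b z \<in> D}" and ?v = "\<lambda>z. u (chart b z)"
  have V: "open ?V" "z \<in> ?V" using open_chart_vimage D(1) x(1) xz by (auto simp: K_def)
  have cv: "continuous_on ?V ?v"
    using sub by (auto simp: sphere_subharmonic_on_chart subharmonic_on_def)
  obtain r where r: "r > 0" "cball z r \<subseteq> ?V" using V open_contains_cball by blast
  have "\<not> chart b ` ball z r \<subseteq> K"
    by (rule x(2)) (use r xz in \<open>auto intro: open_chart_image\<close>)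
  then obtain w where w: "w \<in> ball z r" "chart b w \<notin> K" by blast
  \<comment> \<open>The radius is chosen so that the circle passes through \<open>w\<close>, where
    the value is below the maximum.\<close>
  let ?\<rho> = "dist z w"
  have "w \<noteq> z" using w(2) x(1) xz by auto
  have sub_r: "cball z ?\<rho> \<subseteq> ?V" using r(2) w(1) by (meson less_imp_le mem_ball order_trans subset_cball)
  have "u x \<le> circle_mean ?v z ?\<rho>"
    using sub sub_r \<open>w \<noteq> z\<close> xz
    by (simp add: sphere_subharmonic_on_chart subharmonic_on_def circle_mean_def)
  moreover have "circle_mean ?v z ?\<rho> < u m"
  proof (rule circle_mean_strict)
    show "continuous_on (sphere z ?\<rho>) ?v" by (rule continuous_on_subset[OF cv order_trans[OF sphere_cball sub_r]])
    show "w \<in> sphere z ?\<rho>" by simp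
    show "?v w < u m" using w(2) le[of "chart b w"] subsetD[OF sub_r, of w] by (auto simp: K_def)
    show "?v y \<le> u m" if "y \<in> sphere z ?\<rho>" for y
      by (rule le) (use that subsetD[OF order_trans[OF sphere_cball sub_r]] in blast)
  qed auto
  ultimately show False using x(1) by (simp add: K_def)
qed

section \<open>Perron solutions are harmonic\<close>

text \<open>Approximation is demanded on discs whose closure lies in the chart domain: these are the
  discs on which the Perron solution will be identified with a Poisson integral.\<close>

definition sphere_harmonic_on :: "(riemann_sphere \<Rightarrow> real) \<Rightarrow> riemann_sphere set \<Rightarrow> bool" where
  "sphere_harmonic_on h D \<longleftrightarrow> continuous_on D h \<and>
     (\<forall>b c r. r > 0 \<longrightarrow> cball c r \<subseteq> {z. chart b z \<in> D} \<longrightarrow> re_limit (\<lambda>z. h (chart b z)) (ball c r))"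

lemma sphere_harmonic_on_uminus: "sphere_harmonic_on h D \<Longrightarrow> sphere_harmonic_on (\<lambda>x. - h x) D"
  unfolding sphere_harmonic_on_def by (auto intro!: continuous_intros re_limit_uminus)

lemma chart_cball:
  assumes "open D" "chart b z \<in> D"
  obtains r where "r > 0" "cball z r \<subseteq> {z. chart b z \<in> D}"
proof -
  have "\<exists>r>0. cball z r \<subseteq> {z. chart b z \<in> D}"
    using open_chart_vimage[OF assms(1), of b] assms(2) by (simp only: open_contains_cball mem_Collect_eq)
  then show thesis using that by (elim exE conjE)
qed

lemma sphere_harmonic_on_subharmonic:
  assumes "sphere_harmonic_on h D" "open D" shows "sphere_subharmonic_on h D"
proof (rule sphere_subharmonic_onI)
  fix b z assume "chart b z \<in> D"
  then obtain r where r: "r > 0" "cball z r \<subseteq> {z. chart b z \<in> D}"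
    using chart_cball[OF assms(2)] by blast
  then have "re_limit (\<lambda>z. h (chart b z)) (ball z r)"
    using assms(1) by (simp add: sphere_harmonic_on_def)
  then show "locally_submean (\<lambda>z. h (chart b z)) z"
    by (rule re_limit_locally_submean) (use r in auto)
qed (use assms in \<open>auto simp: sphere_harmonic_on_def\<close>)

text \<open>The boundary condition of the Perron family, without extended reals.\<close>

definition upper_boundary :: "riemann_sphere set \<Rightarrow> (riemann_sphere \<Rightarrow> real) \<Rightarrow> (riemann_sphere \<Rightarrow> real) \<Rightarrow> bool" where
  "upper_boundary D u \<phi> \<longleftrightarrow> (\<forall>\<zeta>\<in>frontier D. \<forall>e>0. \<forall>\<^sub>F x in at \<zeta> within D. u x < \<phi> \<zeta> + e)"

lemma Limsup_le_ereal_iff: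
  fixes u :: "'a \<Rightarrow> real"
  shows "Limsup F (\<lambda>x. ereal (u x)) \<le> ereal c \<longleftrightarrow> (\<forall>e>0. \<forall>\<^sub>F x in F. u x < c + e)"
proof
  assume L: "Limsup F (\<lambda>x. ereal (u x)) \<le> ereal c"
  show "\<forall>e>0. \<forall>\<^sub>F x in F. u x < c + e"
  proof (intro allI impI)
    fix e :: real assume "e > 0"
    then have "ereal c < ereal (c + e)" by simp
    then have "\<forall>\<^sub>F x in F. ereal (u x) < ereal (c + e)"
      using L unfolding Limsup_le_iff by blast
    then show "\<forall>\<^sub>F x in F. u x < c + e" by simp
  qed
next
  assume e: "\<forall>e>0. \<forall>\<^sub>F x in F. u x < c + e"
  show "Limsup F (\<lambda>x. ereal (u x)) \<le> ereal c"
    unfolding Limsup_le_iff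
  proof (intro allI impI)
    fix y assume y: "y > ereal c"
    show "\<forall>\<^sub>F x in F. ereal (u x) < y"
    proof (cases y)
      case (real y')
      then have "\<forall>\<^sub>F x in F. u x < c + (y' - c)" using e[rule_format, of "y' - c"] y real by simp
      then show ?thesis using real by simp
    qed (use y in auto)
  qed
qed

lemma mem_perron_family:
  "u \<in> perron_family D \<phi> \<longleftrightarrow> sphere_subharmonic_on u D \<and> upper_boundary D u \<phi>"
  by (simp add: perron_family_def upper_boundary_def Limsup_le_ereal_iff)

lemma upper_boundary_add:
  assumes "upper_boundary D u \<phi>" "upper_boundary D v \<psi>"
  shows "upper_boundary D (\<lambda>x. u x + v x) (\<lambda>x. \<phi> x + \<psi> x)"
  unfolding upper_boundary_def
proof (intro ballI allI impI)
  fix \<zeta> and e :: real assume "\<zeta> \<in> frontier D" "e > 0"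
  then have "\<forall>\<^sub>F x in at \<zeta> within D. u x < \<phi> \<zeta> + e / 2" "\<forall>\<^sub>F x in at \<zeta> within D. v x < \<psi> \<zeta> + e / 2"
    using assms by (simp_all add: upper_boundary_def)
  then show "\<forall>\<^sub>F x in at \<zeta> within D. u x + v x < \<phi> \<zeta> + \<psi> \<zeta> + e"
    by eventually_elim simp
qed

lemma upper_boundary_tendsto:
  assumes "\<And>\<zeta>. \<zeta> \<in> frontier D \<Longrightarrow> (u \<longlongrightarrow> \<phi> \<zeta>) (at \<zeta> within D)"
  shows "upper_boundary D u \<phi>"
  unfolding upper_boundary_def
proof (intro ballI allI impI)
  fix \<zeta> and e :: real assume "\<zeta> \<in> frontier D" "e > 0"
  then show "\<forall>\<^sub>F x in at \<zeta> within D. u x < \<phi> \<zeta> + e"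
    by (intro order_tendstoD(2)[OF assms]) auto
qed

text \<open>Applied with \<open>v\<close> the negative of a competitor, or a constant, this compares
  subharmonic with superharmonic functions while speaking of subharmonic ones only.\<close>

lemma perron_comparison:
  assumes "open D" "D \<noteq> UNIV" "sphere_subharmonic_on u D" "sphere_subharmonic_on v D"
    "upper_boundary D u \<phi>" "upper_boundary D v \<psi>" "\<And>\<zeta>. \<zeta> \<in> frontier D \<Longrightarrow> \<phi> \<zeta> + \<psi> \<zeta> \<le> 0" "a \<in> D"
  shows "u a + v a \<le> 0"
proof (rule sphere_max_principle[OF assms(1,2) _ _ assms(8)])
  show "sphere_subharmonic_on (\<lambda>x. u x + v x) D"
    by (rule sphere_subharmonic_on_add[OF assms(3,4,1)])
  fix \<zeta> and e :: real assume z: "\<zeta> \<in> frontier D" and "e > 0"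
  then have "\<forall>\<^sub>F x in at \<zeta> within D. u x + v x < \<phi> \<zeta> + \<psi> \<zeta> + e"
    using upper_boundary_add[OF assms(5,6)] by (simp add: upper_boundary_def)
  then show "\<forall>\<^sub>F x in at \<zeta> within D. u x + v x < e"
    by (rule eventually_mono) (use assms(7)[OF z] in linarith)
qed

locale perron =
  fixes D :: "riemann_sphere set" and \<phi> :: "riemann_sphere \<Rightarrow> real" and C :: real
  assumes D: "open D" "D \<noteq> UNIV" and C: "\<And>\<zeta>. \<zeta> \<in> frontier D \<Longrightarrow> \<bar>\<phi> \<zeta>\<bar> \<le> C"
begin

abbreviation "F \<equiv> perron_family D \<phi>"
abbreviation "H \<equiv> perron_solution D \<phi>"

lemma const_mem: "(\<lambda>_. - C) \<in> F"
  unfolding mem_perron_family upper_boundary_def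
proof (intro conjI ballI allI impI always_eventually)
  fix \<zeta> and e :: real assume "\<zeta> \<in> frontier D" "e > 0"
  then show "- C < \<phi> \<zeta> + e" using C[of \<zeta>] by linarith
qed (rule sphere_subharmonic_on_const[OF D(1)])

text \<open>The family is bounded above on \<open>D\<close>, so the supremum in
  \<open>perron_solution\<close> is a genuine least upper bound.\<close>

lemma mem_le: "u \<in> F \<Longrightarrow> x \<in> D \<Longrightarrow> u x \<le> C"
proof -
  assume u: "u \<in> F" and x: "x \<in> D"
  have "u x + - C \<le> 0"
  proof (rule perron_comparison[OF D, of u "\<lambda>_. - C" \<phi> "\<lambda>_. - C"])
    show "upper_boundary D (\<lambda>_. - C) (\<lambda>_. - C)" by (simp add: upper_boundary_def)
    show "\<phi> \<zeta> + - C \<le> 0" if "\<zeta> \<in> frontier D" for \<zeta> using C[OF that] by linarith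
  qed (use u x D in \<open>auto simp: mem_perron_family sphere_subharmonic_on_const\<close>)
  then show "u x \<le> C" by simp
qed

lemma mem_le_solution: "u \<in> F \<Longrightarrow> x \<in> D \<Longrightarrow> u x \<le> H x"
  unfolding perron_solution_def
  by (rule cSUP_upper) (auto intro!: bdd_aboveI2[of _ _ C] mem_le)

lemma solution_le: "(\<And>u. u \<in> F \<Longrightarrow> u x \<le> c) \<Longrightarrow> H x \<le> c"
  unfolding perron_solution_def using const_mem by (intro cSUP_least) auto

lemma approx:
  assumes "e > 0" obtains u where "u \<in> F" "H x - e < u x"
proof -
  have "\<exists>u\<in>F. \<not> u x \<le> H x - e"
    using solution_le[of x "H x - e"] assms by force
  then show thesis using that by (auto simp: not_le)
qed

lemma max_mem:
  assumes "u \<in> F" "v \<in> F" shows "(\<lambda>x. max (u x) (v x)) \<in> F"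
  using assms unfolding mem_perron_family upper_boundary_def
  by (auto intro!: sphere_subharmonic_on_max D intro: eventually_conj)

lemma finite_max_mem:
  assumes "finite A" "A \<subseteq> F" shows "\<exists>u\<in>F. (\<forall>x. \<forall>v\<in>A. v x \<le> u x)"
  using assms
proof (induction A)
  case empty then show ?case using const_mem by auto
next
  case (insert v A)
  then obtain u where u: "u \<in> F" "\<forall>x. \<forall>v\<in>A. v x \<le> u x" by auto
  have "\<forall>x. \<forall>w\<in>insert v A. w x \<le> max (u x) (v x)"
    using u(2) by (auto intro: max.coboundedI1)
  moreover have "(\<lambda>x. max (u x) (v x)) \<in> F" using u insert by (intro max_mem) auto
  ultimately show ?case by (rule_tac bexI)
qed

text \<open>Perron's lifting: inside the disc \<open>u\<close> is replaced by the Poisson integral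
  of its values on the circle. The result dominates \<open>u\<close>, and it differs from
  \<open>u\<close> only on a compact part of \<open>D\<close>.\<close>

lemma poisson_modification:
  assumes u: "u \<in> F" and r: "r > 0" and sub: "cball c r \<subseteq> {z. chart b z \<in> D}"
  obtains w where "w \<in> F" "\<And>x. x \<in> D \<Longrightarrow> u x \<le> w x"
    "\<And>z. z \<in> cball c r \<Longrightarrow> w (chart b z) = poisson (\<lambda>z. u (chart b z)) c r z"
proof -
  let ?U = "chart b ` ball c r" and ?K = "chart b ` cball c r"
  let ?v = "\<lambda>z. u (chart b z)"
  let ?p = "poisson ?v c r"
  define w where "w x = (if x \<in> ?U then ?p (chart_inv b x) else u x)" for x
  have us: "sphere_subharmonic_on u D" and ub: "upper_boundary D u \<phi>"
    using u by (auto simp: mem_perron_family)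
  have cu: "continuous_on D u" by (rule sphere_subharmonic_on_continuous[OF us D(1)])
  have cv: "continuous_on (cball c r) ?v"
    by (rule continuous_on_compose2[OF cu continuous_on_chart]) (use sub in auto)
  have cv': "continuous_on (sphere c r) ?v" by (rule continuous_on_subset[OF cv]) auto
  have lv: "locally_submean ?v z" if "chart b z \<in> D" for z
    by (rule sphere_subharmonic_on_locally[OF us D(1) that])
  have U: "open ?U" by (rule open_chart_image) simp
  have K: "compact ?K" by (intro compact_continuous_image continuous_on_chart compact_cball)
  have KD: "?K \<subseteq> D" using sub by auto
  have w_K: "w (chart b z) = ?p z" if "z \<in> cball c r" for z
  proof (cases "z \<in> ball c r")
    case False
    then have "z \<in> sphere c r" using that by auto
    then show ?thesis using False poisson_boundary[OF cv' r, of z] by (simp add: w_def)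
  qed (simp add: w_def)
  have w_ge: "u x \<le> w x" if "x \<in> D" for x
  proof (cases "x \<in> ?U")
    case True
    then obtain z where z: "z \<in> ball c r" "x = chart b z" by auto
    have "?v z \<le> ?p z"
      by (rule le_poisson[OF cv' r cv]) (use z lv subsetD[OF sub] in auto)
    then show ?thesis using z by (simp add: w_def)
  qed (simp add: w_def)
  \<comment> \<open>Two relatively closed pieces, the closed disc and the complement of the open
    disc, overlap in the circle, where both formulas for \<open>w\<close> agree.\<close>
  have cw: "continuous_on D w"
  proof -
    have "continuous_on (?K \<union> (D - ?U)) w"
    proof (rule continuous_on_Un_local)
      show "closedin (top_of_set (?K \<union> (D - ?U))) ?K"
        by (rule closed_subset) (use K in \<open>auto intro: compact_imp_closed\<close>)
      have "D - ?U = (?K \<union> (D - ?U)) \<inter> - ?U" using KD by blast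
      then show "closedin (top_of_set (?K \<union> (D - ?U))) (D - ?U)"
        using U unfolding closedin_closed by (metis closed_Compl)
      show "continuous_on ?K w"
      proof (rule continuous_on_eq)
        show "continuous_on ?K (\<lambda>x. ?p (chart_inv b x))"
          by (rule continuous_on_compose2[OF continuous_on_poisson[OF cv' r]])
             (auto intro: continuous_on_subset[OF continuous_on_chart_inv])
      qed (auto simp: w_K)
      show "continuous_on (D - ?U) w"
        by (rule continuous_on_eq[OF continuous_on_subset[OF cu]]) (auto simp: w_def)
    qed
    moreover have "?K \<union> (D - ?U) = D" using KD by fastforce
    ultimately show ?thesis by simp
  qed
  have "sphere_subharmonic_on w D"
  proof (rule sphere_subharmonic_onI[OF D(1) cw])
    fix b' z assume zD: "chart b' z \<in> D"
    have cw': "continuous_on {z. chart b' z \<in> D} (\<lambda>z. w (chart b' z))"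
      by (rule continuous_on_compose2[OF cw continuous_on_chart]) auto
    have cu': "continuous_on {z. chart b' z \<in> D} (\<lambda>z. u (chart b' z))"
      by (rule continuous_on_compose2[OF cu continuous_on_chart]) auto
    show "locally_submean (\<lambda>z. w (chart b' z)) z"
    \<comment> \<open>Off the open disc \<open>w\<close> is a majorant of \<open>u\<close> that
      agrees with it at the point. Inside, \<open>w\<close> is harmonic, and the transition from
      \<open>b\<close> to the testing chart \<open>b'\<close> preserves this.\<close>
    proof (cases "chart b' z \<in> ?U")
      case False
      show ?thesis
      proof (rule locally_submean_le[OF sphere_subharmonic_on_locally[OF us D(1) zD] open_chart_vimage[OF D(1)] _ cu' cw'])
        show "w (chart b' z) = u (chart b' z)" using False by (simp add: w_def)
      qed (use zD w_ge in auto)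
    next
      case True
      let ?V = "{z. chart b' z \<in> ?U}"
      have V: "open ?V" by (rule open_chart_vimage[OF U])
      have "re_limit (\<lambda>z. ?p (chart_inv b (chart b' z))) ?V"
      proof (rule re_limit_compose[OF re_limit_poisson[OF cv' r]])
        show "(\<lambda>z. chart_inv b (chart b' z)) holomorphic_on ?V"
          by (rule holomorphic_on_subset[OF holomorphic_chart_transition]) auto
      qed auto
      then have "locally_submean (\<lambda>z. ?p (chart_inv b (chart b' z))) z"
        by (rule re_limit_locally_submean[OF _ V]) (use True in simp)
      then show ?thesis
        using locally_submean_cong[OF V, of z "\<lambda>z. ?p (chart_inv b (chart b' z))" "\<lambda>z. w (chart b' z)"] True
        by (simp add: w_def)
    qed
  qed
  moreover have "upper_boundary D w \<phi>"
    unfolding upper_boundary_def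
  proof (intro ballI allI impI)
    fix \<zeta> and e :: real assume z: "\<zeta> \<in> frontier D" "e > 0"
    \<comment> \<open>The disc is compact in \<open>D\<close>, so near the frontier \<open>w\<close>
      coincides with \<open>u\<close>.\<close>
    have "\<zeta> \<notin> ?K" using KD z(1) D(1) by (auto simp: frontier_def interior_open)
    then have "\<forall>\<^sub>F x in at \<zeta> within D. x \<in> - ?K"
      using K by (intro eventually_at_topological[THEN iffD2] exI[of _ "- ?K"]) (auto intro: compact_imp_closed)
    moreover have "\<forall>\<^sub>F x in at \<zeta> within D. u x < \<phi> \<zeta> + e"
      using ub z by (simp add: upper_boundary_def)
    ultimately show "\<forall>\<^sub>F x in at \<zeta> within D. w x < \<phi> \<zeta> + e"
      by eventually_elim (auto simp: w_def)
  qed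
  ultimately have "w \<in> F" by (simp add: mem_perron_family)
  then show thesis using that w_ge w_K by blast
qed

text \<open>Every member of the family lies below a modified member that is harmonic on the disc and
  bounded by \<open>C\<close>; these share one Lipschitz constant, which passes to the
  supremum.\<close>

lemma solution_lipschitz:
  assumes r: "r > 0" and sub: "cball c r \<subseteq> {z. chart b z \<in> D}"
    and z: "z \<in> ball c (r/2)" and y: "y \<in> ball c (r/2)"
  shows "H (chart b z) \<le> H (chart b y) + exp (C+1) * (exp (C+1) / (r/4)) * norm (z - y)"
proof (rule solution_le)
  fix u assume "u \<in> F"
  \<comment> \<open>Members have no common lower bound; cutting at \<open>- C\<close> supplies the
    one that the Lipschitz estimate needs.\<close>
  then have m: "(\<lambda>x. max (u x) (- C)) \<in> F" by (intro max_mem const_mem)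
  obtain w where w: "w \<in> F" "\<And>x. x \<in> D \<Longrightarrow> max (u x) (- C) \<le> w x"
     "\<And>z. z \<in> cball c r \<Longrightarrow> w (chart b z) = poisson (\<lambda>z. max (u (chart b z)) (-C)) c r z"
    using poisson_modification[OF m r sub] by auto
  have inD: "chart b x \<in> D" if "x \<in> ball c r" for x
    using subsetD[OF sub, of x] that by simp
  have zy: "z \<in> ball c r" "y \<in> ball c r" using z y r by auto
  have "continuous_on (sphere c r) (\<lambda>z. max (u (chart b z)) (-C))"
    by (rule continuous_on_compose2[OF sphere_subharmonic_on_continuous[of "\<lambda>x. max (u x) (- C)" D] continuous_on_chart])
       (use m D sub in \<open>auto simp: mem_perron_family\<close>)
  from re_limit_poisson[OF this r] have "re_limit (\<lambda>z. w (chart b z)) (ball c r)"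
    by (rule re_limit_cong) (simp add: w(3))
  then have "\<bar>w (chart b z) - w (chart b y)\<bar> \<le> exp (C+1) * (exp (C+1) / (r/4)) * norm (z - y)"
  proof (rule re_limit_lipschitz[OF _ r _ z y])
    fix x assume x: "x \<in> ball c r"
    show "\<bar>w (chart b x)\<bar> \<le> C"
      using w(2)[OF inD[OF x]] mem_le[OF w(1) inD[OF x]] by (simp add: abs_le_iff)
  qed
  moreover have "u (chart b z) \<le> w (chart b z)" using w(2)[OF inD[OF zy(1)]] by simp
  moreover have "w (chart b y) \<le> H (chart b y)" by (rule mem_le_solution[OF w(1) inD[OF zy(2)]])
  ultimately show "u (chart b z) \<le> H (chart b y) + exp (C+1) * (exp (C+1) / (r/4)) * norm (z - y)"
    by linarith
qed

lemma continuous_on_solution: "continuous_on D H"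
  unfolding continuous_on_sphere_chart[OF D(1)]
proof (intro allI continuous_at_imp_continuous_on ballI)
  fix b c assume "c \<in> {z. chart b z \<in> D}"
  then obtain r where r: "r > 0" "cball c r \<subseteq> {z. chart b z \<in> D}"
    using chart_cball[OF D(1)] by blast
  define L where "L = exp (C+1) * (exp (C+1) / (r/4))"
  have "L-lipschitz_on (ball c (r/2)) (\<lambda>z. H (chart b z))"
  proof (rule lipschitz_onI)
    fix z y assume "z \<in> ball c (r/2)" "y \<in> ball c (r/2)"
    then show "dist (H (chart b z)) (H (chart b y)) \<le> L * dist z y"
      using solution_lipschitz[OF r, of z y] solution_lipschitz[OF r, of y z]
      by (simp add: L_def dist_norm abs_le_iff norm_minus_commute)
  qed (use r in \<open>simp add: L_def\<close>)
  then have "continuous_on (ball c (r/2)) (\<lambda>z. H (chart b z))"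
    by (rule lipschitz_on_continuous_on)
  then show "isCont (\<lambda>z. H (chart b z)) c"
    using r by (simp add: continuous_on_eq_continuous_at)
qed

text \<open>On a circle, the supremum \<^term>\<open>H\<close> is uniformly approximated from within the family, by
  compactness and closure under finite maxima.\<close>

lemma solution_eq_poisson:
  assumes r: "r > 0" and sub: "cball c r \<subseteq> {z. chart b z \<in> D}" and z: "z \<in> cball c r"
  shows "H (chart b z) = poisson (\<lambda>z. H (chart b z)) c r z"
proof (rule antisym)
  let ?h = "\<lambda>z. H (chart b z)"
  have inD: "chart b x \<in> D" if "x \<in> cball c r" for x
    using subsetD[OF sub that] by simp
  have cH: "continuous_on (sphere c r) ?h"
    by (rule continuous_on_compose2[OF continuous_on_solution continuous_on_chart]) (use inD in auto)
  have cu: "continuous_on (cball c r) (\<lambda>z. u (chart b z))" if "u \<in> F" for u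
    by (rule continuous_on_compose2[OF sphere_subharmonic_on_continuous[of u D] continuous_on_chart])
       (use that D inD in \<open>auto simp: mem_perron_family\<close>)
  show "?h z \<le> poisson ?h c r z"
  proof (rule solution_le)
    fix u assume u: "u \<in> F"
    show "u (chart b z) \<le> poisson ?h c r z"
    proof (rule le_poisson[OF cH r cu[OF u] _ _ z])
      show "locally_submean (\<lambda>z. u (chart b z)) w" if "w \<in> ball c r" for w
        by (rule sphere_subharmonic_on_locally[OF _ D(1) inD]) (use u that in \<open>auto simp: mem_perron_family\<close>)
      show "u (chart b w) \<le> ?h w" if "w \<in> sphere c r" for w
        by (rule mem_le_solution[OF u inD]) (use that in auto)
    qed
  qed
  show "poisson ?h c r z \<le> ?h z"
  proof (rule field_le_epsilon)
    fix e :: real assume e: "e > 0"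
    \<comment> \<open>The part of the circle where \<open>u\<close> comes within \<open>e\<close> of
      the solution is relatively open. Finitely many such parts cover the circle, and the maximum
      \<open>v\<close> of the corresponding members is within \<open>e\<close> of the solution
      everywhere on it.\<close>
    have "\<exists>W. open W \<and> W \<inter> sphere c r = {w\<in>sphere c r. ?h w - u (chart b w) < e}" if "u \<in> F" for u
    proof -
      have "continuous_on (sphere c r) (\<lambda>w. ?h w - u (chart b w))"
        by (intro continuous_intros cH continuous_on_subset[OF cu[OF that]]) auto
      then obtain W where "open W" "W \<inter> sphere c r = (\<lambda>w. ?h w - u (chart b w)) -` {..<e} \<inter> sphere c r"
        unfolding continuous_on_open_invariant using open_lessThan by blast
      moreover have "(\<lambda>w. ?h w - u (chart b w)) -` {..<e} \<inter> sphere c r =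
          {w\<in>sphere c r. ?h w - u (chart b w) < e}"
        by auto
      ultimately show ?thesis by (intro exI[of _ W] conjI) simp_all
    qed
    then have "\<exists>W. \<forall>u\<in>F. open (W u) \<and> W u \<inter> sphere c r = {w\<in>sphere c r. ?h w - u (chart b w) < e}"
      by (intro bchoice ballI)
    then obtain W where W: "\<And>u. u \<in> F \<Longrightarrow> open (W u)"
       "\<And>u. u \<in> F \<Longrightarrow> W u \<inter> sphere c r = {w\<in>sphere c r. ?h w - u (chart b w) < e}"
      by blast
    have "sphere c r \<subseteq> (\<Union>u\<in>F. W u)"
    proof
      fix w assume w: "w \<in> sphere c r"
      obtain u where "u \<in> F" "?h w - e < u (chart b w)" using approx[OF e] by blast
      then have "w \<in> W u \<inter> sphere c r" using W(2) w by auto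
      then show "w \<in> (\<Union>u\<in>F. W u)" using \<open>u \<in> F\<close> by auto
    qed
    then obtain A where A: "A \<subseteq> F" "finite A" "sphere c r \<subseteq> (\<Union>u\<in>A. W u)"
      using compactE_image[OF compact_sphere, of F W c r] W(1) by metis
    obtain v where v: "v \<in> F" "\<And>x u. u \<in> A \<Longrightarrow> u x \<le> v x"
      using finite_max_mem[OF A(2,1)] by auto
    have near: "?h w - e \<le> v (chart b w)" if "w \<in> sphere c r" for w
    proof -
      obtain u where u: "u \<in> A" "w \<in> W u" using A(3) \<open>w \<in> sphere c r\<close> by blast
      then have "w \<in> W u \<inter> sphere c r" "u \<in> F" using A(1) that by auto
      then have "?h w - u (chart b w) < e" using W(2) by blast
      then show ?thesis using v(2)[OF u(1), of "chart b w"] by linarith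
    qed
    \<comment> \<open>Modifying \<open>v\<close> puts the Poisson integral of \<open>v\<close>
      itself into the family, hence below the solution.\<close>
    obtain w where w: "w \<in> F" "\<And>z. z \<in> cball c r \<Longrightarrow> w (chart b z) = poisson (\<lambda>z. v (chart b z)) c r z"
      using poisson_modification[OF v(1) r sub] by metis
    have cvs: "continuous_on (sphere c r) (\<lambda>z. v (chart b z))"
      by (rule continuous_on_subset[OF cu[OF v(1)]]) auto
    have "poisson ?h c r z + - e \<le> poisson (\<lambda>z. v (chart b z)) c r z"
    proof (rule le_poisson[OF cvs r _ _ _ z])
      show "continuous_on (cball c r) (\<lambda>z. poisson ?h c r z + - e)"
        by (intro continuous_intros continuous_on_poisson[OF cH r])
      show "locally_submean (\<lambda>z. poisson ?h c r z + - e) w" if "w \<in> ball c r" for w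
      proof (rule locally_submean_add[OF _ _ open_ball that])
        show "locally_submean (poisson ?h c r) w"
          by (rule re_limit_locally_submean[OF re_limit_poisson[OF cH r] open_ball that])
        show "locally_submean (\<lambda>_. - e) w" by (simp add: locally_submean_def)
      qed (auto intro!: continuous_on_subset[OF continuous_on_poisson[OF cH r]])
      show "poisson ?h c r w + - e \<le> v (chart b w)" if "w \<in> sphere c r" for w
        using near[OF that] poisson_boundary[OF cH r that] by simp
    qed
    also have "\<dots> = w (chart b z)" using w(2)[OF z] by simp
    also have "\<dots> \<le> ?h z" by (rule mem_le_solution[OF w(1) inD[OF z]])
    finally show "poisson ?h c r z \<le> ?h z + e" by simp
  qed
qed

lemma sphere_harmonic_on_solution: "sphere_harmonic_on H D"
  unfolding sphere_harmonic_on_def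
proof (intro conjI allI impI continuous_on_solution)
  fix b c and r :: real assume r: "r > 0" and sub: "cball c r \<subseteq> {z. chart b z \<in> D}"
  have "continuous_on (sphere c r) (\<lambda>z. H (chart b z))"
    by (rule continuous_on_compose2[OF continuous_on_solution continuous_on_chart]) (use sub in auto)
  from re_limit_poisson[OF this r] show "re_limit (\<lambda>z. H (chart b z)) (ball c r)"
    by (rule re_limit_cong) (use solution_eq_poisson[OF r sub] in simp)
qed

end

section \<open>Local form of a rational function\<close>

text \<open>The properties of a nonconstant rational function used from here on. They are symmetric
  in \<open>R\<close> and its reciprocal, so results on the preimage of the disc hold for the
  exterior by interpretation. Finite fibres exclude constant maps.\<close>

locale rational_map =
  fixes R :: "riemann_sphere \<Rightarrow> riemann_sphere"
  assumes hol: "R (chart b z) = Fin w \<Longrightarrow>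
      \<exists>f e. e > 0 \<and> f holomorphic_on ball z e \<and> (\<forall>y\<in>ball z e. R (chart b y) = Fin (f y))"
    and hol_inverse: "sphere_inverse (R (chart b z)) = Fin w \<Longrightarrow>
      \<exists>f e. e > 0 \<and> f holomorphic_on ball z e \<and> (\<forall>y\<in>ball z e. sphere_inverse (R (chart b y)) = Fin (f y))"
    and finite_fibre: "finite {x. R x = y}"

lemma rational_map_inverse:
  assumes "rational_map R" shows "rational_map (\<lambda>x. sphere_inverse (R x))"
proof -
  interpret rational_map R by fact
  show ?thesis
  proof
    fix y
    have "sphere_inverse x = y \<longleftrightarrow> x = sphere_inverse y" for x
      by (metis sphere_inverse_involution)
    then show "finite {x. sphere_inverse (R x) = y}"
      using finite_fibre[of "sphere_inverse y"] by simp
  qed (use hol hol_inverse in simp_all)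
qed

text \<open>Reversing the coefficients, after padding to the common degree, gives the quotient in the
  coordinate at infinity.\<close>

lemma poly_quotient_in_chart:
  assumes nz: "p \<noteq> 0" "q \<noteq> 0"
  shows "\<exists>P Q. (\<forall>z. poly_quotient p q (chart b z) = (if poly Q z = 0 then Infty else Fin (poly P z / poly Q z)))
     \<and> (\<forall>z. poly_quotient q p (chart b z) = (if poly P z = 0 then Infty else Fin (poly Q z / poly P z)))"
proof (cases b)
  case At_zero
  then show ?thesis by (intro exI[of _ p] exI[of _ q]) (simp add: chart_def)
next
  case At_infinity
  define n where "n = max (degree p) (degree q)"
  define P where "P = monom 1 (n - degree p) * reflect_poly p"
  define Q where "Q = monom 1 (n - degree q) * reflect_poly q"
  have nz': "poly (monom 1 (n - degree f) * reflect_poly f) z = z ^ n * poly f (inverse z)"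
    if "z \<noteq> 0" "degree f \<le> n" for z and f :: "complex poly"
    using that by (simp add: poly_monom poly_reflect_poly_nz flip: power_add)
  \<comment> \<open>At 0 the padded reversal takes the coefficient of degree \<open>n\<close>, which
    is the leading coefficient if \<open>f\<close> has full degree and 0 otherwise; this reproduces
    the case distinction in the value at \<open>Infty\<close>.\<close>
  have z0: "poly (monom 1 (n - degree f) * reflect_poly f) 0 = coeff f n"
    if "degree f \<le> n" for f :: "complex poly"
  proof (cases "degree f = n")
    case False
    then have "degree f < n" using that by simp
    then show ?thesis by (simp add: poly_monom coeff_eq_0 zero_power)
  qed (auto simp: poly_monom)
  have PQ: "degree p \<le> n" "degree q \<le> n" by (auto simp: n_def)
  have 1: "poly_quotient p q (chart b z) = (if poly Q z = 0 then Infty else Fin (poly P z / poly Q z))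
     \<and> poly_quotient q p (chart b z) = (if poly P z = 0 then Infty else Fin (poly Q z / poly P z))" for z
  proof (cases "z = 0")
    case True
    have c: "chart b z = Infty" using True At_infinity by (simp add: chart_def)
    have v: "poly P z = coeff p n" "poly Q z = coeff q n"
      using z0 PQ True by (auto simp: P_def Q_def)
    consider "degree p < degree q" | "degree q < degree p" | "degree p = degree q" by linarith
    then show ?thesis
    proof cases
      case 1
      then have "n = degree q" by (simp add: n_def)
      then show ?thesis using 1 nz v c by (simp add: coeff_eq_0)
    next
      case 2
      then have "n = degree p" by (simp add: n_def)
      then show ?thesis using 2 nz v c by (simp add: coeff_eq_0)
    next
      case 3
      then have "n = degree q" by (simp add: n_def)
      moreover have "coeff p (degree q) \<noteq> 0" using 3 nz by (metis leading_coeff_0_iff)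
      ultimately show ?thesis using 3 nz v c by simp
    qed
  next
    case False
    then have c: "chart b z = Fin (inverse z)" using At_infinity by (simp add: chart_def)
    have v: "poly P z = z ^ n * poly p (inverse z)" "poly Q z = z ^ n * poly q (inverse z)"
      using nz' PQ False by (auto simp: P_def Q_def)
    show ?thesis using False by (simp add: c v)
  qed
  show ?thesis by (intro exI[of _ P] exI[of _ Q]) (use 1 in blast)
qed

lemma sphere_inverse_poly_quotient:
  assumes nz: "p \<noteq> 0" "q \<noteq> 0" and cop: "\<And>z. \<not> (poly p z = 0 \<and> poly q z = 0)"
  shows "sphere_inverse (poly_quotient p q x) = poly_quotient q p x"
proof (cases x)
  case (Fin z)
  then show ?thesis using cop[of z] by auto
next
  case Infty
  have "coeff p (degree q) \<noteq> 0" if "degree p = degree q"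
    using that nz by (metis leading_coeff_0_iff)
  then show ?thesis using Infty nz by (auto simp: coeff_eq_0)
qed

lemma rational_quotient_holomorphic:
  assumes Q: "\<And>z. S (chart b z) = (if poly Q z = 0 then Infty else Fin (poly P z / poly Q z))"
    and w: "S (chart b z) = Fin w"
  shows "\<exists>f e. e > 0 \<and> f holomorphic_on ball z e \<and> (\<forall>y\<in>ball z e. S (chart b y) = Fin (f y))"
proof -
  have "poly Q z \<noteq> 0" using w Q[of z] by (auto split: if_splits)
  moreover have "open {y. poly Q y \<noteq> 0}"
    by (intro open_Collect_neq continuous_intros)
  ultimately obtain e where e: "e > 0" "ball z e \<subseteq> {y. poly Q y \<noteq> 0}"
    unfolding open_contains_ball by blast
  then have ne: "poly Q y \<noteq> 0" if "y \<in> ball z e" for y using that by blast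
  have "(\<lambda>y. poly P y / poly Q y) holomorphic_on ball z e"
    by (intro holomorphic_intros) (use ne in blast)
  then show ?thesis
    using e(1) Q ne by (intro exI[of _ "\<lambda>y. poly P y / poly Q y"] exI[of _ e]) simp
qed

lemma rational_function_imp_rational_map:
  assumes "rational_function R d" "d \<ge> 1"
  shows "rational_map R"
proof -
  obtain p q where pq: "q \<noteq> 0" "coprime p q" "R = poly_quotient p q" "d = max (degree p) (degree q)"
    using assms(1) by (auto simp: rational_function_def)
  have cop: "\<not> (poly p z = 0 \<and> poly q z = 0)" for z
  proof
    assume "poly p z = 0 \<and> poly q z = 0"
    then have "[:-z, 1:] dvd p" "[:-z, 1:] dvd q" by (auto simp: poly_eq_0_iff_dvd)
    then have "[:-z, 1:] dvd 1" using pq(2) by (meson coprime_common_divisor)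
    then show False by (simp add: is_unit_iff_degree)
  qed
  have p0: "p \<noteq> 0"
  proof
    assume "p = 0"
    then have "q dvd 1" using pq(2) by simp
    then have "degree q = 0" using pq(1) by (simp add: is_unit_iff_degree)
    then show False using \<open>p = 0\<close> pq(4) assms(2) by simp
  qed
  have inv: "sphere_inverse (R x) = poly_quotient q p x" for x
    unfolding pq(3) by (rule sphere_inverse_poly_quotient[OF p0 pq(1) cop])
  show ?thesis
  proof
    fix b z w
    obtain P Q where PQ:
      "\<And>z. poly_quotient p q (chart b z) = (if poly Q z = 0 then Infty else Fin (poly P z / poly Q z))"
      "\<And>z. poly_quotient q p (chart b z) = (if poly P z = 0 then Infty else Fin (poly Q z / poly P z))"
      using poly_quotient_in_chart[OF p0 pq(1), of b] by blast
    show "\<exists>f e. e > 0 \<and> f holomorphic_on ball z e \<and> (\<forall>y\<in>ball z e. R (chart b y) = Fin (f y))"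
      if "R (chart b z) = Fin w"
      using rational_quotient_holomorphic[OF PQ(1)] that unfolding pq(3) by blast
    show "\<exists>f e. e > 0 \<and> f holomorphic_on ball z e \<and> (\<forall>y\<in>ball z e. sphere_inverse (R (chart b y)) = Fin (f y))"
      if "sphere_inverse (R (chart b z)) = Fin w"
      using rational_quotient_holomorphic[OF PQ(2)] that unfolding inv by blast
  next
    fix y
    have "{x. R x = y} \<subseteq> insert Infty (Fin ` {z. R (Fin z) = y})"
    proof
      fix x assume "x \<in> {x. R x = y}"
      then show "x \<in> insert Infty (Fin ` {z. R (Fin z) = y})" by (cases x) auto
    qed
    moreover have "finite {z. R (Fin z) = y}"
    proof (cases y)
      case (Fin c)
      \<comment> \<open>Otherwise \<open>q\<close> divides \<open>p\<close>, coprimality makes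
        \<open>q\<close> constant, then \<open>p\<close> is constant as well, and the degree would
        be 0.\<close>
      have "p - smult c q \<noteq> 0"
      proof
        assume "p - smult c q = 0"
        then have pc: "p = smult c q" by simp
        then have "q dvd p" by (simp add: dvd_smult)
        then have "q dvd 1" using pq(2) by (meson coprime_common_divisor dvd_refl)
        then have "degree q = 0" using pq(1) by (simp add: is_unit_iff_degree)
        then have "d = 0" using pq(4) pc by simp
        then show False using assms(2) by simp
      qed
      then have "finite {z. poly (p - smult c q) z = 0}" by (rule poly_roots_finite)
      moreover have "{z. R (Fin z) = y} \<subseteq> {z. poly (p - smult c q) z = 0}"
        using Fin by (auto simp: pq(3) field_simps split: if_splits)
      ultimately show ?thesis by (rule rev_finite_subset)
    next
      case Infty
      have "{z. R (Fin z) = y} \<subseteq> {z. poly q z = 0}"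
        using Infty by (auto simp: pq(3) split: if_splits)
      then show ?thesis using poly_roots_finite[OF pq(1)] by (rule finite_subset)
    qed
    ultimately show "finite {x. R x = y}" by (meson finite_imageI finite_insert finite_subset)
  qed
qed

text \<open>The local degree of \<open>R\<close> at a point with finite value:
  \<open>zero_multiplicity\<close> with the value 0 replaced by \<open>R x\<close>.\<close>

definition fibre_mult :: "(riemann_sphere \<Rightarrow> riemann_sphere) \<Rightarrow> riemann_sphere \<Rightarrow> nat" where
  "fibre_mult R x = nat (zorder (\<lambda>z. the_Fin (R (local_chart x z)) - the_Fin (R x)) 0)"

lemma zero_multiplicity_eq: "zero_multiplicity R x = (if R x = Fin 0 then fibre_mult R x else 0)"
  by (simp add: zero_multiplicity_def fibre_mult_def)

lemma local_chart_eq_chart: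
  obtains b z where "x = chart b z" "\<And>y. local_chart x y = chart b (z + y)"
proof (cases x)
  case (Fin a)
  then show thesis using that[of At_zero a] by (simp add: chart_def)
next
  case Infty
  then show thesis using that[of At_infinity 0] by (simp add: chart_def)
qed

lemma fibre_mult_eqI:
  assumes x: "x = chart b z" "\<And>y. local_chart x y = chart b (z + y)" and r: "r > 0"
    and f: "\<And>y. y \<in> ball z r \<Longrightarrow> R (chart b y) = Fin (f y)"
    and g: "g holomorphic_on ball z r" "g z \<noteq> 0"
    and eq: "\<And>y. y \<in> ball z r \<Longrightarrow> f y - f z = (y - z) ^ n * g y"
  shows "fibre_mult R x = n"
proof -
  have "zorder (\<lambda>y. the_Fin (R (local_chart x y)) - the_Fin (R x)) 0 = int n"
  proof (rule zorder_eqI)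
    show "open (ball (0::complex) r)" "0 \<in> ball (0::complex) r" using r by auto
    show "(\<lambda>y. g (z + y)) holomorphic_on ball 0 r"
      by (rule holomorphic_on_compose_gen[OF _ g(1), unfolded o_def])
         (auto intro!: holomorphic_intros simp: dist_norm)
    show "g (z + 0) \<noteq> 0" using g(2) by simp
    fix y :: complex assume "y \<in> ball 0 r" "y \<noteq> 0"
    then have "z + y \<in> ball z r" by (simp add: dist_norm)
    then show "the_Fin (R (local_chart x y)) - the_Fin (R x) = g (z + y) * (y - 0) powi int n"
      using eq[of "z + y"] f[of "z + y"] f[of z] r x by (simp add: mult.commute)
  qed
  then show ?thesis by (simp add: fibre_mult_def)
qed

context rational_map
begin

lemma continuous_on_R: "continuous_on S R"
proof -
  \<comment> \<open>Stated for an arbitrary \<open>T\<close> so that it serves \<open>R\<close> at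
    points with finite value and its reciprocal at poles.\<close>
  have *: "isCont T x" if T: "\<And>b z w. T (chart b z) = Fin w \<Longrightarrow>
      \<exists>f e. e > 0 \<and> f holomorphic_on ball z e \<and> (\<forall>y\<in>ball z e. T (chart b y) = Fin (f y))"
    and w: "T x = Fin w" for T x w
  proof -
    obtain b z where x: "x = chart b z" by (rule chart_cover)
    obtain f e where f: "e > 0" "f holomorphic_on ball z e" "\<And>y. y \<in> ball z e \<Longrightarrow> T (chart b y) = Fin (f y)"
      using T[of b z w] w x by auto
    have "continuous_on (chart b ` ball z e) (\<lambda>x. f (chart_inv b x))"
      by (rule continuous_on_compose2[OF holomorphic_on_imp_continuous_on[OF f(2)]])
         (auto intro: continuous_on_subset[OF continuous_on_chart_inv])
    then have "continuous_on (chart b ` ball z e) (\<lambda>x. Fin (f (chart_inv b x)))"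
      by (rule continuous_on_compose2[OF continuous_on_Fin[of UNIV]]) auto
    then have "continuous_on (chart b ` ball z e) T"
      by (rule continuous_on_eq) (auto simp: f(3))
    then show ?thesis
      using open_chart_image[OF open_ball, of b z e] f(1) x by (auto simp: continuous_on_eq_continuous_at)
  qed
  have "isCont R x" for x
  proof (cases "R x")
    case (Fin w) then show ?thesis using *[of R x w] hol by blast
  next
    case Infty
    have "isCont (\<lambda>x. sphere_inverse (R x)) x"
      using *[of "\<lambda>x. sphere_inverse (R x)" x 0] hol_inverse Infty by simp
    moreover have "isCont sphere_inverse (sphere_inverse (R x))"
      using continuous_on_sphere_inverse[of UNIV] by (simp add: continuous_on_eq_continuous_at)
    ultimately have "isCont (\<lambda>x. sphere_inverse (sphere_inverse (R x))) x"
      by (rule isCont_o2)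
    then show ?thesis by simp
  qed
  then show ?thesis by (simp add: continuous_at_imp_continuous_on)
qed

lemma local_factor:
  assumes "R x = Fin c"
  obtains b z r f g n where "x = chart b z" "\<And>y. local_chart x y = chart b (z + y)" "r > 0"
    "f holomorphic_on ball z r" "\<And>y. y \<in> ball z r \<Longrightarrow> R (chart b y) = Fin (f y)" "f z = c"
    "g holomorphic_on ball z r" "\<And>y. y \<in> ball z r \<Longrightarrow> g y \<noteq> 0" "n > 0"
    "\<And>y. y \<in> ball z r \<Longrightarrow> f y - c = (y - z) ^ n * g y"
proof -
  obtain b z where x: "x = chart b z" "\<And>y. local_chart x y = chart b (z + y)"
    using local_chart_eq_chart[of x] by blast
  have "R (chart b z) = Fin c" using assms x(1) by simp
  from hol[OF this] obtain f e where f: "e > 0" "f holomorphic_on ball z e"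
      "\<And>y. y \<in> ball z e \<Longrightarrow> R (chart b y) = Fin (f y)"
    by blast
  have fz: "f z = c" using f(1) f(3)[of z] assms x(1) by simp
  \<comment> \<open>A locally constant \<open>R\<close> would have an infinite fibre.\<close>
  have nc: "\<not> (\<lambda>y. f y - c) constant_on ball z e"
  proof
    assume "(\<lambda>y. f y - c) constant_on ball z e"
    then obtain k where k: "\<And>y. y \<in> ball z e \<Longrightarrow> f y - c = k" by (auto simp: constant_on_def)
    have "k = 0" using k[of z] f(1) fz by simp
    then have "chart b ` ball z e \<subseteq> {x. R x = Fin c}" using f(3) k by auto
    then have "finite (chart b ` ball z e)" using finite_fibre[of "Fin c"] by (rule finite_subset)
    then have "finite (ball z e)" by (rule finite_imageD) (auto intro: inj_onI)
    then show False using f(1) finite_imp_not_open[of "ball z e"] by auto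
  qed
  have h: "(\<lambda>y. f y - c) holomorphic_on ball z e" by (intro holomorphic_intros f)
  obtain g r n where g: "0 < n" "0 < r" "ball z r \<subseteq> ball z e" "g holomorphic_on ball z r"
     "\<And>y. y \<in> ball z r \<Longrightarrow> f y - c = (y - z) ^ n * g y" "\<And>y. y \<in> ball z r \<Longrightarrow> g y \<noteq> 0"
    using holomorphic_factor_zero_nonconstant[OF h open_ball connected_ball _ _ nc, of z] f(1) fz
    by (metis cancel_comm_monoid_add_class.diff_cancel centre_in_ball)
  show thesis
    by (rule that[OF x g(2) holomorphic_on_subset[OF f(2) g(3)] f(3) fz g(4,6,1,5)]) (use g(3) in auto)
qed

text \<open>The normal form of a holomorphic map at a point, branch points included:
  \<open>s\<close> is a root of \<open>R - c\<close> of order the local degree, used as a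
  coordinate. \<open>N\<close> confines its range, so that forms at different points can be kept
  disjoint.\<close>

definition local_form :: "riemann_sphere \<Rightarrow> complex \<Rightarrow> riemann_sphere set \<Rightarrow> coordinate \<Rightarrow> (complex \<Rightarrow> complex) \<Rightarrow> real \<Rightarrow> bool" where
  "local_form x c N b \<kappa> \<rho> \<longleftrightarrow> \<rho> > 0 \<and> \<kappa> holomorphic_on ball 0 \<rho> \<and> inj_on \<kappa> (ball 0 \<rho>) \<and> chart b (\<kappa> 0) = x \<and>
     (\<forall>s\<in>ball 0 \<rho>. chart b (\<kappa> s) \<in> N \<and> R (chart b (\<kappa> s)) = Fin (c + s ^ fibre_mult R x))"

text \<open>The nonvanishing factor \<open>g\<close> in \<open>f y - c = (y - z) ^ n * g y\<close>
  has a holomorphic \<open>n\<close>-th root \<open>h\<close> on the disc. Then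
  \<open>(y - z) * h y\<close> has derivative \<open>h z\<close>, different from 0, at
  \<open>z\<close>, and its local inverse is the required \<open>\<kappa>\<close>.\<close>

lemma local_form_exists:
  assumes Rx: "R x = Fin c" and N: "open N" "x \<in> N"
  shows "fibre_mult R x > 0" "\<exists>b \<kappa> \<rho>. local_form x c N b \<kappa> \<rho>"
proof -
  obtain b z r f g n where x: "x = chart b z" "\<And>y. local_chart x y = chart b (z + y)" and r: "r > 0"
    and f: "f holomorphic_on ball z r" "\<And>y. y \<in> ball z r \<Longrightarrow> R (chart b y) = Fin (f y)" "f z = c"
    and g: "g holomorphic_on ball z r" "\<And>y. y \<in> ball z r \<Longrightarrow> g y \<noteq> 0" and n: "n > 0"
    and eq: "\<And>y. y \<in> ball z r \<Longrightarrow> f y - c = (y - z) ^ n * g y"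
    using local_factor[OF Rx] by blast
  have m: "fibre_mult R x = n"
    by (rule fibre_mult_eqI[where f = f and g = g, OF x r f(2) g(1)]) (use r g(2) eq f(3) in auto)
  then show "fibre_mult R x > 0" using n by simp
  obtain k where k: "k holomorphic_on ball z r" "\<And>y. y \<in> ball z r \<Longrightarrow> exp (k y) = g y"
    using holomorphic_logarithm_exists[OF convex_ball open_ball g(1,2), of z] r by auto
  define h where "h y = exp (k y / of_nat n)" for y
  define \<psi> where "\<psi> y = (y - z) * h y" for y
  have h: "h holomorphic_on ball z r" unfolding h_def by (intro holomorphic_intros k) (use n in auto)
  have hn: "h y ^ n = g y" if "y \<in> ball z r" for y
    using n k(2)[OF that] by (simp add: h_def exp_divide_power_eq)
  have \<psi>: "\<psi> holomorphic_on ball z r" unfolding \<psi>_def by (intro holomorphic_intros h)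
  have f\<psi>: "f y = c + \<psi> y ^ n" if "y \<in> ball z r" for y
    using eq[OF that] by (simp add: \<psi>_def power_mult_distrib hn[OF that] diff_eq_eq add.commute)
  have zr: "z \<in> ball z r" using r by simp
  have "(\<psi> has_field_derivative (1 - 0) * h z + deriv h z * (z - z)) (at z)"
    unfolding \<psi>_def
    by (intro DERIV_mult DERIV_diff DERIV_ident DERIV_const holomorphic_derivI[OF h open_ball zr])
  then have d: "deriv \<psi> z \<noteq> 0" by (simp add: DERIV_imp_deriv h_def)
  define S where "S = ball z r \<inter> {y. chart b y \<in> N}"
  have S: "open S" "z \<in> S" "S \<subseteq> ball z r" using open_chart_vimage[OF N(1), of b] N(2) x(1) zr by (auto simp: S_def)
  obtain r1 where r1: "r1 > 0" "ball z r1 \<subseteq> S" "open (\<psi> ` ball z r1)" "inj_on \<psi> (ball z r1)"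
    using has_complex_derivative_locally_invertible[OF holomorphic_on_subset[OF \<psi> S(3)] S(2,1) d] by blast
  have r1r: "ball z r1 \<subseteq> ball z r" using r1(2) S(3) by (rule order_trans)
  obtain \<kappa> where \<kappa>: "\<kappa> holomorphic_on (\<psi> ` ball z r1)" "\<And>y. y \<in> ball z r1 \<Longrightarrow> \<kappa> (\<psi> y) = y"
    by (rule holomorphic_has_inverse[OF holomorphic_on_subset[OF \<psi> r1r] open_ball r1(4)]) (rule that; assumption)
  have z1: "z \<in> ball z r1" using r1(1) by simp
  have \<psi>z: "\<psi> z = 0" by (simp add: \<psi>_def)
  have "0 \<in> \<psi> ` ball z r1" using image_eqI[of 0 \<psi> z] z1 \<psi>z by simp
  from r1(3)[unfolded open_contains_ball, rule_format, OF this]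
  obtain \<rho> where \<rho>: "\<rho> > 0" "ball 0 \<rho> \<subseteq> \<psi> ` ball z r1" by (elim exE conjE)
  have pre: "\<kappa> s \<in> ball z r1" "\<psi> (\<kappa> s) = s" if "s \<in> ball 0 \<rho>" for s
  proof -
    obtain y where y: "y \<in> ball z r1" "s = \<psi> y" using \<rho>(2) \<open>s \<in> ball 0 \<rho>\<close> by blast
    show "\<kappa> s \<in> ball z r1" "\<psi> (\<kappa> s) = s" using \<kappa>(2)[OF y(1)] y by simp_all
  qed
  have "local_form x c N b \<kappa> \<rho>"
    unfolding local_form_def
  proof (intro conjI ballI)
    show "\<kappa> holomorphic_on ball 0 \<rho>" by (rule holomorphic_on_subset[OF \<kappa>(1) \<rho>(2)])
    show "inj_on \<kappa> (ball 0 \<rho>)"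
    proof (rule inj_onI)
      fix s t assume st: "s \<in> ball 0 \<rho>" "t \<in> ball 0 \<rho>" "\<kappa> s = \<kappa> t"
      show "s = t"
        using arg_cong[OF st(3), of \<psi>] unfolding pre(2)[OF st(1)] pre(2)[OF st(2)] .
    qed
    show "chart b (\<kappa> 0) = x" using \<kappa>(2)[OF z1] \<psi>z x(1) by simp
    fix s :: complex assume s: "s \<in> ball 0 \<rho>"
    have "\<kappa> s \<in> S" "\<kappa> s \<in> ball z r"
      using subsetD[OF r1(2) pre(1)[OF s]] subsetD[OF r1r pre(1)[OF s]] by simp_all
    then show "chart b (\<kappa> s) \<in> N" "R (chart b (\<kappa> s)) = Fin (c + s ^ fibre_mult R x)"
      using f(2)[of "\<kappa> s"] f\<psi>[of "\<kappa> s"] unfolding pre(2)[OF s] m S_def by simp_all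
  qed (fact \<rho>(1))
  then show "\<exists>b \<kappa> \<rho>. local_form x c N b \<kappa> \<rho>" by blast
qed

lemma local_formD:
  assumes "local_form x c N b \<kappa> \<rho>"
  shows "\<rho> > 0" "\<kappa> holomorphic_on ball 0 \<rho>" "inj_on (\<lambda>s. chart b (\<kappa> s)) (ball 0 \<rho>)" "chart b (\<kappa> 0) = x"
    "\<And>s. s \<in> ball 0 \<rho> \<Longrightarrow> chart b (\<kappa> s) \<in> N"
    "\<And>s. s \<in> ball 0 \<rho> \<Longrightarrow> R (chart b (\<kappa> s)) = Fin (c + s ^ fibre_mult R x)"
    "continuous_on (ball 0 \<rho>) (\<lambda>s. chart b (\<kappa> s))"
    "\<And>S. open S \<Longrightarrow> S \<subseteq> ball 0 \<rho> \<Longrightarrow> open ((\<lambda>s. chart b (\<kappa> s)) ` S)"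
proof -
  have h: "\<kappa> holomorphic_on ball 0 \<rho>" and i: "inj_on \<kappa> (ball 0 \<rho>)"
    using assms by (auto simp: local_form_def)
  show "\<rho> > 0" and "\<kappa> holomorphic_on ball 0 \<rho>" and "chart b (\<kappa> 0) = x" and
    "\<And>s. s \<in> ball 0 \<rho> \<Longrightarrow> chart b (\<kappa> s) \<in> N" and
    "\<And>s. s \<in> ball 0 \<rho> \<Longrightarrow> R (chart b (\<kappa> s)) = Fin (c + s ^ fibre_mult R x)"
    using assms by (auto simp: local_form_def)
  show "inj_on (\<lambda>s. chart b (\<kappa> s)) (ball 0 \<rho>)" using i by (simp add: inj_on_def)
  show "continuous_on (ball 0 \<rho>) (\<lambda>s. chart b (\<kappa> s))"
    by (rule continuous_on_compose2[OF continuous_on_chart[of UNIV] holomorphic_on_imp_continuous_on[OF h]]) auto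
  fix S :: "complex set" assume S: "open S" "S \<subseteq> ball 0 \<rho>"
  have "open (chart b ` \<kappa> ` S)"
    by (intro open_chart_image open_mapping_thm3[OF holomorphic_on_subset[OF h S(2)] S(1)] inj_on_subset[OF i S(2)])
  then show "open ((\<lambda>s. chart b (\<kappa> s)) ` S)" by (simp add: image_image)
qed

text \<open>Near a nonzero \<open>s\<close> the power map is injective, hence so is \<open>R\<close>
  near the corresponding point. A local form there with exponent \<open>k\<close> would take equal
  values at \<open>k\<close> distinct roots, so \<open>k = 1\<close>.\<close>

lemma fibre_mult_simple:
  assumes lf: "local_form x c N b \<kappa> \<rho>" and s: "s \<in> ball 0 \<rho>" "s \<noteq> 0" and m: "fibre_mult R x > 0"
  shows "fibre_mult R (chart b (\<kappa> s)) = 1"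
proof -
  note L = local_formD[OF lf]
  let ?m = "fibre_mult R x" and ?y = "chart b (\<kappa> s)"
  have "((\<lambda>t. t ^ ?m) has_field_derivative of_nat ?m * s ^ (?m - Suc 0)) (at s)"
    by (auto intro!: derivative_eq_intros)
  then have "deriv (\<lambda>t. t ^ ?m) s \<noteq> 0" using m s(2) by (simp add: DERIV_imp_deriv)
  moreover have "(\<lambda>t. t ^ ?m) holomorphic_on ball 0 \<rho>" by (intro holomorphic_intros)
  ultimately obtain r where r: "r > 0" "ball s r \<subseteq> ball 0 \<rho>" "inj_on (\<lambda>t. t ^ ?m) (ball s r)"
    using has_complex_derivative_locally_invertible[of "\<lambda>t. t ^ ?m" "ball 0 \<rho>" s] s(1) by blast
  define N' where "N' = (\<lambda>s. chart b (\<kappa> s)) ` ball s r"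
  have N': "open N'" "?y \<in> N'" unfolding N'_def using L(8)[OF open_ball r(2)] r(1) by auto
  have inj: "inj_on R N'"
  proof (rule inj_onI)
    fix u v assume "u \<in> N'" "v \<in> N'" and eq: "R u = R v"
    then obtain t t' where t: "t \<in> ball s r" "t' \<in> ball s r" "u = chart b (\<kappa> t)" "v = chart b (\<kappa> t')"
      by (auto simp: N'_def)
    have "t ^ ?m = t' ^ ?m" using eq t L(6)[OF subsetD[OF r(2) t(1)]] L(6)[OF subsetD[OF r(2) t(2)]] by simp
    then have "t = t'" using inj_onD[OF r(3)] t by blast
    then show "u = v" using t by simp
  qed
  have Ry: "R ?y = Fin (c + s ^ ?m)" by (rule L(6)[OF s(1)])
  let ?k = "fibre_mult R ?y"
  have k: "?k > 0" by (rule local_form_exists(1)[OF Ry N'])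
  obtain b' \<kappa>' \<rho>' where lf': "local_form ?y (c + s ^ ?m) N' b' \<kappa>' \<rho>'"
    using local_form_exists(2)[OF Ry N'] by blast
  note L' = local_formD[OF lf']
  define t where "t = complex_of_real (\<rho>' / 2)"
  have t: "t \<in> ball 0 \<rho>'" "t \<noteq> 0" using L'(1) by (auto simp: t_def)
  \<comment> \<open>All these roots have the modulus of \<open>t\<close>, so they stay in the
    coordinate disc, where injectivity of \<open>R\<close> identifies them.\<close>
  have "{u. u ^ ?k = t ^ ?k} \<subseteq> {t}"
  proof
    fix u assume "u \<in> {u. u ^ ?k = t ^ ?k}"
    then have u: "u ^ ?k = t ^ ?k" by simp
    then have "norm u = norm t" using k by (metis norm_power norm_ge_zero power_eq_imp_eq_base)
    then have u': "u \<in> ball 0 \<rho>'" using t by simp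
    have "R (chart b' (\<kappa>' u)) = R (chart b' (\<kappa>' t))" using L'(6)[OF u'] L'(6)[OF t(1)] u by simp
    then have "chart b' (\<kappa>' u) = chart b' (\<kappa>' t)"
      using inj_onD[OF inj] L'(5)[OF u'] L'(5)[OF t(1)] by blast
    then show "u \<in> {t}" using inj_onD[OF L'(3)] u' t(1) by blast
  qed
  then have "card {u. u ^ ?k = t ^ ?k} \<le> card {t}" by (rule card_mono[rotated]) simp
  moreover have "card {u. u ^ ?k = t ^ ?k} = ?k" using t(2) k by (intro card_nth_roots) auto
  ultimately show ?thesis using k by simp
qed

text \<open>\<open>1/f - 1/c = - (f - c) / (f * c)\<close>, and the denominator does not vanish near
  the point, so the order of vanishing is the same.\<close>

lemma fibre_mult_inverse:
  assumes "R x = Fin c" "c \<noteq> 0"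
  shows "fibre_mult (\<lambda>x. sphere_inverse (R x)) x = fibre_mult R x"
proof -
  obtain b z r f g n where x: "x = chart b z" "\<And>y. local_chart x y = chart b (z + y)" and r: "r > 0"
    and f: "f holomorphic_on ball z r" "\<And>y. y \<in> ball z r \<Longrightarrow> R (chart b y) = Fin (f y)" "f z = c"
    and g: "g holomorphic_on ball z r" "\<And>y. y \<in> ball z r \<Longrightarrow> g y \<noteq> 0" and n: "n > 0"
    and eq: "\<And>y. y \<in> ball z r \<Longrightarrow> f y - c = (y - z) ^ n * g y"
    using local_factor[OF assms(1)] by blast
  have m: "fibre_mult R x = n"
    by (rule fibre_mult_eqI[where f = f and g = g, OF x r f(2) g(1)]) (use r g(2) eq f(3) in auto)
  have "isCont f z" using holomorphic_on_imp_continuous_on[OF f(1)] r by (simp add: continuous_on_eq_continuous_at)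
  then obtain e where e: "e > 0" "\<And>y. dist z y < e \<Longrightarrow> f y \<noteq> 0"
    using continuous_at_avoid[of z f 0] f(3) assms(2) by blast
  define r' where "r' = min r e"
  have r': "r' > 0" "ball z r' \<subseteq> ball z r" "\<And>y. y \<in> ball z r' \<Longrightarrow> f y \<noteq> 0"
    using r e by (auto simp: r'_def)
  have "fibre_mult (\<lambda>x. sphere_inverse (R x)) x = n"
  proof (rule fibre_mult_eqI[OF x r'(1)])
    show "sphere_inverse (R (chart b y)) = Fin (inverse (f y))" if "y \<in> ball z r'" for y
      using f(2) r'(2,3) that by (simp add: subset_iff)
    show "(\<lambda>y. - g y / (f y * c)) holomorphic_on ball z r'"
      by (intro holomorphic_intros holomorphic_on_subset[OF g(1) r'(2)] holomorphic_on_subset[OF f(1) r'(2)])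
         (use r'(3) assms(2) in auto)
    show "- g z / (f z * c) \<noteq> 0" using g(2)[of z] r f(3) assms(2) by simp
    fix y assume y: "y \<in> ball z r'"
    have "inverse (f y) - inverse (f z) = - (f y - c) / (f y * c)"
      using r'(3)[OF y] f(3) assms(2) by (simp add: field_simps)
    also have "\<dots> = (y - z) ^ n * (- g y / (f y * c))"
      using eq[of y] y r'(2) by (simp add: subset_iff)
    finally show "inverse (f y) - inverse (f z) = (y - z) ^ n * (- g y / (f y * c))" .
  qed
  then show ?thesis using m by simp
qed

end

section \<open>Sums over fibres\<close>

text \<open>One root, the one with argument \<open>t / m\<close>, is multiplied by all
  \<open>m\<close>-th roots of unity.\<close>

lemma bij_betw_shifted_roots:
  assumes m: "m > 0" and \<rho>: "\<rho> > 0"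
  shows "bij_betw (\<lambda>k. of_real \<rho> * exp (\<i> * of_real (t / m + 2 * pi * real k / m))) {..<m}
     {s. s ^ m = of_real (\<rho> ^ m) * exp (\<i> * of_real t)}"
proof -
  define a where "a = of_real \<rho> * exp (\<i> * of_real (t / m))"
  have a: "a \<noteq> 0" using \<rho> by (simp add: a_def)
  have "exp (\<i> * of_real (t / m)) ^ m = exp (of_nat m * (\<i> * of_real (t / m)))"
    by (rule exp_of_nat_mult[symmetric])
  also have "of_nat m * (\<i> * of_real (t / m)) = \<i> * complex_of_real t"
    using m by simp
  finally have am: "a ^ m = of_real (\<rho> ^ m) * exp (\<i> * of_real t)"
    by (simp add: a_def power_mult_distrib)
  have "bij_betw (\<lambda>z. a * z) {z. z ^ m = 1} {s. s ^ m = a ^ m}"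
    by (rule bij_betwI[of _ _ _ "\<lambda>s. s / a"]) (use a in \<open>auto simp: power_mult_distrib power_divide\<close>)
  from bij_betw_trans[OF Complex.bij_betw_roots_unity[OF m] this]
  have "bij_betw (\<lambda>k. a * cis (2 * pi * real k / real m)) {..<m} {s. s ^ m = a ^ m}"
    by (simp add: o_def)
  moreover have "a * cis (2 * pi * real k / real m) = of_real \<rho> * exp (\<i> * of_real (t / m + 2 * pi * real k / m))" for k
    by (simp only: a_def cis_conv_exp of_real_add distrib_left exp_add mult.assoc)
  ultimately show ?thesis by (simp only: am)
qed

lemma sum_integral_partition:
  fixes g :: "real \<Rightarrow> real"
  assumes g: "\<And>a b. g integrable_on {a..b}" and l: "l \<ge> 0"
  shows "(\<Sum>k<n. integral {l * real k..l * real k + l} g) = integral {0..l * real n} g"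
proof (induction n)
  case (Suc n)
  have "integral {0..l * real n} g + integral {l * real n..l * real n + l} g = integral {0..l * real n + l} g"
    by (rule Henstock_Kurzweil_Integration.integral_combine) (use g l in auto)
  then show ?case using Suc by (simp add: algebra_simps)
qed simp

text \<open>While \<open>t\<close> runs once around, the root with index \<open>k\<close> sweeps the
  arc of length \<open>2 * pi / m\<close> starting at angle \<open>2 * pi * k / m\<close>. The
  \<open>m\<close> arcs tile the circle, and the substitution on each contributes the factor
  \<open>m\<close>.\<close>

lemma has_integral_roots:
  assumes m: "m > 0" and \<rho>: "\<rho> > 0" and G: "continuous_on (sphere 0 \<rho>) G"
  shows "((\<lambda>t. \<Sum>s | s ^ m = of_real (\<rho> ^ m) * exp (\<i> * of_real t). G s) has_integral
     2 * pi * (real m * circle_mean G 0 \<rho>)) {0..2 * pi}"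
proof -
  define g where "g t = G (of_real \<rho> * exp (\<i> * of_real t))" for t
  have cg: "continuous_on T g" for T
    using continuous_on_circle[OF G, of T] \<rho> by (simp add: g_def)
  have ig: "g integrable_on {a..b}" for a b by (rule integrable_continuous_real[OF cg])
  define l where "l = 2 * pi / m"
  have l: "l > 0" using m by (simp add: l_def)
  have lk: "t / m + 2 * pi * real k / m = inverse (real m) *\<^sub>R t + l * real k" for t k
    by (simp add: l_def divide_inverse mult_ac)
  have "((\<lambda>t. g (t / m + 2 * pi * real k / m)) has_integral real m * integral {l * real k..l * real k + l} g) {0..2 * pi}" for k
  proof -
    have "(g has_integral integral {l * real k..l * real k + l} g) (cbox (l * real k) (l * real k + l))"
      using ig by (simp add: integrable_integral)
    from has_integral_affinity'[OF this, of "inverse (real m)" "l * real k"]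
    show ?thesis unfolding lk using m by (simp add: l_def)
  qed
  then have "((\<lambda>t. \<Sum>k<m. g (t / m + 2 * pi * real k / m)) has_integral
      (\<Sum>k<m. real m * integral {l * real k..l * real k + l} g)) {0..2 * pi}"
    by (intro has_integral_sum) auto
  moreover have "(\<Sum>k<m. real m * integral {l * real k..l * real k + l} g) = 2 * pi * (real m * circle_mean G 0 \<rho>)"
  proof -
    have "(\<Sum>k<m. real m * integral {l * real k..l * real k + l} g) = real m * integral {0..l * real m} g"
      using sum_integral_partition[OF ig, of l m] l by (simp flip: sum_distrib_left)
    also have "l * real m = 2 * pi" using m by (simp add: l_def)
    finally have "(\<Sum>k<m. real m * integral {l * real k..l * real k + l} g) = real m * integral {0..2 * pi} g" .
    moreover have "circle_mean G 0 \<rho> = 1 / (2 * pi) * integral {0..2 * pi} g"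
      unfolding circle_mean_def g_def [abs_def] by simp
    ultimately show ?thesis by simp
  qed
  moreover have "(\<Sum>k<m. g (t / m + 2 * pi * real k / m)) = (\<Sum>s | s ^ m = of_real (\<rho> ^ m) * exp (\<i> * of_real t). G s)" for t
    unfolding g_def by (rule sum.reindex_bij_betw[OF bij_betw_shifted_roots[OF m \<rho>]])
  ultimately show ?thesis by simp
qed

lemma finite_separated:
  fixes X :: "'a::metric_space set"
  assumes "finite X"
  obtains e where "e > 0" "\<And>x y. x \<in> X \<Longrightarrow> y \<in> X \<Longrightarrow> x \<noteq> y \<Longrightarrow> ball x e \<inter> ball y e = {}"
proof -
  \<comment> \<open>The extra 1 keeps the minimum defined when \<open>X\<close> has fewer than two
    points.\<close>
  define A where "A = insert 1 ((\<lambda>(x, y). dist x y) ` {p \<in> X \<times> X. fst p \<noteq> snd p})"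
  have A: "finite A" "A \<noteq> {}" "\<And>a. a \<in> A \<Longrightarrow> a > 0" using assms by (auto simp: A_def)
  have "Min A > 0" using A by simp
  moreover have "ball x (Min A / 2) \<inter> ball y (Min A / 2) = {}" if "x \<in> X" "y \<in> X" "x \<noteq> y" for x y
  proof -
    have "dist x y \<in> A" using that by (force simp: A_def)
    then have "Min A \<le> dist x y" using A by simp
    then have False if "dist x z < Min A / 2" "dist y z < Min A / 2" for z
      using that dist_triangle[of x y z] by (simp add: dist_commute)
    then show ?thesis by auto
  qed
  ultimately show thesis using that[of "Min A / 2"] by simp
qed

lemma norm_less_if_power:
  fixes s :: complex
  assumes "s ^ m = w" "norm w < \<delta> ^ m" "\<delta> \<ge> 0" shows "norm s < \<delta>"
  using assms by (metis norm_power power_less_imp_less_base)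

context rational_map
begin

text \<open>The trace of \<open>f\<close> along \<open>R\<close>. Counting with local degrees is
  what keeps it continuous and harmonic across critical values.\<close>

definition push :: "(riemann_sphere \<Rightarrow> real) \<Rightarrow> complex \<Rightarrow> real" where
  "push f w = (\<Sum>x | R x = Fin w. real (fibre_mult R x) * f x)"

text \<open>For \<open>w\<close> near \<open>c\<close> and different from \<open>c\<close>, the
  fibre over \<open>w\<close> splits into the roots seen in disjoint local forms around the fibre
  over \<open>c\<close>, all of them simple. The quantifier over \<open>f\<close> is inside, so the
  neighbourhood of \<open>c\<close> does not depend on \<open>f\<close>.\<close>

lemma push_near:
  assumes N: "open N" "\<And>x. R x = Fin c \<Longrightarrow> x \<in> N"
  obtains b \<kappa> \<rho> where "\<And>x. R x = Fin c \<Longrightarrow> local_form x c N (b x) (\<kappa> x) (\<rho> x)"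
    "\<forall>\<^sub>F w in at c. \<forall>f. push f w =
       (\<Sum>x | R x = Fin c. \<Sum>s | s ^ fibre_mult R x = w - c. f (chart (b x) (\<kappa> x s)))"
proof -
  define X where "X = {x. R x = Fin c}"
  have X: "finite X" unfolding X_def by (rule finite_fibre)
  obtain e where e: "e > 0" "\<And>x y. x \<in> X \<Longrightarrow> y \<in> X \<Longrightarrow> x \<noteq> y \<Longrightarrow> ball x e \<inter> ball y e = {}"
    using finite_separated[OF X] by blast
  have "\<exists>t. local_form x c (N \<inter> ball x e) (fst t) (fst (snd t)) (snd (snd t))" if "x \<in> X" for x
  proof -
    have "\<exists>b \<kappa> \<rho>. local_form x c (N \<inter> ball x e) b \<kappa> \<rho>"
      by (rule local_form_exists(2)) (use that N e(1) in \<open>auto simp: X_def\<close>)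
    then obtain b \<kappa> \<rho> where "local_form x c (N \<inter> ball x e) b \<kappa> \<rho>" by blast
    then show ?thesis by (intro exI[of _ "(b, \<kappa>, \<rho>)"]) simp
  qed
  then have "\<exists>t. \<forall>x\<in>X. local_form x c (N \<inter> ball x e) (fst (t x)) (fst (snd (t x))) (snd (snd (t x)))"
    by (intro bchoice ballI)
  then obtain t where t: "\<And>x. x \<in> X \<Longrightarrow> local_form x c (N \<inter> ball x e) (fst (t x)) (fst (snd (t x))) (snd (snd (t x)))"
    by blast
  define b \<kappa> \<rho> where "b x = fst (t x)" and "\<kappa> x = fst (snd (t x))" and "\<rho> x = snd (snd (t x))" for x
  have lf: "local_form x c (N \<inter> ball x e) (b x) (\<kappa> x) (\<rho> x)" if "x \<in> X" for x
    using t[OF that] by (simp add: b_def \<kappa>_def \<rho>_def)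
  note L = local_formD[OF lf]
  define \<gamma> where "\<gamma> x s = chart (b x) (\<kappa> x s)" for x s
  define m where "m x = fibre_mult R x" for x
  have m: "m x > 0" if "x \<in> X" for x
    using local_form_exists(1)[of x c UNIV] that by (simp add: X_def m_def)
  \<comment> \<open>What the local forms leave out is compact, and its image is a closed set missing
    \<open>c\<close>; hence for \<open>w\<close> near \<open>c\<close> no preimage escapes the local
    forms.\<close>
  define K where "K = - (\<Union>x\<in>X. \<gamma> x ` ball 0 (\<rho> x))"
  have "open (\<gamma> x ` ball 0 (\<rho> x))" if "x \<in> X" for x
    using L(8)[OF that open_ball order_refl] by (simp add: \<gamma>_def [abs_def])
  then have "closed K" unfolding K_def closed_def by auto
  then have "compact (R ` K)"
    by (intro compact_continuous_image continuous_on_R compact_riemann_sphere_closed)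
  then have "open (- R ` K)" by (simp add: compact_imp_closed open_Compl)
  moreover have "Fin c \<notin> R ` K"
  proof
    assume "Fin c \<in> R ` K"
    then obtain x where x: "x \<in> K" "R x = Fin c" by force
    then have "x \<in> X" by (simp add: X_def)
    then have "\<gamma> x 0 = x" "0 \<in> ball (0::complex) (\<rho> x)" using L(1,4) by (auto simp: \<gamma>_def)
    then have "x \<in> (\<Union>x\<in>X. \<gamma> x ` ball 0 (\<rho> x))" using \<open>x \<in> X\<close> by (metis UN_I image_eqI)
    then show False using x(1) by (simp add: K_def)
  qed
  moreover have "(Fin \<longlongrightarrow> Fin c) (at c)"
    using continuous_on_Fin[of UNIV] by (simp add: continuous_on_eq_continuous_at isCont_def)
  ultimately have ev1: "\<forall>\<^sub>F w in at c. Fin w \<in> - R ` K"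
    by (intro topological_tendstoD) auto
  have "\<forall>\<^sub>F w in at c. norm (w - c) < \<rho> x ^ m x" if "x \<in> X" for x
  proof -
    have "((\<lambda>w. norm (w - c)) \<longlongrightarrow> norm (c - c)) (at c)" by (intro tendsto_intros)
    then show ?thesis using L(1)[OF that] by (intro order_tendstoD(2)) auto
  qed
  then have ev2: "\<forall>\<^sub>F w in at c. \<forall>x\<in>X. norm (w - c) < \<rho> x ^ m x"
    using X by (simp add: eventually_ball_finite)
  have "\<forall>\<^sub>F w in at c. w \<noteq> c" by (rule eventually_neq_at_within)
  with ev1 ev2 have "\<forall>\<^sub>F w in at c. \<forall>f. push f w = (\<Sum>x\<in>X. \<Sum>s | s ^ m x = w - c. f (\<gamma> x s))"
  proof eventually_elim
    case (elim w)
    define S where "S x = {s. s ^ m x = w - c}" for x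
    have S: "S x \<subseteq> ball 0 (\<rho> x)" if "x \<in> X" for x
      using norm_less_if_power[of _ "m x" "w - c" "\<rho> x"] elim(2) that L(1)[OF that] by (auto simp: S_def)
    have inj: "inj_on (\<gamma> x) (S x)" if "x \<in> X" for x
      using inj_on_subset[OF L(3)[OF that] S[OF that]] by (simp add: \<gamma>_def [abs_def])
    have finS: "finite (S x)" if "x \<in> X" for x
      unfolding S_def using m[OF that] elim(3) by (intro finite_nth_roots) auto
    have fib: "{y. R y = Fin w} = (\<Union>x\<in>X. \<gamma> x ` S x)"
    proof (intro equalityI subsetI)
      fix y assume "y \<in> {y. R y = Fin w}"
      then have y: "R y = Fin w" by simp
      have "y \<notin> K"
      proof
        assume "y \<in> K"
        then have "Fin w \<in> R ` K" using y by (metis image_eqI)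
        then show False using elim(1) by simp
      qed
      then obtain x s where xs: "x \<in> X" "s \<in> ball 0 (\<rho> x)" "y = \<gamma> x s" by (auto simp: K_def)
      have "w = c + s ^ m x" using L(6)[OF xs(1,2)] y xs(3) by (simp add: \<gamma>_def m_def)
      then have "s \<in> S x" by (simp add: S_def)
      then show "y \<in> (\<Union>x\<in>X. \<gamma> x ` S x)" using xs by blast
    next
      fix y assume "y \<in> (\<Union>x\<in>X. \<gamma> x ` S x)"
      then obtain x s where xs: "x \<in> X" "s \<in> S x" "y = \<gamma> x s" by blast
      have "R y = Fin (c + s ^ m x)" using L(6)[OF xs(1) subsetD[OF S[OF xs(1)] xs(2)]] xs(3) by (simp add: \<gamma>_def m_def)
      then show "y \<in> {y. R y = Fin w}" using xs(2) by (simp add: S_def)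
    qed
    \<comment> \<open>Since \<open>w\<close> differs from \<open>c\<close>, the root
      \<open>s\<close> is nonzero and \<open>fibre_mult_simple\<close> applies.\<close>
    have m1: "fibre_mult R (\<gamma> x s) = 1" if "x \<in> X" "s \<in> S x" for x s
    proof -
      have "s \<noteq> 0" using that elim(3) m[OF that(1)] by (auto simp: S_def zero_power)
      then show ?thesis
        using fibre_mult_simple[OF lf[OF that(1)] subsetD[OF S[OF that(1)] that(2)]] m[OF that(1)]
        by (simp add: \<gamma>_def m_def)
    qed
    have disj: "\<gamma> x ` S x \<inter> \<gamma> y ` S y = {}" if "x \<in> X" "y \<in> X" "x \<noteq> y" for x y
    proof -
      have "\<gamma> z ` S z \<subseteq> ball z e" if z: "z \<in> X" for z
        using L(5)[OF z] S[OF z] by (auto simp: \<gamma>_def subset_iff)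
      then show ?thesis using e(2)[OF that] that by blast
    qed
    show ?case
    proof
      fix f
      have "push f w = (\<Sum>y\<in>(\<Union>x\<in>X. \<gamma> x ` S x). real (fibre_mult R y) * f y)"
        unfolding push_def fib ..
      also have "\<dots> = (\<Sum>x\<in>X. \<Sum>y\<in>\<gamma> x ` S x. real (fibre_mult R y) * f y)"
        by (rule sum.UNION_disjoint) (use X finS disj in auto)
      also have "\<dots> = (\<Sum>x\<in>X. \<Sum>s\<in>S x. f (\<gamma> x s))"
        by (intro sum.cong refl) (simp add: sum.reindex[OF inj] m1)
      finally show "push f w = (\<Sum>x\<in>X. \<Sum>s | s ^ m x = w - c. f (\<gamma> x s))" by (simp add: S_def)
    qed
  qed
  moreover have "local_form x c N (b x) (\<kappa> x) (\<rho> x)" if "R x = Fin c" for x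
    using lf[of x] that by (simp add: local_form_def X_def)
  ultimately show thesis using that[of b \<kappa> \<rho>] by (simp add: X_def \<gamma>_def m_def)
qed

text \<open>The \<open>m\<close> roots attached to a point \<open>x\<close> of the fibre all tend to
  \<open>x\<close> and together contribute \<open>m * f x\<close>. The set \<open>T\<close> allows
  approach from within the closed disc only, as needed on the boundary circle.\<close>

lemma push_tendsto:
  assumes f: "\<And>x. R x = Fin c \<Longrightarrow> (f \<longlongrightarrow> f x) (at x within {y. \<exists>w\<in>T. R y = Fin w})"
  shows "(push f \<longlongrightarrow> push f c) (at c within T)"
proof -
  obtain b \<kappa> \<rho> where lf: "\<And>x. R x = Fin c \<Longrightarrow> local_form x c UNIV (b x) (\<kappa> x) (\<rho> x)"
    and ev: "\<forall>\<^sub>F w in at c. \<forall>f. push f w =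
       (\<Sum>x | R x = Fin c. \<Sum>s | s ^ fibre_mult R x = w - c. f (chart (b x) (\<kappa> x s)))"
    using push_near[of UNIV c] by auto
  have le: "at c within T \<le> at c" by (rule at_le) simp
  have "((\<lambda>w. \<Sum>s | s ^ fibre_mult R x = w - c. f (chart (b x) (\<kappa> x s))) \<longlongrightarrow> real (fibre_mult R x) * f x) (at c within T)"
    if x: "R x = Fin c" for x
  proof (rule tendstoI)
    fix e :: real assume e: "e > 0"
    note L = local_formD[OF lf[OF x]]
    define m where "m = fibre_mult R x"
    have m: "m > 0" using local_form_exists(1)[OF x, of UNIV] by (simp add: m_def)
    \<comment> \<open>The \<open>m\<close> terms then add up to at most \<open>e / 2\<close>,
      strictly below \<open>e\<close>.\<close>
    define e' where "e' = e / (2 * m)"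
    have e': "e' > 0" using e m by (simp add: e'_def)
    have "\<forall>\<^sub>F y in at x within {y. \<exists>w\<in>T. R y = Fin w}. dist (f y) (f x) < e'"
      using f[OF x] e' by (rule tendstoD)
    then obtain N where N: "open N" "x \<in> N"
      "\<And>y w. y \<in> N \<Longrightarrow> y \<noteq> x \<Longrightarrow> w \<in> T \<Longrightarrow> R y = Fin w \<Longrightarrow> dist (f y) (f x) < e'"
      by (auto simp: eventually_at_topological)
    have "isCont (\<lambda>s. chart (b x) (\<kappa> x s)) 0"
      using L(1,7) by (simp add: continuous_on_eq_continuous_at)
    then have "((\<lambda>s. chart (b x) (\<kappa> x s)) \<longlongrightarrow> x) (at 0)" using L(4) by (simp add: isCont_def)
    then have "\<forall>\<^sub>F s in at 0. chart (b x) (\<kappa> x s) \<in> N" using N(1,2) by (rule topological_tendstoD)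
    then obtain \<delta>0 where \<delta>0: "\<delta>0 > 0" "\<And>s. s \<noteq> 0 \<Longrightarrow> norm s < \<delta>0 \<Longrightarrow> chart (b x) (\<kappa> x s) \<in> N"
      by (auto simp: eventually_at)
    define \<delta> where "\<delta> = min \<delta>0 (\<rho> x)"
    have \<delta>: "\<delta> > 0" "\<delta> \<le> \<delta>0" "\<delta> \<le> \<rho> x" using \<delta>0(1) L(1) by (auto simp: \<delta>_def)
    have "((\<lambda>w. norm (w - c)) \<longlongrightarrow> norm (c - c)) (at c within T)" by (intro tendsto_intros)
    then have "\<forall>\<^sub>F w in at c within T. norm (w - c) < \<delta> ^ m"
      using \<delta>(1) by (intro order_tendstoD(2)) auto
    moreover have "\<forall>\<^sub>F w in at c within T. w \<noteq> c" by (rule eventually_neq_at_within)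
    moreover have "\<forall>\<^sub>F w in at c within T. w \<in> T" by (simp add: eventually_at_filter)
    ultimately show "\<forall>\<^sub>F w in at c within T. dist (\<Sum>s | s ^ fibre_mult R x = w - c. f (chart (b x) (\<kappa> x s)))
        (real (fibre_mult R x) * f x) < e"
    proof eventually_elim
      case (elim w)
      define S where "S = {s. s ^ m = w - c}"
      have cS: "card S = m" unfolding S_def using elim m by (intro card_nth_roots) auto
      have close: "norm (f (chart (b x) (\<kappa> x s)) - f x) \<le> e'" if "s \<in> S" for s
      proof -
        have "norm s < \<delta>"
          using norm_less_if_power[of s m "w - c" \<delta>] that elim(1) \<delta>(1) by (simp add: S_def)
        then have s: "norm s < \<delta>0" "s \<in> ball 0 (\<rho> x)" using \<delta> by auto
        have Rs: "R (chart (b x) (\<kappa> x s)) = Fin w"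
          using L(6)[OF s(2)] that by (simp add: S_def m_def)
        have "s \<noteq> 0" using that elim(2) m by (auto simp: S_def zero_power)
        then have "chart (b x) (\<kappa> x s) \<in> N" using \<delta>0(2) s(1) by blast
        then show ?thesis
          using N(3)[OF _ _ elim(3) Rs] e' by (cases "chart (b x) (\<kappa> x s) = x") (auto simp: dist_norm less_imp_le)
      qed
      have "(\<Sum>s\<in>S. f (chart (b x) (\<kappa> x s))) - real m * f x = (\<Sum>s\<in>S. f (chart (b x) (\<kappa> x s)) - f x)"
        by (simp add: sum_subtractf cS)
      also have "norm \<dots> \<le> (\<Sum>s\<in>S. e')" by (rule sum_norm_le[OF close])
      also have "\<dots> = e / 2" using m by (simp add: cS e'_def)
      also have "\<dots> < e" using e by simp
      finally show ?case by (simp add: dist_norm S_def m_def)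
    qed
  qed
  then have "((\<lambda>w. \<Sum>x | R x = Fin c. \<Sum>s | s ^ fibre_mult R x = w - c. f (chart (b x) (\<kappa> x s))) \<longlongrightarrow> push f c) (at c within T)"
    unfolding push_def by (intro tendsto_sum) auto
  moreover have "\<forall>\<^sub>F w in at c within T. (\<Sum>x | R x = Fin c. \<Sum>s | s ^ fibre_mult R x = w - c. f (chart (b x) (\<kappa> x s))) = push f w"
    using filter_leD[OF le ev] by (rule eventually_mono) simp
  ultimately show ?thesis by (rule Lim_transform_eventually)
qed

text \<open>The mean over a small circle around \<open>c\<close> splits over the fibre. The share of
  \<open>x\<close> is \<open>m\<close> times the mean of \<open>h\<close> over a circle in the
  coordinate \<open>s\<close>, that is \<open>m * h x\<close>, because \<open>h\<close> stays
  harmonic in that coordinate.\<close>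

lemma push_circle_mean:
  assumes D: "open D" and h: "sphere_harmonic_on h D" and c: "\<And>x. R x = Fin c \<Longrightarrow> x \<in> D"
  shows "\<forall>\<^sub>F r in at_right 0. circle_mean (push h) c r = push h c"
proof -
  obtain b \<kappa> \<rho> where lf: "\<And>x. R x = Fin c \<Longrightarrow> local_form x c D (b x) (\<kappa> x) (\<rho> x)"
    and ev: "\<forall>\<^sub>F w in at c. \<forall>f. push f w =
       (\<Sum>x | R x = Fin c. \<Sum>s | s ^ fibre_mult R x = w - c. f (chart (b x) (\<kappa> x s)))"
    using push_near[OF D c] by blast
  define \<gamma> where "\<gamma> x s = chart (b x) (\<kappa> x s)" for x s
  have "\<exists>\<delta>>0. \<forall>r. 0 < r \<longrightarrow> r < \<delta> \<longrightarrow> continuous_on (sphere 0 r) (\<lambda>s. h (\<gamma> x s)) \<and> circle_mean (\<lambda>s. h (\<gamma> x s)) 0 r = h x"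
    if x: "R x = Fin c" for x
  proof -
    note L = local_formD[OF lf[OF x]]
    have "chart (b x) (\<kappa> x 0) \<in> D" using L(1) L(5)[of 0] by simp
    then obtain r1 where r1: "r1 > 0" "cball (\<kappa> x 0) r1 \<subseteq> {z. chart (b x) z \<in> D}"
      using chart_cball[OF D] by blast
    then have re: "re_limit (\<lambda>z. h (chart (b x) z)) (ball (\<kappa> x 0) r1)"
      using h by (simp add: sphere_harmonic_on_def)
    have "isCont (\<kappa> x) 0"
      using holomorphic_on_imp_continuous_on[OF L(2)] L(1) by (simp add: continuous_on_eq_continuous_at)
    then obtain \<delta>0 where \<delta>0: "\<delta>0 > 0" "\<And>s. norm s < \<delta>0 \<Longrightarrow> dist (\<kappa> x s) (\<kappa> x 0) < r1"
      using r1(1) unfolding continuous_at_eps_delta by (metis diff_zero dist_norm)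
    define \<delta> where "\<delta> = min \<delta>0 (\<rho> x)"
    have \<delta>: "\<delta> > 0" using \<delta>0(1) L(1) by (simp add: \<delta>_def)
    have re': "re_limit (\<lambda>s. h (\<gamma> x s)) (ball 0 \<delta>)"
      unfolding \<gamma>_def
    proof (rule re_limit_compose[OF re])
      show "\<kappa> x holomorphic_on ball 0 \<delta>" by (rule holomorphic_on_subset[OF L(2)]) (auto simp: \<delta>_def)
      show "\<kappa> x ` ball 0 \<delta> \<subseteq> ball (\<kappa> x 0) r1" using \<delta>0(2) by (auto simp: \<delta>_def dist_commute)
    qed
    have "continuous_on (sphere 0 r) (\<lambda>s. h (\<gamma> x s)) \<and> circle_mean (\<lambda>s. h (\<gamma> x s)) 0 r = h x"
      if r: "0 < r" "r < \<delta>" for r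
    proof
      have sub: "cball (0::complex) r \<subseteq> ball 0 \<delta>" using r by auto
      show "continuous_on (sphere 0 r) (\<lambda>s. h (\<gamma> x s))"
        by (rule continuous_on_subset[OF re_limit_continuous[OF re'] order_trans[OF sphere_cball sub]])
      show "circle_mean (\<lambda>s. h (\<gamma> x s)) 0 r = h x"
        using re_limit_mean[OF re' sub r(1)] L(4) by (simp add: \<gamma>_def)
    qed
    then show ?thesis using \<delta> by blast
  qed
  then have "\<exists>\<delta>. \<forall>x\<in>{x. R x = Fin c}. \<delta> x > 0 \<and> (\<forall>r. 0 < r \<longrightarrow> r < \<delta> x \<longrightarrow>
      continuous_on (sphere 0 r) (\<lambda>s. h (\<gamma> x s)) \<and> circle_mean (\<lambda>s. h (\<gamma> x s)) 0 r = h x)"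
    by (intro bchoice ballI) simp
  then obtain \<delta> where \<delta>: "\<And>x. R x = Fin c \<Longrightarrow> \<delta> x > 0"
      "\<And>x r. R x = Fin c \<Longrightarrow> 0 < r \<Longrightarrow> r < \<delta> x \<Longrightarrow> continuous_on (sphere 0 r) (\<lambda>s. h (\<gamma> x s))"
      "\<And>x r. R x = Fin c \<Longrightarrow> 0 < r \<Longrightarrow> r < \<delta> x \<Longrightarrow> circle_mean (\<lambda>s. h (\<gamma> x s)) 0 r = h x"
    by blast
  define m where "m x = fibre_mult R x" for x
  have m: "m x > 0" if "R x = Fin c" for x
    using local_form_exists(1)[OF that, of UNIV] by (simp add: m_def)
  obtain \<epsilon> where \<epsilon>: "\<epsilon> > 0" "\<And>w. w \<noteq> c \<Longrightarrow> dist w c < \<epsilon> \<Longrightarrow> push h w =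
       (\<Sum>x | R x = Fin c. \<Sum>s | s ^ m x = w - c. h (\<gamma> x s))"
    using ev unfolding eventually_at \<gamma>_def m_def by auto
  have "\<forall>\<^sub>F r in at_right 0. r < \<epsilon>" using \<epsilon>(1) by (rule eventually_at_rightI[of 0 \<epsilon>, rotated]) auto
  moreover have "\<forall>\<^sub>F r in at_right (0::real). r > 0" by (rule eventually_at_right_less)
  moreover have "\<forall>\<^sub>F r in at_right 0. \<forall>x\<in>{x. R x = Fin c}. r < \<delta> x ^ m x"
  proof (rule eventually_ball_finite[OF finite_fibre], intro ballI)
    fix x assume "x \<in> {x. R x = Fin c}"
    then have "\<delta> x ^ m x > 0" using \<delta>(1) by simp
    then show "\<forall>\<^sub>F r in at_right 0. r < \<delta> x ^ m x"
      by (rule eventually_at_rightI[of 0 "\<delta> x ^ m x", rotated]) auto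
  qed
  ultimately show ?thesis
  proof eventually_elim
    case (elim r)
    have "((\<lambda>t. \<Sum>s | s ^ m x = of_real r * exp (\<i> * of_real t). h (\<gamma> x s)) has_integral
        2 * pi * (real (m x) * h x)) {0..2 * pi}" if x: "R x = Fin c" for x
    proof -
      \<comment> \<open>The power map sends the circle of radius \<open>r'\<close> in
        \<open>s\<close> onto the circle of radius \<open>r\<close> around 0, the range of
        \<open>w - c\<close>.\<close>
      define r' where "r' = root (m x) r"
      have r': "r' > 0" "r' ^ m x = r" using m[OF x] elim(2) by (auto simp: r'_def)
      have "r' ^ m x < \<delta> x ^ m x" using elim(3) x r'(2) by simp
      then have lt: "r' < \<delta> x" using less_imp_le[OF \<delta>(1)[OF x]] by (rule power_less_imp_less_base)
      show ?thesis
        using has_integral_roots[OF m[OF x] r'(1) \<delta>(2)[OF x r'(1) lt]]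
        unfolding \<delta>(3)[OF x r'(1) lt] r'(2) .
    qed
    then have "((\<lambda>t. \<Sum>x | R x = Fin c. \<Sum>s | s ^ m x = of_real r * exp (\<i> * of_real t). h (\<gamma> x s)) has_integral
        (\<Sum>x | R x = Fin c. 2 * pi * (real (m x) * h x))) {0..2 * pi}"
      by (intro has_integral_sum finite_fibre) auto
    moreover have "(\<Sum>x | R x = Fin c. \<Sum>s | s ^ m x = of_real r * exp (\<i> * of_real t). h (\<gamma> x s)) =
        push h (c + of_real r * exp (\<i> * of_real t))" for t
      using \<epsilon>(2)[of "c + of_real r * exp (\<i> * of_real t)"] elim(1,2) by (simp add: dist_norm norm_mult)
    ultimately have "((\<lambda>t. push h (c + of_real r * exp (\<i> * of_real t))) has_integral
        (\<Sum>x | R x = Fin c. 2 * pi * (real (m x) * h x))) {0..2 * pi}" by simp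
    then have "integral {0..2 * pi} (\<lambda>t. push h (c + of_real r * exp (\<i> * of_real t))) = 2 * pi * push h c"
      by (simp add: integral_unique push_def m_def sum_distrib_left)
    then show ?case unfolding circle_mean_def by simp
  qed
qed

end

section \<open>The Riesz representation theorem on compact metric spaces\<close>

text \<open>Continuous functions decreasing to the indicator of a closed \<open>F\<close>. Index 0
  gives the constant 1, where the telescoping sums start; \<open>infdist\<close> to the empty set is
  0, so the limit statement excludes empty \<open>F\<close>.\<close>

definition cutoff :: "'a::metric_space set \<Rightarrow> nat \<Rightarrow> 'a \<Rightarrow> real" where
  "cutoff F k x = max 0 (1 - real k * infdist x F)"

lemma continuous_on_cutoff: "continuous_on UNIV (cutoff F k)"
  unfolding cutoff_def [abs_def] by (intro continuous_intros)

lemma cutoff_nonneg: "cutoff F k x \<ge> 0"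
  and cutoff_le_1: "cutoff F k x \<le> 1"
  and cutoff_0: "cutoff F 0 x = 1"
  and cutoff_in: "x \<in> F \<Longrightarrow> cutoff F k x = 1"
  by (simp_all add: cutoff_def infdist_nonneg)

lemma cutoff_Suc_le: "cutoff F (Suc k) x \<le> cutoff F k x"
proof -
  have "real k * infdist x F \<le> real (Suc k) * infdist x F"
    by (intro mult_right_mono) (simp_all add: infdist_nonneg)
  then show ?thesis unfolding cutoff_def by linarith
qed

lemma cutoff_tendsto:
  assumes F: "closed F" "F \<noteq> {}"
  shows "(\<lambda>k. cutoff F k x) \<longlonglongrightarrow> indicator F x"
proof (cases "x \<in> F")
  case True
  then show ?thesis by (simp add: cutoff_in)
next
  case False
  have pos: "infdist x F > 0" by (rule infdist_pos_not_in_closed[OF F False])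
  then obtain K where "1 / infdist x F \<le> real K" using real_arch_simple by blast
  then have K: "1 \<le> real K * infdist x F" using pos by (simp add: divide_le_eq)
  have "cutoff F k x = 0" if "k \<ge> K" for k
  proof -
    have "real K * infdist x F \<le> real k * infdist x F" using that pos by (intro mult_right_mono) auto
    then show ?thesis using K by (simp add: cutoff_def)
  qed
  then have "\<forall>\<^sub>F k in sequentially. cutoff F k x = 0" by (auto simp: eventually_sequentially)
  then show ?thesis using False by (simp add: tendsto_eventually)
qed

locale positive_functional =
  fixes \<Lambda> :: "('a::metric_space \<Rightarrow> real) \<Rightarrow> real"
  assumes compact: "compact (UNIV :: 'a set)"
    and add: "continuous_on UNIV f \<Longrightarrow> continuous_on UNIV g \<Longrightarrow> \<Lambda> (\<lambda>x. f x + g x) = \<Lambda> f + \<Lambda> g"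
    and cmult: "continuous_on UNIV f \<Longrightarrow> \<Lambda> (\<lambda>x. c * f x) = c * \<Lambda> f"
    and nonneg: "continuous_on UNIV f \<Longrightarrow> (\<And>x. f x \<ge> 0) \<Longrightarrow> \<Lambda> f \<ge> 0"
begin

lemma diff:
  assumes "continuous_on UNIV f" "continuous_on UNIV g"
  shows "\<Lambda> (\<lambda>x. f x - g x) = \<Lambda> f - \<Lambda> g"
proof -
  have "continuous_on UNIV (\<lambda>x. (-1) * g x)" by (intro continuous_intros assms)
  from add[OF assms(1) this] show ?thesis using cmult[OF assms(2), of "-1"] by simp
qed

lemma mono:
  assumes "continuous_on UNIV f" "continuous_on UNIV g" "\<And>x. f x \<le> g x"
  shows "\<Lambda> f \<le> \<Lambda> g"
  using nonneg[of "\<lambda>x. g x - f x"] diff[OF assms(2,1)] assms by (simp add: continuous_on_diff)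

lemma zero: "\<Lambda> (\<lambda>x. 0) = 0"
  using cmult[of "\<lambda>_. 0" 0] by simp

lemma const: "\<Lambda> (\<lambda>x. c) = c * \<Lambda> (\<lambda>x. 1)"
  using cmult[of "\<lambda>_. 1" c] by simp

lemma sum:
  assumes "finite I" "\<And>i. i \<in> I \<Longrightarrow> continuous_on UNIV (f i)"
  shows "\<Lambda> (\<lambda>x. \<Sum>i\<in>I. f i x) = (\<Sum>i\<in>I. \<Lambda> (f i))"
  using assms
proof (induction I)
  case (insert i I)
  then have "\<Lambda> (\<lambda>x. f i x + (\<Sum>i\<in>I. f i x)) = \<Lambda> (f i) + \<Lambda> (\<lambda>x. \<Sum>i\<in>I. f i x)"
    by (intro add continuous_on_sum) auto
  then show ?case using insert by simp
qed (simp add: zero)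

definition cover :: "'a set \<Rightarrow> (nat \<Rightarrow> 'a \<Rightarrow> real) set" where
  "cover A = {f. (\<forall>n. continuous_on UNIV (f n) \<and> (\<forall>x. f n x \<ge> 0)) \<and> (\<forall>x\<in>A. 1 \<le> (\<Sum>n. ennreal (f n x)))}"

text \<open>Daniell's outer measure.\<close>

definition outer :: "'a set \<Rightarrow> ennreal" where
  "outer A = (INF f\<in>cover A. \<Sum>n. ennreal (\<Lambda> (f n)))"

lemma outer_le: "f \<in> cover A \<Longrightarrow> outer A \<le> (\<Sum>n. ennreal (\<Lambda> (f n)))"
  unfolding outer_def by (rule INF_lower)

lemma outer_close:
  assumes "outer A < e" obtains f where "f \<in> cover A" "(\<Sum>n. ennreal (\<Lambda> (f n))) < e"
  using assms unfolding outer_def INF_less_iff by blast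

lemma outer_le_single:
  assumes "continuous_on UNIV g" "\<And>x. g x \<ge> 0" "\<And>x. x \<in> A \<Longrightarrow> g x \<ge> 1"
  shows "outer A \<le> ennreal (\<Lambda> g)"
proof -
  define f where "f n = (if n = 0 then g else (\<lambda>_. 0))" for n :: nat
  have s: "(\<Sum>n. (if n = 0 then c else 0)) = c" for c :: ennreal
    using suminf_finite[of "{0::nat}" "\<lambda>n. if n = 0 then c else 0"] by simp
  have "ennreal (f n x) = (if n = 0 then ennreal (g x) else 0)" for n x by (simp add: f_def)
  then have "f \<in> cover A"
    using assms by (auto simp: cover_def s f_def)
  from outer_le[OF this] have "outer A \<le> (\<Sum>n. ennreal (\<Lambda> (f n)))" .
  also have "(\<lambda>n. ennreal (\<Lambda> (f n))) = (\<lambda>n. if n = 0 then ennreal (\<Lambda> g) else 0)"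
    by (auto simp: f_def zero)
  finally show ?thesis by (simp add: s)
qed

lemma outer_mono: "A \<subseteq> B \<Longrightarrow> outer A \<le> outer B"
  unfolding outer_def by (rule INF_superset_mono) (auto simp: cover_def)

lemma outer_empty: "outer {} = 0"
  using outer_le_single[of "\<lambda>_. 0" "{}"] by (simp add: zero)

text \<open>The pairing function turns a double sequence into one sequence with the same sums,
  pointwise and under \<open>\<Lambda>\<close>.\<close>

lemma cover_double:
  assumes c: "\<And>k n. continuous_on UNIV (B k n)" and nn: "\<And>k n x. B k n x \<ge> 0"
    and cov: "\<And>x. x \<in> A \<Longrightarrow> 1 \<le> (\<Sum>k. \<Sum>n. ennreal (B k n x))"
  shows "outer A \<le> (\<Sum>k. \<Sum>n. ennreal (\<Lambda> (B k n)))"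
proof -
  define f where "f i = case_prod B (prod_decode i)" for i
  have s1: "(\<Sum>i. ennreal (f i x)) = (\<Sum>k. \<Sum>n. ennreal (B k n x))" for x
    using suminf_ennreal_2dimen[of "\<lambda>k. \<Sum>n. ennreal (B k n x)" "\<lambda>(k, n). ennreal (B k n x)"]
    by (simp add: f_def case_prod_beta)
  have s2: "(\<Sum>i. ennreal (\<Lambda> (f i))) = (\<Sum>k. \<Sum>n. ennreal (\<Lambda> (B k n)))"
    using suminf_ennreal_2dimen[of "\<lambda>k. \<Sum>n. ennreal (\<Lambda> (B k n))" "\<lambda>(k, n). ennreal (\<Lambda> (B k n))"]
    by (simp add: f_def case_prod_beta)
  have "f \<in> cover A"
    unfolding cover_def mem_Collect_eq
  proof (intro conjI allI ballI)
    show "continuous_on UNIV (f n)" "f n x \<ge> 0" for n x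
      using c nn by (simp_all add: f_def case_prod_beta)
    show "1 \<le> (\<Sum>i. ennreal (f i x))" if "x \<in> A" for x
      unfolding s1 by (rule cov[OF that])
  qed
  from outer_le[OF this] show ?thesis by (simp add: s2)
qed

lemma outer_subadditive: "outer (\<Union>i. A i) \<le> (\<Sum>i. outer (A i))"
proof (rule ennreal_le_epsilon)
  fix e :: real assume fin: "(\<Sum>i. outer (A i)) < top" and e: "e > 0"
  then have *: "outer (A n) < outer (A n) + e * (1/2) ^ Suc n" for n
    by (auto simp add: less_top dest!: ennreal_suminf_lessD)
  have "\<exists>f. f \<in> cover (A n) \<and> (\<Sum>i. ennreal (\<Lambda> (f i))) \<le> outer (A n) + e * (1/2) ^ Suc n" for n
    using outer_close[OF *[of n]] less_imp_le by metis
  then obtain B where B: "\<And>n. B n \<in> cover (A n)"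
    "\<And>n. (\<Sum>i. ennreal (\<Lambda> (B n i))) \<le> outer (A n) + e * (1/2) ^ Suc n"
    by metis
  have "outer (\<Union>i. A i) \<le> (\<Sum>k. \<Sum>n. ennreal (\<Lambda> (B k n)))"
  proof (rule cover_double)
    fix x assume "x \<in> (\<Union>i. A i)"
    then obtain i where "x \<in> A i" by blast
    then have "1 \<le> (\<Sum>n. ennreal (B i n x))" using B(1)[of i] by (auto simp: cover_def)
    also have "\<dots> = (\<Sum>k\<in>{i}. \<Sum>n. ennreal (B k n x))" by simp
    also have "\<dots> \<le> (\<Sum>k. \<Sum>n. ennreal (B k n x))" by (rule sum_le_suminf) auto
    finally show "1 \<le> (\<Sum>k. \<Sum>n. ennreal (B k n x))" .
  qed (use B(1) in \<open>auto simp: cover_def\<close>)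
  also have "\<dots> \<le> (\<Sum>n. outer (A n) + e * (1/2) ^ Suc n)"
    by (intro suminf_le B) auto
  also have "... = (\<Sum>n. outer (A n)) + (\<Sum>n. ennreal e * ennreal ((1/2) ^ Suc n))"
    using e by (subst suminf_add[symmetric])
      (auto simp del: ennreal_suminf_cmult simp add: ennreal_mult[symmetric])
  also have "\<dots> = (\<Sum>n. outer (A n)) + e"
    unfolding ennreal_suminf_cmult
    by (subst suminf_ennreal_eq[OF zero_le_power power_half_series]) auto
  finally show "outer (\<Union>i. A i) \<le> (\<Sum>n. outer (A n)) + e" .
qed

text \<open>A cover of \<open>A\<close> is split by the cutoffs \<open>g\<close> of
  \<open>F\<close>: multiplied by \<open>g K\<close> it covers \<open>A \<inter> F\<close>, and
  multiplied by all the differences \<open>g k - g (Suc k)\<close>, which sum to 1 off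
  \<open>F\<close>, it covers \<open>A - F\<close>. Additivity of \<open>\<Lambda>\<close> makes the
  cost exact for every finite \<open>K\<close>.\<close>

lemma outer_closed_split:
  assumes F: "closed F" "F \<noteq> {}"
  shows "outer (A \<inter> F) + outer (A - F) \<le> outer A"
proof -
  define g where "g = cutoff F"
  note g = continuous_on_cutoff[of F, folded g_def] cutoff_nonneg[of F, folded g_def]
    cutoff_le_1[of F, folded g_def] cutoff_Suc_le[of F, folded g_def]
  note g0 = cutoff_0[of F, folded g_def] and g1 = cutoff_in[of _ F, folded g_def]
  have glim: "(\<lambda>k. g k x) \<longlonglongrightarrow> 0" if "x \<notin> F" for x
    using cutoff_tendsto[OF F, of x] that by (simp add: g_def)
  have main: "outer (A \<inter> F) + outer (A - F) \<le> (\<Sum>n. ennreal (\<Lambda> (f n)))" if f: "f \<in> cover A" for f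
  proof -
    have fc: "continuous_on UNIV (f n)" and fn: "f n x \<ge> 0" for n x using f by (auto simp: cover_def)
    let ?T = "\<Sum>n. ennreal (\<Lambda> (f n))" and ?c = "outer (A \<inter> F)"
    define B where "B k n x = f n x * (g k x - g (Suc k) x)" for k n x
    have Bc: "continuous_on UNIV (B k n)" for k n unfolding B_def by (intro continuous_intros fc g)
    have Bn: "B k n x \<ge> 0" for k n x using fn g(4) by (simp add: B_def)
    have fgc: "continuous_on UNIV (\<lambda>x. f n x * g K x)" for n K by (intro continuous_intros fc g)
    have "outer (A - F) \<le> (\<Sum>k. \<Sum>n. ennreal (\<Lambda> (B k n)))"
    proof (rule cover_double[OF Bc Bn])
      fix x assume x: "x \<in> A - F"
      have "x \<notin> F" using x by simp
      from telescope_sums'[OF glim[OF this]]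
      have t: "(\<lambda>k. g k x - g (Suc k) x) sums 1" by (simp only: g0 diff_zero)
      have "(\<Sum>k. ennreal (g k x - g (Suc k) x)) = ennreal 1"
        by (rule suminf_ennreal_eq[OF _ t]) (simp add: g(4))
      then have 1: "(\<Sum>k. ennreal (g k x - g (Suc k) x)) = 1" by (simp only: ennreal_1)
      have "(\<Sum>n. ennreal (B k n x)) = (\<Sum>n. ennreal (f n x)) * ennreal (g k x - g (Suc k) x)" for k
        unfolding B_def ennreal_suminf_multc[symmetric]
        by (intro suminf_cong ennreal_mult fn) (use g(4) in simp)
      then have "(\<Sum>k. \<Sum>n. ennreal (B k n x)) = (\<Sum>k. (\<Sum>n. ennreal (f n x)) * ennreal (g k x - g (Suc k) x))"
        by (simp only:)
      also have "\<dots> = (\<Sum>n. ennreal (f n x)) * 1" unfolding ennreal_suminf_cmult 1 ..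
      finally show "1 \<le> (\<Sum>k. \<Sum>n. ennreal (B k n x))" using f x by (simp add: cover_def)
    qed
    \<comment> \<open>The first \<open>K\<close> differences and the remainder \<open>g K\<close>
      add up to 1, so these pieces of \<open>f n\<close> recombine to \<open>f n\<close>
      itself.\<close>
    moreover have part: "(\<Sum>k<K. \<Sum>n. ennreal (\<Lambda> (B k n))) + ?c \<le> ?T" for K
    proof -
      have "(\<lambda>n x. f n x * g K x) \<in> cover (A \<inter> F)"
        using f fgc g(2) by (auto simp: cover_def g1)
      then have c: "?c \<le> (\<Sum>n. ennreal (\<Lambda> (\<lambda>x. f n x * g K x)))" by (rule outer_le)
      have tele: "(\<Sum>k<K. B k n x) = f n x - f n x * g K x" for n x
      proof -
        have *: "(\<Sum>k<K. g k x - g (Suc k) x) = 1 - g K x"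
          using sum_lessThan_telescope'[of "\<lambda>k. g k x" K] by (simp add: g0)
        show ?thesis unfolding B_def sum_distrib_left[symmetric] * by (simp add: right_diff_distrib)
      qed
      have "(\<Sum>k<K. \<Sum>n. ennreal (\<Lambda> (B k n))) = (\<Sum>n. \<Sum>k<K. ennreal (\<Lambda> (B k n)))"
        by (rule suminf_sum[symmetric]) (rule summableI)
      also have "\<dots> = (\<Sum>n. ennreal (\<Lambda> (f n) - \<Lambda> (\<lambda>x. f n x * g K x)))"
      proof (intro suminf_cong)
        fix n
        have "(\<Sum>k<K. ennreal (\<Lambda> (B k n))) = ennreal (\<Sum>k<K. \<Lambda> (B k n))"
          by (intro sum_ennreal nonneg Bc Bn)
        also have "(\<Sum>k<K. \<Lambda> (B k n)) = \<Lambda> (\<lambda>x. \<Sum>k<K. B k n x)" by (rule sum[symmetric]) (auto intro: Bc)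
        also have "\<dots> = \<Lambda> (f n) - \<Lambda> (\<lambda>x. f n x * g K x)" unfolding tele by (rule diff[OF fc fgc])
        finally show "(\<Sum>k<K. ennreal (\<Lambda> (B k n))) = ennreal (\<Lambda> (f n) - \<Lambda> (\<lambda>x. f n x * g K x))" .
      qed
      finally have "(\<Sum>k<K. \<Sum>n. ennreal (\<Lambda> (B k n))) + ?c \<le>
          (\<Sum>n. ennreal (\<Lambda> (f n) - \<Lambda> (\<lambda>x. f n x * g K x))) + (\<Sum>n. ennreal (\<Lambda> (\<lambda>x. f n x * g K x)))"
        using c by (simp add: add_left_mono)
      also have "\<dots> = (\<Sum>n. ennreal (\<Lambda> (f n) - \<Lambda> (\<lambda>x. f n x * g K x)) + ennreal (\<Lambda> (\<lambda>x. f n x * g K x)))"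
        by (rule suminf_add) (rule summableI)+
      also have "\<dots> = ?T"
      proof (intro suminf_cong)
        fix n
        have "\<Lambda> (\<lambda>x. f n x * g K x) \<le> \<Lambda> (f n)"
          by (rule mono[OF fgc fc]) (use fn g(3) in \<open>simp add: mult_left_le\<close>)
        moreover have "\<Lambda> (\<lambda>x. f n x * g K x) \<ge> 0" by (rule nonneg[OF fgc]) (use fn g(2) in simp)
        ultimately show "ennreal (\<Lambda> (f n) - \<Lambda> (\<lambda>x. f n x * g K x)) + ennreal (\<Lambda> (\<lambda>x. f n x * g K x)) = ennreal (\<Lambda> (f n))"
          by (simp flip: ennreal_plus)
      qed
      finally show ?thesis .
    qed
    have "(\<Sum>k. \<Sum>n. ennreal (\<Lambda> (B k n))) \<le> ?T - ?c"
      by (rule suminf_le_const) (use part in \<open>auto simp: ennreal_le_minus_iff\<close>)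
    ultimately have "outer (A - F) \<le> ?T - ?c" by (rule_tac order_trans)
    then have "outer (A - F) + ?c \<le> (?T - ?c) + ?c" by (rule add_right_mono)
    \<comment> \<open>Subtraction in \<open>ennreal\<close> truncates; \<open>part\<close> with no
      summands says \<open>?c \<le> ?T\<close>, so nothing is lost.\<close>
    also have "\<dots> = ?T" using part[of 0] by (simp add: diff_add_cancel_ennreal)
    finally show ?thesis by (simp add: add.commute)
  qed
  show ?thesis
    unfolding outer_def[of A] by (rule INF_greatest[OF main])
qed

text \<open>Caratheodory's construction: closed sets split every set additively, hence all Borel
  sets are measurable for the outer measure.\<close>

lemma measure_space_outer: "measure_space UNIV (sets borel) outer"
proof -
  have oms: "outer_measure_space (Pow UNIV) outer"
    unfolding outer_measure_space_def positive_def increasing_def countably_subadditive_def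
    using outer_empty outer_mono outer_subadditive by auto
  interpret sigma_algebra UNIV "Pow (UNIV :: 'a set)" by (rule sigma_algebra_Pow)
  define L where "L = lambda_system UNIV (Pow UNIV) outer"
  have msL: "measure_space UNIV L outer" unfolding L_def by (rule caratheodory_lemma[OF oms])
  have "F \<in> L" if "closed F" for F
  proof (cases "F = {}")
    case True
    then show ?thesis unfolding L_def lambda_system_eq by (simp add: outer_empty)
  next
    case False
    have sub: "outer A \<le> outer (A \<inter> F) + outer (A - F)" for A
    proof -
      define S where "S i = (if i = 0 then A \<inter> F else if i = 1 then A - F else {})" for i :: nat
      have "(\<Union>i. S i) = A"
      proof
        show "A \<subseteq> (\<Union>i. S i)"
        proof
          fix x assume "x \<in> A"
          then have "x \<in> S 0 \<or> x \<in> S 1" by (auto simp: S_def)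
          then show "x \<in> (\<Union>i. S i)" by blast
        qed
      qed (auto simp: S_def split: if_splits)
      then have "outer A \<le> (\<Sum>i. outer (S i))" using outer_subadditive[of S] by simp
      also have "\<dots> = (\<Sum>i\<in>{0, 1}. outer (S i))"
        by (rule suminf_finite) (auto simp: S_def outer_empty)
      also have "\<dots> = outer (A \<inter> F) + outer (A - F)" by (simp add: S_def)
      finally show ?thesis .
    qed
    have "outer (A \<inter> F) + outer (A - F) = outer A" for A
      using sub outer_closed_split[OF that False] by (intro antisym)
    then show ?thesis unfolding L_def lambda_system_eq by simp
  qed
  then have "sigma_sets UNIV (Collect closed) \<subseteq> L"
    using msL by (intro sigma_algebra.sigma_sets_subset) (auto simp: measure_space_def)
  then have "sets (borel :: 'a measure) \<subseteq> L" by (simp add: borel_eq_closed)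
  then show ?thesis
    by (rule measure_down[OF msL, rotated]) (metis sets.sigma_algebra_axioms space_borel)
qed

definition representing_measure :: "'a measure" where
  "representing_measure = measure_of UNIV (sets borel) outer"

lemma sets_representing [simp]: "sets representing_measure = sets borel"
  unfolding representing_measure_def by (metis sets.sets_measure_of_eq space_borel)

lemma space_representing [simp]: "space representing_measure = UNIV"
  using sets_eq_imp_space_eq[OF sets_representing] by simp

lemma emeasure_representing: "A \<in> sets borel \<Longrightarrow> emeasure representing_measure A = outer A"
  using measure_space_outer unfolding representing_measure_def measure_space_def
  by (intro emeasure_measure_of_sigma) auto

text \<open>For the lower bound, compactness gives one finite partial sum of the cover that is at
  least \<open>1 - e\<close> everywhere; positivity of \<open>\<Lambda>\<close> and \<open>e\<close>
  tending to 0 finish it.\<close>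

lemma outer_UNIV: "outer UNIV = ennreal (\<Lambda> (\<lambda>_. 1))"
proof (rule antisym)
  show "outer UNIV \<le> ennreal (\<Lambda> (\<lambda>_. 1))" by (rule outer_le_single) auto
  show "ennreal (\<Lambda> (\<lambda>_. 1)) \<le> outer UNIV"
    unfolding outer_def
  proof (rule INF_greatest)
    fix f assume f: "f \<in> cover UNIV"
    have fc: "continuous_on UNIV (f n)" and fn: "f n x \<ge> 0" and f1: "1 \<le> (\<Sum>n. ennreal (f n x))" for n x
      using f by (auto simp: cover_def)
    have sc: "continuous_on UNIV (\<lambda>x. \<Sum>n<N. f n x)" for N by (intro continuous_intros fc)
    let ?T = "\<Sum>n. ennreal (\<Lambda> (f n))"
    have bound: "ennreal ((1 - e) * \<Lambda> (\<lambda>_. 1)) \<le> ?T" if e: "e > 0" for e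
    proof -
      define U where "U N = {x. (\<Sum>n<N. f n x) > 1 - e}" for N
      have "open (U N)" for N
        unfolding U_def by (intro open_Collect_less continuous_intros fc)
      moreover have "UNIV \<subseteq> (\<Union>N\<in>UNIV. U N)"
      proof
        fix x
        have "ennreal (1 - e) < 1" using e by (simp add: ennreal_less_one_iff)
        also have "1 \<le> (\<Sum>n. ennreal (f n x))" by (rule f1)
        also have "\<dots> = (SUP N. \<Sum>n<N. ennreal (f n x))" by (rule suminf_eq_SUP)
        finally obtain N where "ennreal (1 - e) < (\<Sum>n<N. ennreal (f n x))" by (auto simp: less_SUP_iff)
        also have "\<dots> = ennreal (\<Sum>n<N. f n x)" by (rule sum_ennreal) (rule fn)
        finally have "1 - e < (\<Sum>n<N. f n x)"
          by (metis ennreal_leI not_le)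
        then show "x \<in> (\<Union>N\<in>UNIV. U N)" by (auto simp: U_def)
      qed
      ultimately obtain C where C: "finite C" "UNIV \<subseteq> (\<Union>N\<in>C. U N)"
        using compactE_image[OF compact, of UNIV U] by metis
      obtain M where M: "\<And>N. N \<in> C \<Longrightarrow> N \<le> M" using finite_nat_set_iff_bounded_le[of C] C(1) by auto
      have "1 - e \<le> (\<Sum>n<M. f n x)" for x
      proof -
        obtain N where N: "N \<in> C" "x \<in> U N" using C(2) by blast
        have "(\<Sum>n<N. f n x) \<le> (\<Sum>n<M. f n x)" by (rule sum_mono2) (use M[OF N(1)] fn in auto)
        then show ?thesis using N(2) by (simp add: U_def)
      qed
      then have "\<Lambda> (\<lambda>_. 1 - e) \<le> \<Lambda> (\<lambda>x. \<Sum>n<M. f n x)" by (intro mono sc) auto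
      then have "(1 - e) * \<Lambda> (\<lambda>_. 1) \<le> (\<Sum>n<M. \<Lambda> (f n))" using sum[of "{..<M}" f] fc const[of "1 - e"] by simp
      then have "ennreal ((1 - e) * \<Lambda> (\<lambda>_. 1)) \<le> ennreal (\<Sum>n<M. \<Lambda> (f n))" by (rule ennreal_leI)
      also have "\<dots> = (\<Sum>n<M. ennreal (\<Lambda> (f n)))" by (rule sum_ennreal[symmetric]) (intro nonneg fc fn)
      also have "\<dots> \<le> ?T" by (rule sum_le_suminf) auto
      finally show ?thesis .
    qed
    show "ennreal (\<Lambda> (\<lambda>_. 1)) \<le> ?T"
    proof (rule tendsto_upperbound)
      show "((\<lambda>e. ennreal ((1 - e) * \<Lambda> (\<lambda>_. 1))) \<longlongrightarrow> ennreal (\<Lambda> (\<lambda>_. 1))) (at_right 0)"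
      proof (rule tendsto_ennrealI)
        have "((\<lambda>e. (1 - e) * \<Lambda> (\<lambda>_. 1)) \<longlongrightarrow> (1 - 0) * \<Lambda> (\<lambda>_. 1)) (at_right (0::real))"
          by (intro tendsto_intros)
        then show "((\<lambda>e. (1 - e) * \<Lambda> (\<lambda>_. 1)) \<longlongrightarrow> \<Lambda> (\<lambda>_. 1)) (at_right (0::real))" by simp
      qed
      show "\<forall>\<^sub>F e in at_right 0. ennreal ((1 - e) * \<Lambda> (\<lambda>_. 1)) \<le> ?T"
        by (rule eventually_at_rightI[of 0 1]) (use bound in auto)
    qed simp
  qed
qed

lemma finite_measure_representing: "finite_measure representing_measure"
  by (rule finite_measureI) (simp add: emeasure_representing outer_UNIV)

lemma measure_UNIV: "measure representing_measure UNIV = \<Lambda> (\<lambda>_. 1)"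
  using nonneg[of "\<lambda>_. 1"] by (simp add: measure_def emeasure_representing outer_UNIV)

lemma measure_le:
  assumes "A \<in> sets borel" "continuous_on UNIV g" "\<And>x. g x \<ge> 0" "\<And>x. x \<in> A \<Longrightarrow> g x \<ge> 1"
  shows "measure representing_measure A \<le> \<Lambda> g"
proof -
  have "emeasure representing_measure A \<le> ennreal (\<Lambda> g)"
    unfolding emeasure_representing[OF assms(1)] by (rule outer_le_single[OF assms(2-4)])
  then show ?thesis
    unfolding measure_def using nonneg[OF assms(2,3)] by (rule enn2real_leI[rotated])
qed

lemma bounded_continuous:
  assumes "continuous_on UNIV f" obtains C where "\<And>x::'a. \<bar>f x\<bar> \<le> (C::real)"
proof -
  have "bounded (f ` UNIV)" by (intro compact_imp_bounded compact_continuous_image assms compact)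
  then show thesis using that by (auto simp: bounded_real)
qed

lemma integrable_continuous:
  assumes f: "continuous_on UNIV f" shows "integrable representing_measure (f :: 'a \<Rightarrow> real)"
proof -
  interpret finite_measure representing_measure by (rule finite_measure_representing)
  obtain C where "\<And>x. \<bar>f x\<bar> \<le> C" using bounded_continuous[OF f] by blast
  moreover have "f \<in> borel_measurable representing_measure"
    using borel_measurable_continuous_onI[OF f] by (simp cong: measurable_cong_sets)
  ultimately show ?thesis by (intro integrable_const_bound[of _ C]) auto
qed

text \<open>Slicing the range of \<open>f\<close> into layers of height \<open>h\<close> compares the integral with \<open>\<Lambda> f\<close> up to \<open>h\<close>
  times the total mass.\<close>

lemma integral_le:
  assumes f: "continuous_on UNIV f" and fn: "\<And>x. f x \<ge> 0"
  shows "(\<integral>x. f x \<partial>representing_measure) \<le> \<Lambda> f"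
proof (rule field_le_epsilon)
  interpret finite_measure representing_measure by (rule finite_measure_representing)
  fix e :: real assume e: "e > 0"
  let ?\<mu> = "measure representing_measure" and ?W = "\<Lambda> (\<lambda>_. 1)"
  have W: "?W \<ge> 0" by (rule nonneg) auto
  \<comment> \<open>The 1 avoids division by a vanishing total mass.\<close>
  define h where "h = e / (?W + 1)"
  have h: "h > 0" "h * ?W \<le> e" using e W by (auto simp: h_def field_simps)
  obtain C where C: "\<And>x. \<bar>f x\<bar> \<le> C" using bounded_continuous[OF f] by blast
  obtain N where "C / h \<le> real N" using real_arch_simple by blast
  then have N: "C \<le> real N * h" using h(1) by (simp add: divide_le_eq)
  \<comment> \<open>The slice of \<open>f\<close> between heights \<open>real k * h\<close> and
    \<open>real (Suc k) * h\<close>. It has full height \<open>h\<close> on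
    \<open>B (Suc k)\<close>, so \<open>s k / h\<close> dominates that indicator.\<close>
  define s where "s k x = min (max (f x - real k * h) 0) h" for k x
  have sc: "continuous_on UNIV (s k)" for k unfolding s_def by (intro continuous_intros f)
  have layers: "(\<Sum>k<n. s k x) = min (f x) (real n * h)" for n x
  proof (induction n)
    case 0 then show ?case using fn[of x] by simp
  next
    case (Suc n)
    then show ?case using h(1) fn[of x] by (auto simp: s_def min_def max_def algebra_simps)
  qed
  define B where "B k = {x. f x > real k * h}" for k :: nat
  have B: "B k \<in> sets borel" for k
    unfolding B_def by (intro borel_open open_Collect_less continuous_intros f)
  have B': "?\<mu> (B (Suc k)) \<le> \<Lambda> (s k) / h" for k
  proof -
    have "?\<mu> (B (Suc k)) \<le> \<Lambda> (\<lambda>x. (1 / h) * s k x)"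
    proof (rule measure_le[OF B])
      show "continuous_on UNIV (\<lambda>x. (1 / h) * s k x)" by (intro continuous_intros sc)
      show "0 \<le> (1 / h) * s k x" for x using h(1) by (simp add: s_def)
      show "1 \<le> (1 / h) * s k x" if "x \<in> B (Suc k)" for x
        using that h(1) by (simp add: B_def s_def algebra_simps)
    qed
    then show ?thesis using cmult[OF sc, of "1 / h" k] by simp
  qed
  have "f x \<le> (\<Sum>k<N. h * indicator (B k) x)" for x
  proof -
    have "f x = (\<Sum>k<N. s k x)" unfolding layers using C[of x] N by (simp add: min_def)
    also have "\<dots> \<le> (\<Sum>k<N. h * indicator (B k) x)"
      by (rule sum_mono) (use h(1) in \<open>auto simp: s_def B_def indicator_def\<close>)
    finally show ?thesis .
  qed
  moreover have int: "integrable representing_measure (\<lambda>x. h * indicator (B k) x)" for k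
    by (intro integrable_mult_right integrable_real_indicator) (simp_all add: B less_top[symmetric])
  ultimately have "(\<integral>x. f x \<partial>representing_measure) \<le> (\<integral>x. (\<Sum>k<N. h * indicator (B k) x) \<partial>representing_measure)"
    by (rule_tac integral_mono[OF integrable_continuous[OF f] Bochner_Integration.integrable_sum]) simp_all
  also have "\<dots> = (\<Sum>k<N. \<integral>x. h * indicator (B k) x \<partial>representing_measure)"
    by (rule Bochner_Integration.integral_sum[OF int])
  also have "\<dots> = (\<Sum>k<N. h * ?\<mu> (B k))"
    by simp
  \<comment> \<open>One term is added so that splitting off index 0 leaves the sets
    \<open>B (Suc k)\<close> with \<open>k < N\<close>, matching \<open>B'\<close>; the term at 0 is
    the error \<open>h * ?W\<close>.\<close>
  also have "\<dots> \<le> (\<Sum>k<Suc N. h * ?\<mu> (B k))"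
    using h(1) by simp
  also have "\<dots> = h * ?\<mu> (B 0) + (\<Sum>k<N. h * ?\<mu> (B (Suc k)))"
    by (rule sum.lessThan_Suc_shift)
  also have "\<dots> \<le> h * ?W + (\<Sum>k<N. \<Lambda> (s k))"
  proof (intro add_mono sum_mono)
    show "h * ?\<mu> (B 0) \<le> h * ?W"
      using h(1) finite_measure_mono[of "B 0" UNIV] by (simp add: measure_UNIV)
    show "h * ?\<mu> (B (Suc k)) \<le> \<Lambda> (s k)" for k using B'[of k] h(1) by (simp add: field_simps)
  qed
  also have "(\<Sum>k<N. \<Lambda> (s k)) = \<Lambda> (\<lambda>x. \<Sum>k<N. s k x)" by (rule sum[symmetric]) (auto intro: sc)
  also have "\<dots> \<le> \<Lambda> f" by (rule mono) (auto intro!: continuous_intros f sc simp: layers)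
  finally show "(\<integral>x. f x \<partial>representing_measure) \<le> \<Lambda> f + e" using h(2) by simp
qed

text \<open>The one-sided bound is applied to the nonnegative functions \<open>C + f\<close> and
  \<open>C - f\<close>. Constants integrate exactly because the total mass is
  \<open>\<Lambda>\<close> of 1, so the two bounds close up to an equality.\<close>

theorem integral_representing:
  assumes f: "continuous_on UNIV f"
  shows "(\<integral>x. f x \<partial>representing_measure) = \<Lambda> f"
proof -
  interpret finite_measure representing_measure by (rule finite_measure_representing)
  obtain C where C: "\<And>x. \<bar>f x\<bar> \<le> C" using bounded_continuous[OF f] by blast
  have fC: "0 \<le> C + f x" "0 \<le> C - f x" for x using C[of x] by linarith+
  have "(\<integral>x. C + f x \<partial>representing_measure) \<le> \<Lambda> (\<lambda>x. C + f x)"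
    by (intro integral_le continuous_intros f fC)
  moreover have "(\<integral>x. C - f x \<partial>representing_measure) \<le> \<Lambda> (\<lambda>x. C - f x)"
    by (intro integral_le continuous_intros f fC)
  moreover have "\<Lambda> (\<lambda>x. C + f x) = C * \<Lambda> (\<lambda>_. 1) + \<Lambda> f" "\<Lambda> (\<lambda>x. C - f x) = C * \<Lambda> (\<lambda>_. 1) - \<Lambda> f"
    using add[of "\<lambda>_. C" f] diff[of "\<lambda>_. C" f] f const[of C] by auto
  moreover have "(\<integral>x. C + f x \<partial>representing_measure) = C * \<Lambda> (\<lambda>_. 1) + (\<integral>x. f x \<partial>representing_measure)"
    "(\<integral>x. C - f x \<partial>representing_measure) = C * \<Lambda> (\<lambda>_. 1) - (\<integral>x. f x \<partial>representing_measure)"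
    using integrable_continuous[OF f] by (simp_all add: measure_UNIV)
  ultimately show ?thesis by linarith
qed

end

text \<open>Cutoffs converge to indicators of closed sets, and the closed sets form an
  intersection-stable generator of the Borel sets. Two finite families appear instead of two
  measures because the final identity concerns sums of measures.\<close>

lemma measure_eq_of_continuous_integrals:
  fixes M :: "'i \<Rightarrow> 'a::metric_space measure" and N :: "'j \<Rightarrow> 'a measure"
  assumes fin: "finite I" "finite J"
    and M: "\<And>i. i \<in> I \<Longrightarrow> finite_measure (M i)" "\<And>i. i \<in> I \<Longrightarrow> sets (M i) = sets borel"
    and N: "\<And>j. j \<in> J \<Longrightarrow> finite_measure (N j)" "\<And>j. j \<in> J \<Longrightarrow> sets (N j) = sets borel"
    and eq: "\<And>f :: 'a \<Rightarrow> real. continuous_on UNIV f \<Longrightarrow> (\<And>x. \<bar>f x\<bar> \<le> 1) \<Longrightarrow>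
       (\<Sum>i\<in>I. \<integral>x. f x \<partial>M i) = (\<Sum>j\<in>J. \<integral>x. f x \<partial>N j)"
    and A: "A \<in> sets borel"
  shows "(\<Sum>i\<in>I. measure (M i) A) = (\<Sum>j\<in>J. measure (N j) A)"
proof -
  have closed_case: "(\<Sum>i\<in>I. measure (M i) F) = (\<Sum>j\<in>J. measure (N j) F)" if F: "closed F" for F
  proof (cases "F = {}")
    case False
    define g where "g = cutoff F"
    note g = continuous_on_cutoff[of F, folded g_def] cutoff_nonneg[of F, folded g_def]
      cutoff_le_1[of F, folded g_def] and glim = cutoff_tendsto[OF F False, folded g_def]
    have lim: "(\<lambda>k. \<integral>x. g k x \<partial>P) \<longlonglongrightarrow> measure P F" if P: "finite_measure P" "sets P = sets borel" for P
    proof -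
      interpret finite_measure P by fact
      have sp: "space P = UNIV" using sets_eq_imp_space_eq[OF P(2)] by simp
      have "(\<lambda>k. \<integral>x. g k x \<partial>P) \<longlonglongrightarrow> (\<integral>x. indicator F x \<partial>P)"
      proof (rule integral_dominated_convergence[where w = "\<lambda>_. 1"])
        show "(indicator F :: 'a \<Rightarrow> real) \<in> borel_measurable P"
          using F P(2) by (intro borel_measurable_indicator) auto
        show "g k \<in> borel_measurable P" for k
          using borel_measurable_continuous_onI[OF g(1)[of k]] P(2) by (simp cong: measurable_cong_sets)
      qed (use glim g in auto)
      then show ?thesis by (simp add: sp)
    qed
    have "(\<lambda>k. \<Sum>i\<in>I. \<integral>x. g k x \<partial>M i) \<longlonglongrightarrow> (\<Sum>i\<in>I. measure (M i) F)"
      by (intro tendsto_sum lim M)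
    moreover have "(\<lambda>k. \<Sum>j\<in>J. \<integral>x. g k x \<partial>N j) \<longlonglongrightarrow> (\<Sum>j\<in>J. measure (N j) F)"
      by (intro tendsto_sum lim N)
    moreover have "(\<Sum>i\<in>I. \<integral>x. g k x \<partial>M i) = (\<Sum>j\<in>J. \<integral>x. g k x \<partial>N j)" for k
    proof (rule eq[OF g(1)])
      show "\<bar>g k x\<bar> \<le> 1" for x using g(2,3)[of k x] by simp
    qed
    ultimately show ?thesis by (simp add: LIMSEQ_unique)
  qed simp
  have "Int_stable (Collect (closed :: 'a set \<Rightarrow> bool))" "Collect (closed :: 'a set \<Rightarrow> bool) \<subseteq> Pow UNIV"
    "A \<in> sigma_sets UNIV (Collect closed)"
    using A by (auto simp: Int_stable_def borel_eq_closed)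
  then show ?thesis
  proof (induct A rule: sigma_sets_induct_disjoint)
    case (basic A) then show ?case by (simp add: closed_case)
  next
    case empty then show ?case by simp
  next
    case (compl A)
    have AB: "A \<in> sets borel" using compl(1) by (simp add: borel_eq_closed)
    have "measure P (UNIV - A) = measure P UNIV - measure P A" if "finite_measure P" "sets P = sets borel" for P
      using finite_measure.finite_measure_Diff[OF that(1), of UNIV A] that(2) AB sets_eq_imp_space_eq[OF that(2)]
      by (simp add: sets_eq_imp_space_eq)
    then show ?case using compl(2) closed_case[of UNIV] M N by (simp add: sum_subtractf)
  next
    case (union A)
    have AB: "range A \<subseteq> sets borel" using union(2) by (auto simp: borel_eq_closed)
    have s: "(\<lambda>n. measure P (A n)) sums measure P (\<Union>n. A n)" if "finite_measure P" "sets P = sets borel" for P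
      using finite_measure.finite_measure_UNION[OF that(1), of A] that(2) AB union(1) by simp
    have "(\<lambda>n. \<Sum>i\<in>I. measure (M i) (A n)) sums (\<Sum>i\<in>I. measure (M i) (\<Union>n. A n))"
      by (intro sums_sum s M)
    moreover have "(\<lambda>n. \<Sum>j\<in>J. measure (N j) (A n)) sums (\<Sum>j\<in>J. measure (N j) (\<Union>n. A n))"
      by (intro sums_sum s N)
    ultimately show ?case using union(3) sums_unique2 by simp
  qed
qed

section \<open>Boundary values of the Perron solution\<close>

lemma locally_submean_cmult:
  assumes "locally_submean u z" "k \<ge> 0" shows "locally_submean (\<lambda>w. k * u w) z"
  using assms(1) unfolding locally_submean_def circle_mean_cmult
  by (rule eventually_mono) (use assms(2) in \<open>simp add: mult_left_mono\<close>)

lemma sphere_subharmonic_on_cmult: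
  assumes u: "sphere_subharmonic_on u D" and D: "open D" and k: "k \<ge> 0"
  shows "sphere_subharmonic_on (\<lambda>x. k * u x) D"
proof (rule sphere_subharmonic_onI[OF D])
  show "continuous_on D (\<lambda>x. k * u x)"
    by (intro continuous_intros sphere_subharmonic_on_continuous[OF u D])
  show "locally_submean (\<lambda>z. k * u (chart b z)) z" if "chart b z \<in> D" for b z
    by (rule locally_submean_cmult[OF sphere_subharmonic_on_locally[OF u D that] k])
qed

lemma frontier_open_disjoint: "open D \<Longrightarrow> \<zeta> \<in> frontier D \<Longrightarrow> \<zeta> \<notin> D"
  by (simp add: frontier_def interior_open)

text \<open>A function harmonic in \<open>D\<close> with the right boundary values belongs to the
  Perron family and dominates it, so the supremum is attained by it.\<close>

lemma perron_solution_eqI: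
  assumes D: "open D" "D \<noteq> UNIV"
    and h: "sphere_subharmonic_on h D" "sphere_subharmonic_on (\<lambda>x. - h x) D"
    and lim: "\<And>\<zeta>. \<zeta> \<in> frontier D \<Longrightarrow> (h \<longlongrightarrow> \<psi> \<zeta>) (at \<zeta> within D)"
    and a: "a \<in> D"
  shows "perron_solution D \<psi> a = h a"
  unfolding perron_solution_def
proof (rule cSup_eq_maximum)
  have "h \<in> perron_family D \<psi>"
    using h(1) upper_boundary_tendsto[OF lim] by (simp add: mem_perron_family)
  then show "h a \<in> (\<lambda>u. u a) ` perron_family D \<psi>" by blast
  fix y assume "y \<in> (\<lambda>u. u a) ` perron_family D \<psi>"
  then obtain u where u: "u \<in> perron_family D \<psi>" "y = u a" by blast
  have "u a + - h a \<le> 0"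
  proof (rule perron_comparison[OF D _ h(2) _ _ _ a])
    show "sphere_subharmonic_on u D" "upper_boundary D u \<psi>" using u(1) by (auto simp: mem_perron_family)
    show "upper_boundary D (\<lambda>x. - h x) (\<lambda>\<zeta>. - \<psi> \<zeta>)"
      by (rule upper_boundary_tendsto) (intro tendsto_minus lim)
  qed simp
  then show "y \<le> h a" using u(2) by simp
qed

context rational_map
begin

definition disc_preimage :: "riemann_sphere set" where
  "disc_preimage = R -` (Fin ` ball 0 1)"

lemma disc_preimage_iff: "x \<in> disc_preimage \<longleftrightarrow> (\<exists>w. norm w < 1 \<and> R x = Fin w)"
  by (auto simp: disc_preimage_def)

lemma open_disc_preimage: "open disc_preimage"
proof -
  have "chart At_zero = Fin" by (simp add: fun_eq_iff chart_def)
  then have "open (Fin ` ball 0 1)" using open_chart_image[OF open_ball, of At_zero 0 1] by simp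
  then show ?thesis unfolding disc_preimage_def by (rule open_vimage[OF _ continuous_on_R])
qed

lemma closure_disc_preimage_subset: "closure disc_preimage \<subseteq> R -` (Fin ` cball 0 1)"
proof (rule closure_minimal)
  have "closed (Fin ` cball 0 1)"
    by (intro compact_imp_closed compact_continuous_image continuous_on_Fin compact_cball)
  then show "closed (R -` (Fin ` cball 0 1))" by (rule closed_vimage[OF _ continuous_on_R])
  show "disc_preimage \<subseteq> R -` (Fin ` cball 0 1)" by (auto simp: disc_preimage_def)
qed

text \<open>In the normal form at \<open>x\<close>, a root of \<open>- e * c\<close> moves the value
  from \<open>c\<close> to \<open>(1 - e) * c\<close>, which lies inside the disc. This works at
  critical points too.\<close>

lemma boundary_in_closure:
  assumes x: "R x = Fin c" and c: "norm c = 1" shows "x \<in> closure disc_preimage"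
  unfolding closure_iff_nhds_not_empty
proof (intro allI impI)
  fix A V assume V: "V \<subseteq> A" "open V" "x \<in> V"
  obtain b \<kappa> \<rho> where lf: "local_form x c V b \<kappa> \<rho>" using local_form_exists(2)[OF x V(2,3)] by blast
  note L = local_formD[OF lf]
  let ?m = "fibre_mult R x"
  have m: "?m > 0" by (rule local_form_exists(1)[OF x V(2,3)])
  \<comment> \<open>Below 1, so that \<open>1 - e\<close> stays positive, and below
    \<open>\<rho> ^ ?m\<close>, so that the root stays in the coordinate disc.\<close>
  define e where "e = min (1/2) (\<rho> ^ ?m / 2)"
  have "\<rho> ^ ?m > 0" using L(1) by simp
  then have e: "e > 0" "e < 1" "e < \<rho> ^ ?m" by (auto simp: e_def min_def)
  have card: "card {s. s ^ ?m = - of_real e * c} = ?m"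
    by (rule card_nth_roots) (use e(1) c m in auto)
  have "{s. s ^ ?m = - of_real e * c} \<noteq> {}"
  proof
    assume "{s. s ^ ?m = - of_real e * c} = {}"
    then show False using card m by (simp only: card.empty)
  qed
  then obtain s where s: "s ^ ?m = - of_real e * c" by blast
  have "norm s < \<rho>"
    by (rule norm_less_if_power[OF s]) (use e L(1) c in \<open>simp_all add: norm_mult\<close>)
  then have sb: "s \<in> ball 0 \<rho>" by simp
  have eq: "c + s ^ ?m = of_real (1 - e) * c" by (simp add: s algebra_simps)
  have "norm (c + s ^ ?m) < 1" using e c by (simp only: eq norm_mult norm_of_real) simp
  then have "chart b (\<kappa> s) \<in> disc_preimage" using L(6)[OF sb] by (auto simp: disc_preimage_iff)
  then show "disc_preimage \<inter> A \<noteq> {}" using L(5)[OF sb] V(1) by blast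
qed

lemma closure_disc_preimage: "closure disc_preimage = R -` (Fin ` cball 0 1)"
proof
  show "R -` (Fin ` cball 0 1) \<subseteq> closure disc_preimage"
  proof
    fix x assume "x \<in> R -` (Fin ` cball 0 1)"
    then obtain c where c: "R x = Fin c" "norm c \<le> 1" by auto
    show "x \<in> closure disc_preimage"
    proof (cases "norm c < 1")
      case True
      then have "x \<in> disc_preimage" using c by (auto simp: disc_preimage_iff)
      then show ?thesis using closure_subset by blast
    next
      case False
      then show ?thesis using boundary_in_closure c by force
    qed
  qed
qed (rule closure_disc_preimage_subset)

lemma frontier_disc_preimage: "x \<in> frontier disc_preimage \<longleftrightarrow> (\<exists>c. norm c = 1 \<and> R x = Fin c)"
proof
  assume x: "x \<in> frontier disc_preimage"
  then obtain c where c: "R x = Fin c" "norm c \<le> 1"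
    unfolding frontier_def closure_disc_preimage by auto
  moreover have "\<not> norm c < 1"
    using frontier_open_disjoint[OF open_disc_preimage x] c(1) by (auto simp: disc_preimage_iff)
  ultimately show "\<exists>c. norm c = 1 \<and> R x = Fin c" by (intro exI[of _ c]) simp
next
  assume "\<exists>c. norm c = 1 \<and> R x = Fin c"
  then obtain c where c: "norm c = 1" "R x = Fin c" by blast
  then have "x \<notin> disc_preimage" by (auto simp: disc_preimage_iff)
  then show "x \<in> frontier disc_preimage"
    using boundary_in_closure[OF c(2,1)] by (simp add: frontier_def interior_open[OF open_disc_preimage])
qed

lemma continuous_on_the_Fin_R: "continuous_on (R -` (Fin ` cball 0 1)) (\<lambda>x. the_Fin (R x))"
  by (rule continuous_on_compose2[OF continuous_on_the_Fin continuous_on_R]) auto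

text \<open>The exterior is the preimage of the disc under the reciprocal of \<open>R\<close>, so
  every result on \<open>disc_preimage\<close> covers both sides.\<close>

lemma complement_disc_preimage:
  "UNIV - closure disc_preimage = (\<lambda>x. sphere_inverse (R x)) -` (Fin ` ball 0 1)"
proof -
  have "R x \<notin> Fin ` cball 0 1 \<longleftrightarrow> sphere_inverse (R x) \<in> Fin ` ball 0 1" for x
  proof (cases "R x")
    case (Fin w)
    then show ?thesis
      by (cases "w = 0") (auto simp: norm_inverse inverse_less_1_iff image_iff not_le dist_norm)
  next
    case Infty
    then show ?thesis by auto
  qed
  then show ?thesis unfolding closure_disc_preimage by auto
qed

text \<open>The barrier at \<open>x\<^sub>0\<close> is \<open>Re (cnj c * R) - 1\<close> where \<open>R x\<^sub>0 = c\<close>, truncated to be constant away from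
  \<open>x\<^sub>0\<close>: on the closed disc that function vanishes only at \<open>c\<close>, whose fibre is discrete.\<close>

lemma barrier:
  assumes x0: "x0 \<in> frontier disc_preimage" and \<delta>1: "\<delta>1 > 0"
  obtains \<beta> \<delta> \<eta> where "sphere_subharmonic_on \<beta> disc_preimage" "0 < \<delta>" "\<delta> < \<delta>1" "\<eta> > 0"
    "\<And>x. x \<in> disc_preimage \<Longrightarrow> \<beta> x \<le> 0" "\<And>x. dist x0 x > \<delta> \<Longrightarrow> \<beta> x = - \<eta>"
    "\<And>e. e > 0 \<Longrightarrow> \<forall>\<^sub>F x in at x0 within disc_preimage. \<beta> x > - e"
proof -
  let ?D = disc_preimage and ?S = "R -` (Fin ` cball 0 1)"
  have D: "open ?D" by (rule open_disc_preimage)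
  have DS: "?D \<subseteq> ?S" by (auto simp: disc_preimage_def)
  obtain c where c: "norm c = 1" "R x0 = Fin c" using x0 by (auto simp: frontier_disc_preimage)
  define q where "q x = Re (cnj c * the_Fin (R x)) - 1" for x
  have qc: "continuous_on ?S q"
    unfolding q_def by (intro continuous_intros continuous_on_the_Fin_R)
  have cc: "cnj c * c = 1" using c(1) by (metis complex_norm_square mult.commute of_real_1 power_one)
  have q_le: "q x \<le> 0" and q_0: "q x = 0 \<Longrightarrow> R x = Fin c" if x: "x \<in> ?S" for x
  proof -
    obtain w where w: "R x = Fin w" "norm w \<le> 1" using x by auto
    have n: "norm (cnj c * w) \<le> 1" using w(2) c(1) by (simp add: norm_mult)
    show "q x \<le> 0" using n complex_Re_le_cmod[of "cnj c * w"] w(1) by (simp add: q_def)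
    assume "q x = 0"
    then have re: "Re (cnj c * w) = 1" using w(1) by (simp add: q_def)
    have "(norm (cnj c * w))\<^sup>2 \<le> 1" using n by (simp add: power_le_one)
    then have "Im (cnj c * w) = 0" using re cmod_power2[of "cnj c * w"] by simp
    then have cw: "cnj c * w = 1" using re by (simp add: complex_eq_iff)
    have "w = (cnj c * c) * w" by (simp only: cc mult_1_left)
    also have "\<dots> = c * (cnj c * w)" by (simp only: mult_ac)
    finally have "w = c" by (simp only: cw mult_1_right)
    then show "R x = Fin c" using w(1) by simp
  qed
  from finite_set_avoid[OF finite_fibre[of "Fin c"], of x0]
  obtain d where d: "d > 0" and d': "\<forall>x\<in>{x. R x = Fin c}. x \<noteq> x0 \<longrightarrow> d \<le> dist x0 x"
    by (elim exE conjE)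
  \<comment> \<open>\<open>\<delta> < d\<close> keeps all other points of the fibre over
    \<open>c\<close> off the sphere of radius \<open>\<delta>\<close> around
    \<open>x0\<close>.\<close>
  define \<delta> where "\<delta> = min (\<delta>1 / 2) (d / 2)"
  have \<delta>: "0 < \<delta>" "\<delta> < \<delta>1" "\<delta> < d" using \<delta>1 d by (auto simp: \<delta>_def)
  define \<Sigma> where "\<Sigma> = ?S \<inter> {x. dist x0 x = \<delta>}"
  have "closed ?S" using closure_disc_preimage by (metis closed_closure)
  moreover have "closed {x. dist x0 x = \<delta>}" by (intro closed_Collect_eq continuous_intros)
  ultimately have "compact \<Sigma>"
    unfolding \<Sigma>_def by (rule compact_riemann_sphere_closed[OF closed_Int])
  have neg: "q x < 0" if "x \<in> \<Sigma>" for x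
  proof -
    have xS: "x \<in> ?S" "dist x0 x = \<delta>" using that by (simp_all add: \<Sigma>_def)
    have "q x \<noteq> 0"
    proof
      assume "q x = 0"
      then have "R x = Fin c" by (rule q_0[OF xS(1)])
      moreover have "x \<noteq> x0" using xS(2) \<delta>(1) by auto
      ultimately have "d \<le> dist x0 x" using bspec[OF d', of x] by simp
      then show False using xS(2) \<delta>(3) by simp
    qed
    then show ?thesis using q_le[OF xS(1)] by simp
  qed
  have "\<exists>\<eta>>0. \<forall>x\<in>\<Sigma>. q x \<le> - \<eta>"
  proof (cases "\<Sigma> = {}")
    case True then show ?thesis by (intro exI[of _ 1]) simp
  next
    case False
    have "continuous_on \<Sigma> q" using qc by (rule continuous_on_subset) (auto simp: \<Sigma>_def)
    then obtain x where x: "x \<in> \<Sigma>" "\<forall>y\<in>\<Sigma>. q y \<le> q x"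
      using continuous_attains_sup[OF \<open>compact \<Sigma>\<close> False] by blast
    then show ?thesis using neg[OF x(1)] by (intro exI[of _ "- q x"]) simp
  qed
  then obtain \<eta> where \<eta>: "\<eta> > 0" "\<And>x. x \<in> \<Sigma> \<Longrightarrow> q x \<le> - \<eta>" by blast
  \<comment> \<open>On the sphere of radius \<open>\<delta>\<close> around \<open>x0\<close> one has
    \<open>q \<le> - \<eta>\<close>, so both branches give \<open>- \<eta>\<close> there and
    \<open>\<beta>\<close> is continuous.\<close>
  define \<beta> where "\<beta> x = (if dist x0 x \<le> \<delta> then max (q x) (- \<eta>) else - \<eta>)" for x
  have \<beta>_far: "\<beta> x = - \<eta>" if "x \<in> ?D" "dist x0 x \<ge> \<delta>" for x
  proof (cases "dist x0 x = \<delta>")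
    case True
    then have "x \<in> \<Sigma>" using that DS by (auto simp: \<Sigma>_def)
    then show ?thesis using \<eta>(2)[of x] True by (simp add: \<beta>_def)
  qed (use that in \<open>simp add: \<beta>_def\<close>)
  have \<beta>c: "continuous_on ?D \<beta>"
  proof -
    have "continuous_on ((?D \<inter> cball x0 \<delta>) \<union> (?D - ball x0 \<delta>)) \<beta>"
    proof (rule continuous_on_Un_local)
      have e: "(?D \<inter> cball x0 \<delta>) \<union> (?D - ball x0 \<delta>) = ?D" by auto
      show "closedin (top_of_set ((?D \<inter> cball x0 \<delta>) \<union> (?D - ball x0 \<delta>))) (?D \<inter> cball x0 \<delta>)"
        unfolding e by (rule closedin_closed_Int) simp
      have "?D - ball x0 \<delta> = ?D \<inter> - ball x0 \<delta>" by auto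
      then show "closedin (top_of_set ((?D \<inter> cball x0 \<delta>) \<union> (?D - ball x0 \<delta>))) (?D - ball x0 \<delta>)"
        unfolding e by (simp add: closedin_closed_Int closed_Compl)
      have "continuous_on (?D \<inter> cball x0 \<delta>) (\<lambda>x. max (q x) (- \<eta>))"
        by (intro continuous_intros continuous_on_subset[OF qc]) (use DS in auto)
      then show "continuous_on (?D \<inter> cball x0 \<delta>) \<beta>"
        by (rule continuous_on_eq) (simp add: \<beta>_def)
      show "continuous_on (?D - ball x0 \<delta>) \<beta>"
        by (rule continuous_on_eq[OF continuous_on_const[of _ "- \<eta>"]]) (simp add: \<beta>_far)
    qed
    moreover have "(?D \<inter> cball x0 \<delta>) \<union> (?D - ball x0 \<delta>) = ?D" by auto
    ultimately show ?thesis by simp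
  qed
  have ge: "\<beta> x \<ge> - \<eta>" for x by (simp add: \<beta>_def)
  have "sphere_subharmonic_on \<beta> ?D"
  proof (rule sphere_subharmonic_onI[OF D \<beta>c])
    fix b z assume z: "chart b z \<in> ?D"
    have \<beta>c': "continuous_on {z. chart b z \<in> ?D} (\<lambda>z. \<beta> (chart b z))"
      by (rule continuous_on_compose2[OF \<beta>c continuous_on_chart]) auto
    show "locally_submean (\<lambda>z. \<beta> (chart b z)) z"
    \<comment> \<open>Where \<open>\<beta>\<close> takes its least value it is a majorant of a
      constant touching it; elsewhere it is locally a majorant of the harmonic \<open>q\<close>
      touching it.\<close>
    proof (cases "\<beta> (chart b z) = - \<eta>")
      case True
      show ?thesis
        by (rule locally_submean_le[of "\<lambda>_. - \<eta>" z "{z. chart b z \<in> ?D}"])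
           (use z ge True \<beta>c' open_chart_vimage[OF D] in \<open>auto simp: locally_submean_def\<close>)
    next
      case False
      then have near: "dist x0 (chart b z) < \<delta>" using \<beta>_far[OF z] by force
      obtain w where w: "R (chart b z) = Fin w" using z by (auto simp: disc_preimage_iff)
      obtain f e where f: "e > 0" "f holomorphic_on ball z e" "\<And>y. y \<in> ball z e \<Longrightarrow> R (chart b y) = Fin (f y)"
        using hol[OF w] by blast
      have "re_limit (\<lambda>y. Re (cnj c * f y - 1)) (ball z e)"
        unfolding re_limit_def
        by (intro exI[of _ "\<lambda>_ y. cnj c * f y - 1"] conjI allI holomorphic_intros f uniform_limit_const)
      then have "re_limit (\<lambda>y. q (chart b y)) (ball z e)"
        by (rule re_limit_cong) (simp add: q_def f(3))
      then have qs: "locally_submean (\<lambda>y. q (chart b y)) z"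
        by (rule re_limit_locally_submean) (use f(1) in auto)
      let ?U = "{y. chart b y \<in> ?D \<inter> ball x0 \<delta>}"
      show ?thesis
      proof (rule locally_submean_le[OF qs, of ?U])
        show "open ?U" by (intro open_chart_vimage open_Int D open_ball)
        show "z \<in> ?U" using z near by simp
        show "continuous_on ?U (\<lambda>y. q (chart b y))"
          by (rule continuous_on_compose2[OF qc continuous_on_chart]) (use DS in auto)
        show "continuous_on ?U (\<lambda>y. \<beta> (chart b y))"
          by (rule continuous_on_subset[OF \<beta>c']) auto
        show "q (chart b y) \<le> \<beta> (chart b y)" if "y \<in> ?U" for y
          using that by (simp add: \<beta>_def)
        show "\<beta> (chart b z) = q (chart b z)"
          using False near by (auto simp: \<beta>_def max_def)
      qed
    qed
  qed
  moreover have "\<beta> x \<le> 0" if "x \<in> ?D" for x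
    using q_le[OF subsetD[OF DS that]] \<eta>(1) by (simp add: \<beta>_def)
  moreover have "\<beta> x = - \<eta>" if "dist x0 x > \<delta>" for x using that by (simp add: \<beta>_def)
  moreover have "\<forall>\<^sub>F x in at x0 within ?D. \<beta> x > - e" if e: "e > 0" for e
  proof -
    have x0S: "x0 \<in> ?S" using c by simp
    have "(q \<longlongrightarrow> q x0) (at x0 within ?S)" using qc x0S by (simp add: continuous_on_def)
    then have "(q \<longlongrightarrow> q x0) (at x0 within ?D)" by (rule tendsto_within_subset[OF _ DS])
    moreover have "q x0 = 0" using c(2) cc by (simp add: q_def)
    ultimately have "\<forall>\<^sub>F x in at x0 within ?D. q x > - e" using e by (intro order_tendstoD(1)) auto
    moreover have "\<forall>\<^sub>F x in at x0 within ?D. dist x0 x < \<delta>"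
      using \<delta>(1) by (auto simp: eventually_at dist_commute)
    ultimately show ?thesis by eventually_elim (simp add: \<beta>_def less_max_iff_disj)
  qed
  ultimately show thesis using that[OF _ \<delta>(1,2) \<eta>(1)] by blast
qed

end

section \<open>Attained boundary values and the mean value identity for the trace\<close>

locale disc_dirichlet = rational_map +
  fixes \<phi> :: "riemann_sphere \<Rightarrow> real"
  assumes proper: "disc_preimage \<noteq> UNIV" and \<phi>: "continuous_on UNIV \<phi>"
begin

abbreviation "\<Omega> \<equiv> disc_preimage"

definition bound :: real where "bound = (SOME C. \<forall>x. \<bar>\<phi> x\<bar> \<le> C)"

lemma bound: "\<bar>\<phi> x\<bar> \<le> bound"
proof -
  have "bounded (\<phi> ` UNIV)" by (intro compact_imp_bounded compact_continuous_image \<phi> compact_riemann_sphere)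
  then have "\<exists>C. \<forall>x. \<bar>\<phi> x\<bar> \<le> C" by (auto simp: bounded_real)
  from someI_ex[OF this] show ?thesis by (simp add: bound_def)
qed

sublocale perron \<Omega> \<phi> bound
  by unfold_locales (simp_all add: open_disc_preimage proper bound)

text \<open>A member of the family is built from the barrier: close to \<open>x0\<close> on the
  frontier, continuity of \<open>\<phi>\<close> makes \<open>\<phi> x0 - e/2\<close> admissible, and
  further away a large multiple of the barrier pushes below \<open>- bound\<close>. At
  \<open>x0\<close> the barrier tends to 0.\<close>

lemma solution_lower:
  assumes x0: "x0 \<in> frontier \<Omega>" and e: "e > 0"
  shows "\<forall>\<^sub>F x in at x0 within \<Omega>. H x > \<phi> x0 - e"
proof -
  have "isCont \<phi> x0" using \<phi> by (simp add: continuous_on_eq_continuous_at)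
  then obtain \<delta>1 where \<delta>1: "\<delta>1 > 0" "\<And>x. dist x x0 < \<delta>1 \<Longrightarrow> dist (\<phi> x) (\<phi> x0) < e/2"
    using e unfolding continuous_at_eps_delta by (metis half_gt_zero)
  obtain \<beta> \<delta> \<eta> where \<beta>: "sphere_subharmonic_on \<beta> \<Omega>" "0 < \<delta>" "\<delta> < \<delta>1" "\<eta> > 0"
    "\<And>x. x \<in> \<Omega> \<Longrightarrow> \<beta> x \<le> 0" "\<And>x. dist x0 x > \<delta> \<Longrightarrow> \<beta> x = - \<eta>"
    "\<And>e. e > 0 \<Longrightarrow> \<forall>\<^sub>F x in at x0 within \<Omega>. \<beta> x > - e"
    using barrier[OF x0 \<delta>1(1)] by blast
  have B: "bound \<ge> 0" using bound[of x0] by linarith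
  \<comment> \<open>With \<open>K * \<eta> = 2 * bound\<close>, the value away from
    \<open>x0\<close> is \<open>\<phi> x0 - e/2 - 2 * bound\<close>, below every boundary
    value.\<close>
  define K where "K = 2 * bound / \<eta>"
  have K: "K \<ge> 0" "K * \<eta> = 2 * bound" using B \<beta>(4) by (auto simp: K_def)
  define u where "u x = (\<phi> x0 - e/2) + K * \<beta> x" for x
  have "sphere_subharmonic_on u \<Omega>"
    unfolding u_def
    by (intro sphere_subharmonic_on_add sphere_subharmonic_on_const sphere_subharmonic_on_cmult \<beta>(1) K(1) D(1))
  moreover have "upper_boundary \<Omega> u \<phi>"
    unfolding upper_boundary_def
  proof (intro ballI allI impI)
    fix \<zeta> and e' :: real assume \<zeta>: "\<zeta> \<in> frontier \<Omega>" "e' > 0"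
    show "\<forall>\<^sub>F x in at \<zeta> within \<Omega>. u x < \<phi> \<zeta> + e'"
    proof (cases "dist \<zeta> x0 < \<delta>1")
      case True
      have "\<forall>\<^sub>F x in at \<zeta> within \<Omega>. x \<in> \<Omega>" by (simp add: eventually_at_filter)
      then show ?thesis
      proof eventually_elim
        case (elim x)
        have "K * \<beta> x \<le> 0" using K(1) \<beta>(5)[OF elim] by (rule mult_nonneg_nonpos)
        moreover have "\<phi> x0 - e/2 < \<phi> \<zeta>" using \<delta>1(2)[OF True] unfolding dist_real_def by linarith
        ultimately show ?case using \<zeta>(2) by (simp add: u_def)
      qed
    next
      case False
      then have "dist x0 \<zeta> > \<delta>" using \<beta>(3) by (simp add: dist_commute)
      then have "\<zeta> \<in> - cball x0 \<delta>" by simp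
      then have "\<forall>\<^sub>F x in at \<zeta> within \<Omega>. x \<in> - cball x0 \<delta>"
        by (intro eventually_at_topological[THEN iffD2] exI[of _ "- cball x0 \<delta>"]) auto
      then show ?thesis
      proof eventually_elim
        case (elim x)
        then have "\<beta> x = - \<eta>" by (intro \<beta>(6)) simp
        then have "u x = \<phi> x0 - e/2 - 2 * bound" using K(2) by (simp add: u_def)
        then show ?case using bound[of x0] bound[of \<zeta>] e \<zeta>(2) by linarith
      qed
    qed
  qed
  ultimately have "u \<in> F" by (simp add: mem_perron_family)
  \<comment> \<open>\<open>K\<close> may be 0, hence \<open>K + 1\<close>; multiplied by
    \<open>K\<close> this tolerance stays below \<open>e/2\<close>.\<close>
  have "e / (2 * (K + 1)) > 0" using e K(1) by simp
  from \<beta>(7)[OF this] have "\<forall>\<^sub>F x in at x0 within \<Omega>. \<beta> x > - (e / (2 * (K + 1)))" .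
  moreover have "\<forall>\<^sub>F x in at x0 within \<Omega>. x \<in> \<Omega>" by (simp add: eventually_at_filter)
  ultimately show ?thesis
  proof eventually_elim
    case (elim x)
    have "K * - (e / (2 * (K + 1))) \<le> K * \<beta> x" using elim(1) K(1) by (intro mult_left_mono) auto
    moreover have "K * (e / (2 * (K + 1))) < e/2" using K(1) e by (simp add: field_simps)
    ultimately have "u x > \<phi> x0 - e" by (simp add: u_def)
    then show ?case using mem_le_solution[OF \<open>u \<in> F\<close> elim(2)] by simp
  qed
qed

lemma disc_dirichlet_uminus: "disc_dirichlet R (\<lambda>x. - \<phi> x)"
  by unfold_locales (intro proper, intro continuous_intros \<phi>)

text \<open>The upper estimate is the lower one for \<open>- \<phi>\<close>, since by comparison the
  solution for \<open>\<phi>\<close> lies below the negative of the solution for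
  \<open>- \<phi>\<close>.\<close>

lemma solution_tendsto:
  assumes x0: "x0 \<in> frontier \<Omega>" shows "(H \<longlongrightarrow> \<phi> x0) (at x0 within \<Omega>)"
proof (rule order_tendstoI)
  fix a assume "a < \<phi> x0"
  then show "\<forall>\<^sub>F x in at x0 within \<Omega>. a < H x" using solution_lower[OF x0, of "\<phi> x0 - a"] by simp
next
  fix a assume a: "\<phi> x0 < a"
  interpret neg: disc_dirichlet R "\<lambda>x. - \<phi> x" by (rule disc_dirichlet_uminus)
  have "\<forall>\<^sub>F x in at x0 within \<Omega>. neg.H x > - \<phi> x0 - (a - \<phi> x0)"
    using neg.solution_lower[OF x0, of "a - \<phi> x0"] a by simp
  moreover have "\<forall>\<^sub>F x in at x0 within \<Omega>. x \<in> \<Omega>" by (simp add: eventually_at_filter)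
  ultimately show "\<forall>\<^sub>F x in at x0 within \<Omega>. H x < a"
  proof eventually_elim
    case (elim x)
    have "H x \<le> - neg.H x"
    proof (rule solution_le)
      fix u assume u: "u \<in> F"
      have "neg.H x \<le> - u x"
      proof (rule neg.solution_le)
        fix v assume v: "v \<in> neg.F"
        have "u x + v x \<le> 0"
          by (rule perron_comparison[OF D _ _ _ _ _ elim(2)]) (use u v in \<open>auto simp: mem_perron_family\<close>)
        then show "v x \<le> - u x" by simp
      qed
      then show "u x \<le> - neg.H x" by simp
    qed
    then show ?case using elim(1) by simp
  qed
qed

lemma solution_subharmonic: "sphere_subharmonic_on H \<Omega>" "sphere_subharmonic_on (\<lambda>x. - H x) \<Omega>"
  using sphere_harmonic_on_subharmonic[OF _ D(1)] sphere_harmonic_on_solution sphere_harmonic_on_uminus by auto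

definition extended :: "riemann_sphere \<Rightarrow> real" where
  "extended x = (if x \<in> \<Omega> then H x else \<phi> x)"

lemma extended_tendsto:
  assumes x: "x \<in> closure \<Omega>" shows "(extended \<longlongrightarrow> extended x) (at x within closure \<Omega>)"
proof (cases "x \<in> \<Omega>")
  case True
  have "isCont H x" using continuous_on_solution True D(1) by (simp add: continuous_on_eq_continuous_at)
  then have "(H \<longlongrightarrow> extended x) (at x within closure \<Omega>)"
    using True by (simp add: extended_def continuous_at_imp_continuous_at_within continuous_within[symmetric])
  moreover have "\<forall>\<^sub>F y in at x within closure \<Omega>. H y = extended y"
    using D(1) True by (intro eventually_at_topological[THEN iffD2] exI[of _ \<Omega>]) (auto simp: extended_def)
  ultimately show ?thesis by (rule Lim_transform_eventually)
next
  case False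
  then have xf: "x \<in> frontier \<Omega>" using x closure_eq_Un_frontier[of \<Omega>] by blast
  have 1: "(extended \<longlongrightarrow> \<phi> x) (at x within \<Omega>)"
    using solution_tendsto[OF xf]
    by (rule Lim_transform_eventually) (simp add: eventually_at_filter extended_def)
  have "isCont \<phi> x" using \<phi> by (simp add: continuous_on_eq_continuous_at)
  then have "(\<phi> \<longlongrightarrow> \<phi> x) (at x within - \<Omega>)"
    by (simp add: continuous_at_imp_continuous_at_within continuous_within[symmetric])
  then have 2: "(extended \<longlongrightarrow> \<phi> x) (at x within - \<Omega>)"
    by (rule Lim_transform_eventually) (simp add: eventually_at_filter extended_def)
  have "(extended \<longlongrightarrow> \<phi> x) (at x within (\<Omega> \<union> - \<Omega>))"
    using 1 2 by (rule Lim_Un)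
  then have "(extended \<longlongrightarrow> \<phi> x) (at x within closure \<Omega>)"
    by (rule tendsto_within_subset) auto
  then show ?thesis using False by (simp add: extended_def)
qed

text \<open>The trace of \<open>extended\<close> is continuous on the closed disc and has the local
  mean value property with equality inside, so it lies both below and above the Poisson integral of
  its boundary values. Evaluation at 0 gives the circle mean of the trace of
  \<open>\<phi>\<close>.\<close>

lemma push_eq_mean: "push H 0 = circle_mean (push \<phi>) 0 1"
proof -
  let ?\<Phi> = "push extended"
  have inn: "push extended w = push H w" if "norm w < 1" for w
    unfolding push_def using that by (intro sum.cong) (auto simp: extended_def disc_preimage_iff)
  have bd: "push extended w = push \<phi> w" if "norm w = 1" for w
    unfolding push_def using that by (intro sum.cong) (auto simp: extended_def disc_preimage_iff)
  have cl: "{y. \<exists>w\<in>cball 0 1. R y = Fin w} = closure \<Omega>"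
    unfolding closure_disc_preimage by auto
  have cont: "continuous_on (cball 0 1) ?\<Phi>"
    unfolding continuous_on_def
  proof
    fix c :: complex assume c: "c \<in> cball 0 1"
    show "(?\<Phi> \<longlongrightarrow> ?\<Phi> c) (at c within cball 0 1)"
    proof (rule push_tendsto)
      fix x assume "R x = Fin c"
      then have "x \<in> closure \<Omega>" using c cl by blast
      then show "(extended \<longlongrightarrow> extended x) (at x within {y. \<exists>w\<in>cball 0 1. R y = Fin w})"
        unfolding cl by (rule extended_tendsto)
    qed
  qed
  have mean: "\<forall>\<^sub>F r in at_right 0. circle_mean ?\<Phi> c r = ?\<Phi> c" if c: "c \<in> ball 0 1" for c
  proof -
    have "\<forall>\<^sub>F r in at_right 0. circle_mean (push H) c r = push H c"
      by (rule push_circle_mean[OF D(1) sphere_harmonic_on_solution])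
         (use c in \<open>auto simp: disc_preimage_iff\<close>)
    then show ?thesis
      using eventually_cball_subset[OF open_ball c]
    proof eventually_elim
      case (elim r)
      have "circle_mean ?\<Phi> c r = circle_mean (push H) c r"
        by (rule circle_mean_cong) (use elim(2) in \<open>auto intro!: inn simp: subset_iff\<close>)
      then show ?case using elim(1) inn[of c] c by simp
    qed
  qed
  have cs: "continuous_on (sphere 0 1) ?\<Phi>" by (rule continuous_on_subset[OF cont]) auto
  have "?\<Phi> 0 \<le> poisson ?\<Phi> 0 1 0"
    by (rule le_poisson[OF cs _ cont])
       (auto simp: locally_submean_def intro!: eventually_mono[OF mean])
  moreover have "poisson ?\<Phi> 0 1 0 \<le> ?\<Phi> 0"
    by (rule poisson_le[OF cs _ cont])
       (auto simp: locally_submean_def circle_mean_uminus intro!: eventually_mono[OF mean])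
  moreover have "poisson ?\<Phi> 0 1 0 = circle_mean ?\<Phi> 0 1" by (rule poisson_center[OF cs]) simp
  moreover have "circle_mean ?\<Phi> 0 1 = circle_mean (push \<phi>) 0 1"
    by (rule circle_mean_cong) (auto simp: bd)
  ultimately show ?thesis using inn[of 0] by simp
qed

end

text \<open>On the unit circle inversion is the reflection \<open>t \<mapsto> 2 * pi - t\<close> of
  the parameter.\<close>

lemma circle_mean_inverse: "circle_mean (\<lambda>w. f (inverse w)) 0 1 = circle_mean f 0 1"
proof -
  let ?g = "\<lambda>t::real. f (exp (\<i> * of_real t))"
  have "integral {0..2*pi} (\<lambda>t. ?g (- t + 2 * pi)) = integral {0..2*pi} ?g"
  proof (cases "?g integrable_on {0..2*pi}")
    case True
    then have "(?g has_integral integral {0..2*pi} ?g) (cbox 0 (2*pi))" by (simp add: integrable_integral)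
    from has_integral_affinity[OF this, of "-1" "2*pi"]
    have "((\<lambda>t. ?g (- t + 2 * pi)) has_integral integral {0..2*pi} ?g) ((\<lambda>x. 2 * pi - x) ` {0..2*pi})"
      by (simp add: add.commute)
    moreover have "(\<lambda>x. 2 * pi - x) ` {0..2*pi} = {0..2*pi}" by simp
    ultimately show ?thesis by (simp add: integral_unique)
  next
    \<comment> \<open>Without integrability both integrals take the default value 0, since the
      reflection preserves integrability in either direction.\<close>
    case False
    have "\<not> (\<lambda>t. ?g (- t + 2 * pi)) integrable_on {0..2*pi}"
    proof
      assume "(\<lambda>t. ?g (- t + 2 * pi)) integrable_on {0..2*pi}"
      then obtain I where "((\<lambda>t. ?g (- t + 2 * pi)) has_integral I) (cbox 0 (2*pi))" by auto
      from has_integral_affinity[OF this, of "-1" "2*pi"]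
      have "(?g has_integral I) ((\<lambda>x. 2 * pi - x) ` {0..2*pi})" by (simp add: add.commute)
      moreover have "(\<lambda>x. 2 * pi - x) ` {0..2*pi} = {0..2*pi}" by simp
      ultimately show False using False by auto
    qed
    then show ?thesis using False by (simp add: not_integrable_integral)
  qed
  moreover have "?g (- t + 2 * pi) = f (inverse (exp (\<i> * of_real t)))" for t
  proof -
    have "exp (\<i> * of_real (- t + 2 * pi)) = cis (- t)"
      unfolding cis_conv_exp[symmetric] by (simp add: complex_eq_iff)
    also have "\<dots> = inverse (exp (\<i> * of_real t))"
      unfolding cis_conv_exp[symmetric] by simp
    finally show ?thesis by simp
  qed
  ultimately show ?thesis by (simp add: circle_mean_def)
qed

text \<open>The fibre of the reciprocal over \<open>w\<close> is the fibre of \<open>R\<close> over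
  \<open>inverse w\<close>, and local degrees agree there because the value is finite and
  nonzero.\<close>

lemma (in rational_map) push_inverse:
  assumes "norm w = 1"
  shows "rational_map.push (\<lambda>x. sphere_inverse (R x)) \<phi> w = push \<phi> (inverse w)"
proof -
  interpret inv: rational_map "\<lambda>x. sphere_inverse (R x)"
    by (rule rational_map_inverse) (rule rational_map_axioms)
  have w: "w \<noteq> 0" using assms by auto
  have iff: "sphere_inverse (R x) = Fin w \<longleftrightarrow> R x = Fin (inverse w)" for x
  proof -
    have "sphere_inverse (R x) = Fin w \<longleftrightarrow> R x = sphere_inverse (Fin w)"
      by (metis sphere_inverse_involution)
    then show ?thesis using w by simp
  qed
  show ?thesis
    unfolding push_def inv.push_def iff
    by (intro sum.cong refl) (use fibre_mult_inverse w in simp)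
qed

section \<open>Harmonic measure\<close>

lemma open_connected_component_sphere:
  fixes D :: "riemann_sphere set"
  assumes D: "open D" shows "open (connected_component_set D a)"
proof (rule Topological_Spaces.openI)
  fix x assume x: "x \<in> connected_component_set D a"
  obtain b z where xz: "x = chart b z" by (rule chart_cover)
  have "chart b z \<in> D" using x xz connected_component_subset by blast
  then obtain r where r: "r > 0" "cball z r \<subseteq> {z. chart b z \<in> D}" using chart_cball[OF D] by blast
  have sub: "chart b ` ball z r \<subseteq> D" using r(2) ball_subset_cball by blast
  have "connected (chart b ` ball z r)"
    by (intro connected_continuous_image continuous_on_chart connected_ball)
  then have "chart b ` ball z r \<subseteq> connected_component_set D x"
    using sub r(1) xz by (intro connected_component_maximal) auto
  also have "\<dots> = connected_component_set D a"
    using x by (metis connected_component_eq)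
  finally show "\<exists>T. open T \<and> x \<in> T \<and> T \<subseteq> connected_component_set D a"
    using r(1) xz by (intro exI[of _ "chart b ` ball z r"]) (simp add: open_chart_image)
qed

text \<open>A frontier point inside \<open>D\<close> would have an open component of its own meeting
  the closure of the given one; the two would coincide, and an open set contains none of its
  frontier points.\<close>

lemma frontier_connected_component_sphere:
  fixes D :: "riemann_sphere set"
  assumes D: "open D" shows "frontier (connected_component_set D a) \<subseteq> frontier D"
proof
  fix \<zeta> assume z: "\<zeta> \<in> frontier (connected_component_set D a)"
  have cl: "\<zeta> \<in> closure (connected_component_set D a)" using z by (simp add: frontier_def)
  have "\<zeta> \<notin> D"
  proof
    assume "\<zeta> \<in> D"
    then have "\<zeta> \<in> connected_component_set D \<zeta>" by (simp add: connected_component_refl)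
    then have "connected_component_set D \<zeta> \<inter> connected_component_set D a \<noteq> {}"
      using cl open_connected_component_sphere[OF D, of \<zeta>]
      by (metis IntI Int_commute empty_iff open_Int_closure_eq_empty)
    then have "connected_component_set D \<zeta> = connected_component_set D a"
      by (metis connected_component_nonoverlap)
    then have "\<zeta> \<in> connected_component_set D a"
      using \<open>\<zeta> \<in> connected_component_set D \<zeta>\<close> by simp
    then show False
      using frontier_open_disjoint[OF open_connected_component_sphere[OF D] z] by contradiction
  qed
  moreover have "\<zeta> \<in> closure D" using cl closure_mono[OF connected_component_subset[of D a]] by blast
  ultimately show "\<zeta> \<in> frontier D" using closure_eq_Un_frontier[of D] by blast
qed

text \<open>Harmonic measure is tested on functions continuous on a frontier only, whereas the
  solutions are studied for data on the whole sphere. The extension is made in the Euclidean space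
  around the embedded sphere.\<close>

lemma Tietze_riemann_sphere:
  fixes \<phi> :: "riemann_sphere \<Rightarrow> real"
  assumes F: "closed F" and \<phi>: "continuous_on F \<phi>"
  obtains \<phi>' where "continuous_on UNIV \<phi>'" "\<And>x. x \<in> F \<Longrightarrow> \<phi>' x = \<phi> x"
proof -
  define g where "g = inv stereographic"
  have g: "g (stereographic x) = x" for x by (simp add: g_def inj_stereographic)
  have "continuous_on (range stereographic) g"
    unfolding continuous_on_iff by (auto simp: g dist_riemann_sphere_def)
  then have cg: "continuous_on (stereographic ` F) g" by (rule continuous_on_subset) auto
  have "continuous_on (stereographic ` F) (\<lambda>y. \<phi> (g y))"
    by (rule continuous_on_compose2[OF \<phi> cg]) (auto simp: g)
  moreover have "compact (stereographic ` F)"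
    by (intro compact_continuous_image continuous_on_stereographic compact_riemann_sphere_closed F)
  then have "closedin (top_of_set UNIV) (stereographic ` F)" by (simp add: compact_imp_closed)
  ultimately obtain h where h: "continuous_on UNIV h" "\<And>y. y \<in> stereographic ` F \<Longrightarrow> h y = \<phi> (g y)"
    using Tietze_unbounded[of "stereographic ` F" "\<lambda>y. \<phi> (g y)" UNIV] by blast
  show thesis
  proof (rule that)
    show "continuous_on UNIV (\<lambda>x. h (stereographic x))"
      by (rule continuous_on_compose2[OF h(1) continuous_on_stereographic]) auto
  qed (use h(2) g in auto)
qed

text \<open>Restricted to the component, the solution on all of \<open>\<Omega>\<close> remains
  harmonic with the right boundary values, so it is the Perron solution there.\<close>

lemma (in disc_dirichlet) solution_component:
  assumes a: "a \<in> \<Omega>" and eq: "\<And>\<zeta>. \<zeta> \<in> frontier (connected_component_set \<Omega> a) \<Longrightarrow> \<psi> \<zeta> = \<phi> \<zeta>"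
  shows "perron_solution (connected_component_set \<Omega> a) \<psi> a = H a"
proof (rule perron_solution_eqI)
  let ?D = "connected_component_set \<Omega> a"
  have sub: "?D \<subseteq> \<Omega>" by (rule connected_component_subset)
  show "open ?D" by (rule open_connected_component_sphere[OF D(1)])
  show "?D \<noteq> UNIV" using sub proper by blast
  show "sphere_subharmonic_on H ?D" "sphere_subharmonic_on (\<lambda>x. - H x) ?D"
    by (rule sphere_subharmonic_on_subset[OF _ sub], rule solution_subharmonic)+
  show "a \<in> ?D" using a by (simp add: connected_component_refl)
  fix \<zeta> assume z: "\<zeta> \<in> frontier ?D"
  then have "\<zeta> \<in> frontier \<Omega>" using frontier_connected_component_sphere[OF D(1)] by blast
  then show "(H \<longlongrightarrow> \<psi> \<zeta>) (at \<zeta> within ?D)"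
    unfolding eq[OF z] by (intro tendsto_within_subset[OF solution_tendsto sub])
qed

section \<open>Existence and uniqueness of harmonic measure at a point\<close>

locale disc_point = rational_map +
  fixes a :: riemann_sphere
  assumes proper: "disc_preimage \<noteq> UNIV" and a: "a \<in> disc_preimage"
begin

lemma disc_dirichletI: "continuous_on UNIV \<phi> \<Longrightarrow> disc_dirichlet R \<phi>"
  by unfold_locales (auto simp: proper)

abbreviation "\<Lambda> \<equiv> \<lambda>\<phi>. perron_solution disc_preimage \<phi> a"

lemma solution_eqI:
  assumes "sphere_subharmonic_on h disc_preimage" "sphere_subharmonic_on (\<lambda>x. - h x) disc_preimage"
    and "\<And>\<zeta>. \<zeta> \<in> frontier disc_preimage \<Longrightarrow> (h \<longlongrightarrow> \<psi> \<zeta>) (at \<zeta> within disc_preimage)"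
  shows "\<Lambda> \<psi> = h a"
  by (rule perron_solution_eqI[OF open_disc_preimage proper assms a])

text \<open>Boundary values are attained, so sums and multiples of solutions are again harmonic with
  the expected boundary values, and \<open>solution_eqI\<close> identifies them.\<close>

lemma positive_functional_solution: "positive_functional \<Lambda>"
proof
  show "compact (UNIV :: riemann_sphere set)" by (rule compact_riemann_sphere)
  fix f :: "riemann_sphere \<Rightarrow> real" assume f: "continuous_on UNIV f"
  interpret f: disc_dirichlet R f by (rule disc_dirichletI[OF f])
  note O = open_disc_preimage
  show "\<Lambda> (\<lambda>x. f x + g x) = \<Lambda> f + \<Lambda> g" if g: "continuous_on UNIV g" for g
  proof -
    interpret g: disc_dirichlet R g by (rule disc_dirichletI[OF g])
    show ?thesis
    proof (rule solution_eqI)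
      show "sphere_subharmonic_on (\<lambda>x. f.H x + g.H x) disc_preimage"
        by (intro sphere_subharmonic_on_add f.solution_subharmonic g.solution_subharmonic O)
      have "sphere_subharmonic_on (\<lambda>x. - f.H x + - g.H x) disc_preimage"
        by (intro sphere_subharmonic_on_add f.solution_subharmonic g.solution_subharmonic O)
      then show "sphere_subharmonic_on (\<lambda>x. - (f.H x + g.H x)) disc_preimage" by simp
    qed (intro tendsto_intros f.solution_tendsto g.solution_tendsto)
  qed
  show "\<Lambda> (\<lambda>x. c * f x) = c * \<Lambda> f" for c
  proof (rule solution_eqI)
    \<comment> \<open>A negative factor is moved onto the negative of the solution, which is
      subharmonic as well.\<close>
    have *: "sphere_subharmonic_on (\<lambda>x. k * f.H x) disc_preimage" for k
    proof (cases "k \<ge> 0")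
      case True
      then show ?thesis by (intro sphere_subharmonic_on_cmult f.solution_subharmonic O)
    next
      case False
      then have "sphere_subharmonic_on (\<lambda>x. (- k) * (- f.H x)) disc_preimage"
        by (intro sphere_subharmonic_on_cmult f.solution_subharmonic O) simp
      then show ?thesis by simp
    qed
    show "sphere_subharmonic_on (\<lambda>x. c * f.H x) disc_preimage" by (rule *)
    show "sphere_subharmonic_on (\<lambda>x. - (c * f.H x)) disc_preimage" using *[of "- c"] by simp
  qed (intro tendsto_intros f.solution_tendsto)
  show "\<Lambda> f \<ge> 0" if "\<And>x. f x \<ge> 0"
  proof -
    have "(\<lambda>_. 0) \<in> f.F"
      unfolding mem_perron_family upper_boundary_def
      using that by (auto intro!: sphere_subharmonic_on_const O always_eventually add_nonneg_pos)
    then show ?thesis using f.mem_le_solution a by blast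
  qed
qed

sublocale functional: positive_functional \<Lambda> by (rule positive_functional_solution)

abbreviation "\<mu> \<equiv> functional.representing_measure"
abbreviation "component \<equiv> connected_component_set disc_preimage a"

lemma solution_one: "\<Lambda> (\<lambda>_. 1) = 1"
  by (rule solution_eqI[of "\<lambda>_. 1"]) (auto intro!: sphere_subharmonic_on_const open_disc_preimage)

lemma component_solution:
  assumes "continuous_on UNIV \<phi>" "\<And>\<zeta>. \<zeta> \<in> frontier component \<Longrightarrow> \<psi> \<zeta> = \<phi> \<zeta>"
  shows "perron_solution component \<psi> a = \<Lambda> \<phi>"
  by (rule disc_dirichlet.solution_component[OF disc_dirichletI[OF assms(1)] a assms(2)])

lemma frontier_component_ne: "frontier component \<noteq> {}"
proof
  assume e: "frontier component = {}"
  have o: "open component" by (rule open_connected_component_sphere[OF open_disc_preimage])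
  have "closed component" using e closure_eq_Un_frontier[of component] by (metis closed_closure sup_bot.right_neutral)
  then have "component = {} \<or> component = UNIV"
    using o connected_riemann_sphere connected_clopen[of "UNIV :: riemann_sphere set"] by auto
  moreover have "a \<in> component" using a by (simp add: connected_component_refl)
  moreover have "component \<subseteq> disc_preimage" by (rule connected_component_subset)
  ultimately show False using proper by blast
qed

text \<open>The distance to the frontier of the component has zero boundary values there, so its
  solution at \<open>a\<close> is that of 0. Its integral against \<open>\<mu>\<close> therefore
  vanishes, and \<open>\<mu>\<close> is concentrated where the distance is 0.\<close>

lemma AE_frontier_component: "AE x in \<mu>. x \<in> frontier component"
proof -
  let ?F = "frontier component"
  have c: "continuous_on UNIV (\<lambda>x. infdist x ?F)" by (intro continuous_intros)
  have "perron_solution component (\<lambda>_. 0) a = \<Lambda> (\<lambda>x. infdist x ?F)"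
    by (rule component_solution[OF c]) simp
  moreover have "perron_solution component (\<lambda>_. 0) a = \<Lambda> (\<lambda>x. 0)"
    by (rule component_solution) auto
  ultimately have "(\<integral>x. infdist x ?F \<partial>\<mu>) = 0"
    using functional.integral_representing[OF c] functional.zero by simp
  then have "AE x in \<mu>. infdist x ?F = 0"
    using integral_nonneg_eq_0_iff_AE[OF functional.integrable_continuous[OF c]] by (simp add: infdist_nonneg)
  then show ?thesis
    by (rule AE_mp) (use in_closed_iff_infdist_zero[OF frontier_closed frontier_component_ne] in auto)
qed

text \<open>Restriction loses no mass by \<open>AE_frontier_component\<close>, and boundary data are
  extended to the sphere before \<open>\<mu>\<close> is applied.\<close>

lemma is_harmonic_measure_restrict:
  "is_harmonic_measure component a (restrict_space \<mu> (frontier component))"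
  unfolding is_harmonic_measure_def
proof (intro conjI allI impI)
  let ?F = "frontier component"
  have F: "?F \<in> sets \<mu>" by (simp add: borel_closed)
  have "emeasure \<mu> ?F = emeasure \<mu> UNIV"
    by (rule emeasure_eq_AE) (use AE_frontier_component F in auto)
  also have "\<dots> = 1"
    by (simp add: functional.emeasure_representing functional.outer_UNIV solution_one)
  finally show "prob_space (restrict_space \<mu> ?F)"
    by (intro prob_spaceI) (use F in \<open>simp add: space_restrict_space emeasure_restrict_space\<close>)
  show "sets (restrict_space \<mu> ?F) = sets (restrict_space borel ?F)"
    by (rule sets_restrict_space_cong) simp
  fix \<phi> :: "riemann_sphere \<Rightarrow> real" assume \<phi>: "continuous_on ?F \<phi>"
  obtain \<phi>' where \<phi>': "continuous_on UNIV \<phi>'" "\<And>x. x \<in> ?F \<Longrightarrow> \<phi>' x = \<phi> x"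
    using Tietze_riemann_sphere[OF frontier_closed \<phi>] by blast
  have m: "\<phi>' \<in> borel_measurable \<mu>"
    using borel_measurable_continuous_onI[OF \<phi>'(1)] by (simp cong: measurable_cong_sets)
  have "(\<integral>x. \<phi> x \<partial>restrict_space \<mu> ?F) = (\<integral>x. \<phi>' x \<partial>restrict_space \<mu> ?F)"
    by (rule Bochner_Integration.integral_cong) (use \<phi>'(2) in \<open>auto simp: space_restrict_space\<close>)
  also have "\<dots> = (\<integral>x. indicator ?F x *\<^sub>R \<phi>' x \<partial>\<mu>)"
    by (rule integral_restrict_space) (use F in simp)
  also have "\<dots> = (\<integral>x. \<phi>' x \<partial>\<mu>)"
  proof (rule integral_cong_AE[OF _ m])
    show "(\<lambda>x. indicator ?F x *\<^sub>R \<phi>' x) \<in> borel_measurable \<mu>"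
      by (intro borel_measurable_scaleR borel_measurable_indicator F m)
    show "AE x in \<mu>. indicator ?F x *\<^sub>R \<phi>' x = \<phi>' x"
      using AE_frontier_component by eventually_elim simp
  qed
  also have "\<dots> = \<Lambda> \<phi>'" by (rule functional.integral_representing[OF \<phi>'(1)])
  also have "\<dots> = perron_solution component \<phi> a"
    using component_solution[OF \<phi>'(1), of \<phi>] \<phi>'(2) by simp
  finally show "perron_solution component \<phi> a = (\<integral>x. \<phi> x \<partial>restrict_space \<mu> ?F)" by simp
qed

text \<open>Any candidate has the same integrals of continuous functions as \<open>\<mu>\<close>.
  With existence, this gives the \<open>THE\<close> in \<open>harmonic_measure\<close> its
  meaning.\<close>

lemma is_harmonic_measure_unique:
  assumes \<nu>: "is_harmonic_measure component a \<nu>"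
  shows "\<nu> = restrict_space \<mu> (frontier component)"
proof -
  let ?F = "frontier component"
  interpret prob_space \<nu> using \<nu> by (simp add: is_harmonic_measure_def)
  interpret \<mu>: finite_measure \<mu> by (rule functional.finite_measure_representing)
  have sets_\<nu>: "sets \<nu> = sets (restrict_space borel ?F)" using \<nu> by (simp add: is_harmonic_measure_def)
  \<comment> \<open>The candidate lives on the subspace \<open>?F\<close>; its image under the
    inclusion is a Borel measure on the sphere, comparable with \<open>\<mu>\<close>.\<close>
  have id: "(\<lambda>x. x) \<in> measurable \<nu> borel"
    using measurable_restrict_space1[of "\<lambda>x. x" borel borel ?F]
    by (simp add: measurable_cong_sets[OF sets_\<nu> refl])
  have F: "?F \<in> sets borel" by (simp add: borel_closed)
  have eq: "measure (distr \<nu> borel (\<lambda>x. x)) A = measure \<mu> A" if A: "A \<in> sets borel" for A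
  proof -
    have "(\<Sum>i\<in>{()}. measure (distr \<nu> borel (\<lambda>x. x)) A) = (\<Sum>i\<in>{()}. measure \<mu> A)"
    proof (rule measure_eq_of_continuous_integrals)
      show "finite_measure (distr \<nu> borel (\<lambda>x. x))" by (rule finite_measure_distr[OF id])
      fix f :: "riemann_sphere \<Rightarrow> real" assume f: "continuous_on UNIV f"
      have "(\<integral>x. f x \<partial>distr \<nu> borel (\<lambda>x. x)) = (\<integral>x. f x \<partial>\<nu>)"
        by (rule integral_distr[OF id borel_measurable_continuous_onI[OF f]])
      also have "\<dots> = perron_solution component f a"
        using \<nu> continuous_on_subset[OF f] by (simp add: is_harmonic_measure_def)
      also have "\<dots> = \<Lambda> f" by (rule component_solution[OF f]) simp
      also have "\<dots> = (\<integral>x. f x \<partial>\<mu>)" by (rule functional.integral_representing[OF f, symmetric])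
      finally show "(\<Sum>i\<in>{()}. \<integral>x. f x \<partial>distr \<nu> borel (\<lambda>x. x)) = (\<Sum>i\<in>{()}. \<integral>x. f x \<partial>\<mu>)" by simp
    qed (use A functional.finite_measure_representing in simp_all)
    then show ?thesis by simp
  qed
  show ?thesis
  proof (rule measure_eqI)
    show "sets \<nu> = sets (restrict_space \<mu> ?F)"
      unfolding sets_\<nu> by (rule sets_restrict_space_cong) simp
    fix A assume A: "A \<in> sets \<nu>"
    then have A': "A \<in> sets borel" "A \<subseteq> ?F"
      using F by (simp_all add: sets_\<nu> sets_restrict_space_iff)
    have "A \<subseteq> space \<nu>" using A sets.sets_into_space by blast
    then have "emeasure (distr \<nu> borel (\<lambda>x. x)) A = emeasure \<nu> A"
      using A' id by (simp add: emeasure_distr Int_absorb2)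
    moreover have "emeasure (distr \<nu> borel (\<lambda>x. x)) A = emeasure \<mu> A"
      using eq[OF A'(1)] finite_measure.emeasure_eq_measure[OF finite_measure_distr[OF id]]
        \<mu>.emeasure_eq_measure by simp
    ultimately show "emeasure \<nu> A = emeasure (restrict_space \<mu> ?F) A"
      using F A'(2) by (simp add: emeasure_restrict_space)
  qed
qed

lemma harmonic_measure_eq:
  assumes E: "E \<in> sets borel" shows "harmonic_measure disc_preimage a E = measure \<mu> E"
proof -
  let ?F = "frontier component"
  have F: "?F \<in> sets \<mu>" by (simp add: borel_closed)
  have "(THE \<nu>. is_harmonic_measure component a \<nu>) = restrict_space \<mu> ?F"
    using is_harmonic_measure_restrict is_harmonic_measure_unique by (rule the_equality)
  then have "harmonic_measure disc_preimage a E = measure (restrict_space \<mu> ?F) (E \<inter> ?F)"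
    by (simp add: harmonic_measure_def Let_def)
  also have "\<dots> = measure \<mu> (E \<inter> ?F)" by (rule measure_restrict_space) (use F in auto)
  also have "\<dots> = measure \<mu> E"
    by (rule measure_eq_AE) (use AE_frontier_component E F in auto)
  finally show ?thesis .
qed

end

text \<open>Grouping the indices by the point that they enumerate turns the sum over the list into
  the trace at 0, the group sizes being the multiplicities.\<close>

lemma (in rational_map) sum_over_zeros:
  fixes d :: nat and \<zeta> :: "nat \<Rightarrow> riemann_sphere"
  assumes z: "\<And>x. card {j \<in> {1..d}. \<zeta> j = x} = zero_multiplicity R x"
  shows "(\<Sum>j=1..d. g (\<zeta> j)) = push g 0" "\<And>j. j \<in> {1..d} \<Longrightarrow> R (\<zeta> j) = Fin 0"
proof -
  show R0: "R (\<zeta> j) = Fin 0" if "j \<in> {1..d}" for j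
  proof (rule ccontr)
    \<comment> \<open>Then the multiplicity at this point is 0, although \<open>j\<close> itself is
      counted there.\<close>
    assume "R (\<zeta> j) \<noteq> Fin 0"
    then have "card {i \<in> {1..d}. \<zeta> i = \<zeta> j} = 0" unfolding z by (simp add: zero_multiplicity_eq)
    moreover have "finite {i \<in> {1..d}. \<zeta> i = \<zeta> j}" by simp
    ultimately have "{i \<in> {1..d}. \<zeta> i = \<zeta> j} = {}" using card_0_eq by blast
    then show False using that by blast
  qed
  have "(\<Sum>j=1..d. g (\<zeta> j)) = (\<Sum>x | R x = Fin 0. \<Sum>j\<in>{j \<in> {1..d}. \<zeta> j = x}. g (\<zeta> j))"
    by (rule sum.group[symmetric]) (use R0 finite_fibre in auto)
  also have "\<dots> = (\<Sum>x | R x = Fin 0. real (card {j \<in> {1..d}. \<zeta> j = x}) * g x)"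
    by (intro sum.cong refl) simp
  also have "\<dots> = push g 0"
    unfolding push_def z by (intro sum.cong refl) (simp add: zero_multiplicity_eq)
  finally show "(\<Sum>j=1..d. g (\<zeta> j)) = push g 0" .
qed

theorem theorem3p1:
  fixes R :: "riemann_sphere \<Rightarrow> riemann_sphere" and d :: nat
    and \<zeta> p :: "nat \<Rightarrow> riemann_sphere"
    and \<Omega> E :: "riemann_sphere set"
  assumes "rational_function R d" and "d \<ge> 1"
    and "\<And>x. card {j \<in> {1..d}. \<zeta> j = x} = zero_multiplicity R x"
    and "\<And>x. card {i \<in> {1..d}. p i = x} = pole_multiplicity R x"
    and "\<Omega> = R -` (Fin ` ball 0 1)"
    and "E \<in> sets borel" and "E \<subseteq> frontier \<Omega>"
  shows "(\<Sum>i=1..d. harmonic_measure (UNIV - closure \<Omega>) (p i) E) =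
         (\<Sum>j=1..d. harmonic_measure \<Omega> (\<zeta> j) E)"
proof -
  interpret rational_map R by (rule rational_function_imp_rational_map[OF assms(1,2)])
  interpret inv: rational_map "\<lambda>x. sphere_inverse (R x)"
    by (rule rational_map_inverse[OF rational_map_axioms])
  have \<Omega>: "\<Omega> = disc_preimage" by (simp add: assms(5) disc_preimage_def)
  have \<Omega>': "UNIV - closure \<Omega> = inv.disc_preimage"
    unfolding \<Omega> complement_disc_preimage inv.disc_preimage_def ..
  have poles: "card {i \<in> {1..d}. p i = x} = zero_multiplicity (\<lambda>x. sphere_inverse (R x)) x" for x
    using assms(4) by (simp add: pole_multiplicity_def comp_def)
  note zeros = sum_over_zeros[of d \<zeta>, OF assms(3)] and inv_zeros = inv.sum_over_zeros[of d p, OF poles]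
  \<comment> \<open>Since \<open>d \<ge> 1\<close> the list of poles is nonempty, and a pole lies
    outside \<open>\<Omega>\<close>. In the same way a zero lies outside the exterior, so the
    maximum principle applies on both sides.\<close>
  have proper: "disc_preimage \<noteq> UNIV"
  proof -
    have "sphere_inverse (R (p 1)) = Fin 0" using inv_zeros(2)[of 1] assms(2) by simp
    then have "R (p 1) = Infty" by (metis sphere_inverse.simps(2) sphere_inverse_involution)
    then have "p 1 \<notin> disc_preimage" by (simp add: disc_preimage_iff)
    then show ?thesis by blast
  qed
  have inv_proper: "inv.disc_preimage \<noteq> UNIV"
  proof -
    have "sphere_inverse (R (\<zeta> 1)) = Infty" using zeros(2)[of 1] assms(2) by simp
    then have "\<zeta> 1 \<notin> inv.disc_preimage" by (simp add: inv.disc_preimage_iff)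
    then show ?thesis by blast
  qed
  have pt: "disc_point R (\<zeta> j)" if "j \<in> {1..d}" for j
    by unfold_locales (use proper zeros(2)[OF that] in \<open>auto simp: disc_preimage_iff\<close>)
  have inv_pt: "disc_point (\<lambda>x. sphere_inverse (R x)) (p i)" if "i \<in> {1..d}" for i
    by unfold_locales (use inv_proper inv_zeros(2)[OF that] in \<open>auto simp: inv.disc_preimage_iff\<close>)
  \<comment> \<open>Unlike the harmonic measures, these measures live on the whole sphere, so all of
    them can be tested against the same continuous functions.\<close>
  define M where "M j = positive_functional.representing_measure (\<lambda>\<phi>. perron_solution disc_preimage \<phi> (\<zeta> j))" for j
  define N where "N i = positive_functional.representing_measure (\<lambda>\<phi>. perron_solution inv.disc_preimage \<phi> (p i))" for i
  note pf = disc_point.positive_functional_solution[OF pt]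
    and inv_pf = disc_point.positive_functional_solution[OF inv_pt]
  have "(\<Sum>i\<in>{1..d}. measure (N i) E) = (\<Sum>j\<in>{1..d}. measure (M j) E)"
  proof (rule measure_eq_of_continuous_integrals)
    fix f :: "riemann_sphere \<Rightarrow> real" assume f: "continuous_on UNIV f"
    interpret f: disc_dirichlet R f by unfold_locales (rule proper f)+
    interpret inv_f: disc_dirichlet "\<lambda>x. sphere_inverse (R x)" f by unfold_locales (rule inv_proper f)+
    have "(\<Sum>i\<in>{1..d}. \<integral>x. f x \<partial>N i) = (\<Sum>i=1..d. inv_f.H (p i))"
      unfolding N_def by (intro sum.cong refl positive_functional.integral_representing[OF inv_pf f])
    also have "\<dots> = circle_mean (inv.push f) 0 1"
      unfolding inv_zeros(1) by (rule inv_f.push_eq_mean)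
    \<comment> \<open>The two sides meet here: the circle mean for the exterior is rewritten as one
      for \<open>R\<close> at inverse points, and inversion preserves circle means.\<close>
    also have "\<dots> = circle_mean (\<lambda>w. push f (inverse w)) 0 1"
      by (rule circle_mean_cong) (simp_all add: push_inverse)
    also have "\<dots> = circle_mean (push f) 0 1" by (rule circle_mean_inverse)
    also have "\<dots> = (\<Sum>j=1..d. f.H (\<zeta> j))"
      unfolding zeros(1) by (rule f.push_eq_mean[symmetric])
    also have "\<dots> = (\<Sum>j\<in>{1..d}. \<integral>x. f x \<partial>M j)"
      unfolding M_def by (intro sum.cong refl positive_functional.integral_representing[OF pf f, symmetric])
    finally show "(\<Sum>i\<in>{1..d}. \<integral>x. f x \<partial>N i) = (\<Sum>j\<in>{1..d}. \<integral>x. f x \<partial>M j)" .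
  qed (auto simp: M_def N_def assms(6) positive_functional.sets_representing[OF pf] positive_functional.sets_representing[OF inv_pf]
        positive_functional.finite_measure_representing[OF pf] positive_functional.finite_measure_representing[OF inv_pf])
  moreover have "harmonic_measure \<Omega> (\<zeta> j) E = measure (M j) E" if "j \<in> {1..d}" for j
    unfolding \<Omega> M_def by (rule disc_point.harmonic_measure_eq[OF pt[OF that] assms(6)])
  moreover have "harmonic_measure (UNIV - closure \<Omega>) (p i) E = measure (N i) E" if "i \<in> {1..d}" for i
    unfolding \<Omega>' N_def by (rule disc_point.harmonic_measure_eq[OF inv_pt[OF that] assms(6)])
  ultimately show ?thesis by simp
qed

end
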